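(* Let $r\in\mathbb{N}$, $\alpha\in\mathbb{R}$, $\mathbf{x}_0\in\mathbb{R}^n$, let $L$ be slowly varying at the origin, and suppose that an $(M,r)$-regular (resp. $r$-regular) MRA is given. Let $g\in\mathcal{K}'_{M,r}(\mathbb{R}^n)$ (resp. $g\in\mathcal{S}'_r(\mathbb{R}^n)$). Then a distribution $f\in\mathcal{K}'_{M,r}(\mathbb{R}^n)$ (resp. $f\in\mathcal{S}'_r(\mathbb{R}^n)$) satisfies $$\lim_{\varepsilon\to0^+}\frac{f(\mathbf{x}_0+\varepsilon\mathbf{x})}{\varepsilon^\alpha L(\varepsilon)}=g(\mathbf{x})\quad\text{weakly$^*$ in }\mathcal{K}'_{M,r}(\mathbb{R}^n)\ (\text{resp. }\mathcal{S}'_r(\mathbb{R}^n))$$ if and only if both of the following hold: $$\lim_{\varepsilon\to0^+}\frac{(q_{1/\varepsilon}f)(\mathbf{x}_0+\varepsilon\mathbf{x})}{\varepsilon^\alpha L(\varepsilon)}=g(\mathbf{x})\quad\text{weakly$^*$ in }\mathcal{K}'_{M,r}(\mathbb{R}^n)\ (\text{resp. }\mathcal{S}'_r(\mathbb{R}^n)),$$ and $$\langle f(\mathbf{x}_0+\varepsilon\mathbf{x}),\varphi(\mathbf{x})\rangle=O(\varepsilon^\alpha L(\varepsilon))\quad\text{as }\varepsilon\to0^+$$ for all $\varphi\in\mathcal{K}_{M,r}(\mathbb{R}^n)$ (resp. $\varphi\in\mathcal{S}_r(\mathbb{R}^n)$).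
   Context: $\mathbb{N}=\{0,1,2,\dots\}$. $M:[0,\infty)\to[0,\infty)$ is a continuous increasing function with $M(t)+M(s)\le M(t+s)$ and $M(t+s)\le M(2t)+M(2s)$ for all $t,s\ge0$; write $M(\mathbf{x})=M(|\mathbf{x}|)$ for $\mathbf{x}\in\mathbb{R}^n$. $\mathcal{K}_{M,r}(\mathbb{R}^n)$ is the Fréchet space of all $\varphi\in C^r(\mathbb{R}^n)$ such that for every $l\in\mathbb{N}$ the norm $\nu_{r,l}(\varphi)=\sup_{|\beta|\le r,\,\mathbf{x}\in\mathbb{R}^n}e^{M(l\mathbf{x})}|\varphi^{(\beta)}(\mathbf{x})|$ is finite, topologized by these norms. $\mathcal{S}_r(\mathbb{R}^n)$ is the Fréchet space of all $\varphi\in C^r(\mathbb{R}^n)$ such that for every $l\in\mathbb{N}$ the norm $\rho_{r,l}(\varphi)=\sup_{|\beta|\le r,\,\mathbf{x}\in\mathbb{R}^n}(1+|\mathbf{x}|)^l|\varphi^{(\beta)}(\mathbf{x})|$ is finite, topologized by these norms. $\mathcal{K}'_{M,r}$ and $\mathcal{S}'_r$ are the duals (spaces of distributions); weak$^*$ convergence means convergence when tested against each fixed $\varphi$ in the test space. $\langle f(\mathbf{x}_0+\varepsilon\mathbf{x}),\varphi(\mathbf{x})\rangle=\varepsilon^{-n}\langle f(\mathbf{y}),\varphi((\mathbf{y}-\mathbf{x}_0)/\varepsilon)\rangle$ for $\varepsilon>0$. $L$ slowly varying at the origin: $L$ is a measurable, real-valued, positive function on an interval $(0,A]$ with $\lim_{\varepsilon\to0^+}L(a\varepsilon)/L(\varepsilon)=1$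 for each $a>0$. MRA: an increasing sequence $\{V_j\}_{j\in\mathbb{Z}}$ of closed linear subspaces of $L^2(\mathbb{R}^n)$ such that (i) $f\in V_j\Leftrightarrow f(2\,\cdot)\in V_{j+1}$; (ii) $f\in V_0\Leftrightarrow f(\cdot-\mathbf{m})\in V_0$ for $\mathbf{m}\in\mathbb{Z}^n$; (iii) $\bigcap_jV_j=\{0\}$ and $\overline{\bigcup_jV_j}=L^2(\mathbb{R}^n)$; (iv) there is a scaling function $\phi\in L^2(\mathbb{R}^n)$ such that $\{\phi(\cdot-\mathbf{m})\}_{\mathbf{m}\in\mathbb{Z}^n}$ is an orthonormal basis of $V_0$. The MRA is $(M,r)$-regular (resp. $r$-regular) if the scaling function can be chosen in $\mathcal{K}_{M,r}(\mathbb{R}^n)$ (resp. $\mathcal{S}_r(\mathbb{R}^n)$); such a $\phi$ is then fixed. Put $q_0(\mathbf{x},\mathbf{y})=\sum_{\mathbf{m}\in\mathbb{Z}^n}\phi(\mathbf{x}-\mathbf{m})\overline{\phi(\mathbf{y}-\mathbf{m})}$ and, for $\lambda\in\mathbb{R}$, $q_\lambda(\mathbf{x},\mathbf{y})=2^{n\lambda}q_0(2^\lambda\mathbf{x},2^\lambda\mathbf{y})$ and $(q_\lambda f)(\mathbf{x})=\langle f(\mathbf{y}),q_\lambda(\mathbf{x},\mathbf{y})\rangle_{\mathbf{y}}$ (bilinear pairing), which is a continuous function of $\mathbf{x}$. Thus $q_{1/\varepsilon}$ is $q_\lambda$ with $\lambda=1/\varepsilon$, i.e. with kernel $2^{n/\varepsilon}q_0(2^{1/\varepsilon}\mathbf{x},2^{1/\varepsilon}\mathbf{y})$.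 *)

theory Defs
  imports "HOL-Analysis.Analysis" "HOL-Library.Landau_Symbols"
begin

section \<open>Functions of class \<open>C\<^sup>r\<close> and their partial derivatives\<close>

definition partial_deriv :: "'n::finite \<Rightarrow> (real^'n \<Rightarrow> complex) \<Rightarrow> real^'n \<Rightarrow> complex" where
  "partial_deriv i f x = vector_derivative (\<lambda>t. f (x + t *\<^sub>R axis i 1)) (at 0)"

primrec C_class :: "nat \<Rightarrow> (real^'n::finite \<Rightarrow> complex) \<Rightarrow> bool" where
  "C_class 0 f \<longleftrightarrow> continuous_on UNIV f"
| "C_class (Suc k) f \<longleftrightarrow> continuous_on UNIV f
     \<and> (\<forall>i x. (\<lambda>t::real. f (x + t *\<^sub>R axis i 1)) differentiable (at 0))
     \<and> (\<forall>i. C_class k (partial_deriv i f))"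

text \<open>A multi-index is a function \<open>\<beta> :: 'n \<Rightarrow> nat\<close>. As \<open>'n\<close> carries no order, the partial derivatives
  are taken along a fixed enumeration of the coordinates; for functions of class \<open>C\<^sup>r\<close> and
  \<open>|\<beta>| \<le> r\<close> the result does not depend on it.\<close>

definition coord_list :: "'n::finite list" where
  "coord_list = (SOME is. distinct is \<and> set is = UNIV)"

definition mi_order :: "('n::finite \<Rightarrow> nat) \<Rightarrow> nat" where
  "mi_order \<beta> = (\<Sum>i\<in>UNIV. \<beta> i)"

definition mi_deriv :: "('n::finite \<Rightarrow> nat) \<Rightarrow> (real^'n \<Rightarrow> complex) \<Rightarrow> real^'n \<Rightarrow> complex" where
  "mi_deriv \<beta> f = foldr (\<lambda>i h. (partial_deriv i ^^ \<beta> i) h) coord_list f"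


section \<open>Test function spaces, their topology and their duals\<close>

text \<open>The spaces \<open>\<K>\<^sub>M\<^sub>,\<^sub>r\<close> and \<open>\<S>\<^sub>r\<close> differ only in the weights \<open>w l\<close>
  (\<open>l \<in> \<nat>\<close>) that occur in the norms. The supremum is a real number; it is only meaningful for functions
  for which the set is bounded, which is what membership in the space demands.\<close>

definition wnorm_values ::
  "(nat \<Rightarrow> real^'n::finite \<Rightarrow> real) \<Rightarrow> nat \<Rightarrow> nat \<Rightarrow> (real^'n \<Rightarrow> complex) \<Rightarrow> real set" where
  "wnorm_values w r l \<phi> = {w l x * cmod (mi_deriv \<beta> \<phi> x) | \<beta> x. mi_order \<beta> \<le> r}"

definition wnorm ::
  "(nat \<Rightarrow> real^'n::finite \<Rightarrow> real) \<Rightarrow> nat \<Rightarrow> nat \<Rightarrow> (real^'n \<Rightarrow> complex) \<Rightarrow> real" where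
  "wnorm w r l \<phi> = Sup (wnorm_values w r l \<phi>)"

definition test_space ::
  "(nat \<Rightarrow> real^'n::finite \<Rightarrow> real) \<Rightarrow> nat \<Rightarrow> (real^'n \<Rightarrow> complex) set" where
  "test_space w r = {\<phi>. C_class r \<phi> \<and> (\<forall>l. bdd_above (wnorm_values w r l \<phi>))}"

definition test_topology ::
  "(nat \<Rightarrow> real^'n::finite \<Rightarrow> real) \<Rightarrow> nat \<Rightarrow> (real^'n \<Rightarrow> complex) topology" where
  "test_topology w r = topology_generated_by
     {{\<psi> \<in> test_space w r. wnorm w r l (\<lambda>x. \<psi> x - \<phi> x) < e} | l \<phi> e. \<phi> \<in> test_space w r \<and> e > 0}"

type_synonym 'n distr = "(real^'n \<Rightarrow> complex) \<Rightarrow> complex"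

text \<open>Only the values of a functional on the test space matter; they are unconstrained elsewhere.\<close>

definition dual_space :: "(nat \<Rightarrow> real^'n::finite \<Rightarrow> real) \<Rightarrow> nat \<Rightarrow> 'n distr set" where
  "dual_space w r = {f.
     (\<forall>\<phi>\<in>test_space w r. \<forall>\<psi>\<in>test_space w r. f (\<lambda>x. \<phi> x + \<psi> x) = f \<phi> + f \<psi>)
   \<and> (\<forall>c. \<forall>\<phi>\<in>test_space w r. f (\<lambda>x. c * \<phi> x) = c * f \<phi>)
   \<and> continuous_map (test_topology w r) euclidean f}"

text \<open>A superadditive \<open>M \<ge> 0\<close> is automatically nondecreasing. ``Increasing'' is rendered by
  monotonicity together with \<open>M \<noteq> 0\<close>: every strictly increasing \<open>M\<close> qualifies, and the only
  nondecreasing function that is excluded is \<open>M = 0\<close>, for which the spaces carry no decay.\<close>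

definition growth_function :: "(real \<Rightarrow> real) \<Rightarrow> bool" where
  "growth_function M \<longleftrightarrow>
     (\<forall>t\<ge>0. M t \<ge> 0) \<and> continuous_on {0..} M \<and> mono_on {0..} M \<and> (\<exists>t\<ge>0. M t \<noteq> 0)
   \<and> (\<forall>t\<ge>0. \<forall>s\<ge>0. M t + M s \<le> M (t + s))
   \<and> (\<forall>t\<ge>0. \<forall>s\<ge>0. M (t + s) \<le> M (2 * t) + M (2 * s))"

definition K_weight :: "(real \<Rightarrow> real) \<Rightarrow> nat \<Rightarrow> real^'n::finite \<Rightarrow> real" where
  "K_weight M l x = exp (M (norm (real l *\<^sub>R x)))"

definition S_weight :: "nat \<Rightarrow> real^'n::finite \<Rightarrow> real" where
  "S_weight l x = (1 + norm x) ^ l"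

abbreviation K_space :: "(real \<Rightarrow> real) \<Rightarrow> nat \<Rightarrow> (real^'n::finite \<Rightarrow> complex) set" where
  "K_space M r \<equiv> test_space (K_weight M) r"

abbreviation S_space :: "nat \<Rightarrow> (real^'n::finite \<Rightarrow> complex) set" where
  "S_space r \<equiv> test_space S_weight r"

abbreviation K_dual :: "(real \<Rightarrow> real) \<Rightarrow> nat \<Rightarrow> 'n::finite distr set" where
  "K_dual M r \<equiv> dual_space (K_weight M) r"

abbreviation S_dual :: "nat \<Rightarrow> 'n::finite distr set" where
  "S_dual r \<equiv> dual_space S_weight r"

definition weakstar_lim ::
  "(real^'n::finite \<Rightarrow> complex) set \<Rightarrow> (real \<Rightarrow> 'n distr) \<Rightarrow> 'n distr \<Rightarrow> bool" where
  "weakstar_lim X F g \<longleftrightarrow> (\<forall>\<theta>\<in>X. ((\<lambda>\<epsilon>. F \<epsilon> \<theta>) \<longlongrightarrow> g \<theta>) (at_right 0))"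

text \<open>\<open>\<langle>f(x\<^sub>0 + \<epsilon>x), \<theta>(x)\<rangle> = \<epsilon>\<^sup>-\<^sup>n \<langle>f(y), \<theta>((y - x\<^sub>0)/\<epsilon>)\<rangle>\<close>, meant for \<open>\<epsilon> > 0\<close>.\<close>

definition dilate :: "'n::finite distr \<Rightarrow> real^'n \<Rightarrow> real \<Rightarrow> 'n distr" where
  "dilate f x0 \<epsilon> \<theta> = f (\<lambda>y. \<theta> ((1 / \<epsilon>) *\<^sub>R (y - x0))) / of_real (\<epsilon> ^ CARD('n))"

definition fun_distr :: "(real^'n::finite \<Rightarrow> complex) \<Rightarrow> 'n distr" where
  "fun_distr h \<theta> = (\<integral>x. h x * \<theta> x \<partial>lborel)"

definition slowly_varying_at_0 :: "(real \<Rightarrow> real) \<Rightarrow> bool" where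
  "slowly_varying_at_0 L \<longleftrightarrow>
     (\<exists>A>0. L \<in> borel_measurable (lebesgue_on {0<..A}) \<and> (\<forall>\<epsilon>\<in>{0<..A}. L \<epsilon> > 0))
   \<and> (\<forall>a>0. ((\<lambda>\<epsilon>. L (a * \<epsilon>) / L \<epsilon>) \<longlongrightarrow> 1) (at_right 0))"


section \<open>Multiresolution analyses\<close>

text \<open>Elements of \<open>L\<^sup>2\<close> are represented by Borel functions, equality being equality almost everywhere.\<close>

definition L2_space :: "(real^'n::finite \<Rightarrow> complex) set" where
  "L2_space = {f \<in> borel_measurable lborel. integrable lborel (\<lambda>x. (cmod (f x))\<^sup>2)}"

definition L2_norm :: "(real^'n::finite \<Rightarrow> complex) \<Rightarrow> real" where
  "L2_norm f = sqrt (\<integral>x. (cmod (f x))\<^sup>2 \<partial>lborel)"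

definition L2_inner :: "(real^'n::finite \<Rightarrow> complex) \<Rightarrow> (real^'n \<Rightarrow> complex) \<Rightarrow> complex" where
  "L2_inner f g = (\<integral>x. f x * cnj (g x) \<partial>lborel)"

text \<open>Closedness under limits in the \<open>L\<^sup>2\<close> seminorm includes (constant sequences) invariance under
  changes on null sets, so these sets correspond to the closed subspaces of the quotient \<open>L\<^sup>2\<close>.\<close>

definition closed_subspace_L2 :: "(real^'n::finite \<Rightarrow> complex) set \<Rightarrow> bool" where
  "closed_subspace_L2 W \<longleftrightarrow>
     W \<subseteq> L2_space \<and> (\<lambda>x. 0) \<in> W
   \<and> (\<forall>f\<in>W. \<forall>g\<in>W. (\<lambda>x. f x + g x) \<in> W)
   \<and> (\<forall>c. \<forall>f\<in>W. (\<lambda>x. c * f x) \<in> W)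
   \<and> (\<forall>F f. (\<forall>k::nat. F k \<in> W) \<and> f \<in> L2_space \<and> (\<lambda>k. L2_norm (\<lambda>x. F k x - f x)) \<longlonglongrightarrow> 0 \<longrightarrow> f \<in> W)"

definition lattice_pt :: "int^'n::finite \<Rightarrow> real^'n" where
  "lattice_pt m = (\<chi> i. of_int (m $ i))"

definition shift :: "int^'n::finite \<Rightarrow> (real^'n \<Rightarrow> complex) \<Rightarrow> real^'n \<Rightarrow> complex" where
  "shift m f x = f (x - lattice_pt m)"

text \<open>The integer translates of \<open>\<phi>\<close> form an orthonormal basis of \<open>W\<close>: an orthonormal system in \<open>W\<close>
  whose finite linear combinations are dense in \<open>W\<close>.\<close>

definition translates_onb ::
  "(real^'n::finite \<Rightarrow> complex) set \<Rightarrow> (real^'n \<Rightarrow> complex) \<Rightarrow> bool" where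
  "translates_onb W \<phi> \<longleftrightarrow>
     (\<forall>m. shift m \<phi> \<in> W)
   \<and> (\<forall>m k. L2_inner (shift m \<phi>) (shift k \<phi>) = (if m = k then 1 else 0))
   \<and> (\<forall>f\<in>W. \<forall>e>0. \<exists>I c. finite I \<and> L2_norm (\<lambda>x. f x - (\<Sum>m\<in>I. c m * shift m \<phi> x)) < e)"

definition scaling_function ::
  "(int \<Rightarrow> (real^'n::finite \<Rightarrow> complex) set) \<Rightarrow> (real^'n \<Rightarrow> complex) \<Rightarrow> bool" where
  "scaling_function V \<phi> \<longleftrightarrow> \<phi> \<in> L2_space \<and> translates_onb (V 0) \<phi>"

definition is_MRA :: "(int \<Rightarrow> (real^'n::finite \<Rightarrow> complex) set) \<Rightarrow> bool" where
  "is_MRA V \<longleftrightarrow>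
     (\<forall>j. closed_subspace_L2 (V j)) \<and> (\<forall>j. V j \<subseteq> V (j + 1))
   \<and> (\<forall>j f. f \<in> V j \<longleftrightarrow> (\<lambda>x. f (2 *\<^sub>R x)) \<in> V (j + 1))
   \<and> (\<forall>f m. f \<in> V 0 \<longleftrightarrow> shift m f \<in> V 0)
   \<and> (\<Inter>j. V j) = {f \<in> L2_space. AE x in lborel. f x = 0}
   \<and> (\<forall>f\<in>L2_space. \<forall>e>0. \<exists>j. \<exists>g\<in>V j. L2_norm (\<lambda>x. f x - g x) < e)
   \<and> (\<exists>\<phi>. scaling_function V \<phi>)"

definition q0 :: "(real^'n::finite \<Rightarrow> complex) \<Rightarrow> real^'n \<Rightarrow> real^'n \<Rightarrow> complex" where
  "q0 \<phi> x y = (\<Sum>\<^sub>\<infinity>m\<in>UNIV. \<phi> (x - lattice_pt m) * cnj (\<phi> (y - lattice_pt m)))"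

definition q_kernel ::
  "(real^'n::finite \<Rightarrow> complex) \<Rightarrow> real \<Rightarrow> real^'n \<Rightarrow> real^'n \<Rightarrow> complex" where
  "q_kernel \<phi> lam x y =
     of_real (2 powr (real CARD('n) * lam)) * q0 \<phi> ((2 powr lam) *\<^sub>R x) ((2 powr lam) *\<^sub>R y)"

definition q_proj ::
  "(real^'n::finite \<Rightarrow> complex) \<Rightarrow> real \<Rightarrow> 'n distr \<Rightarrow> real^'n \<Rightarrow> complex" where
  "q_proj \<phi> lam f x = f (q_kernel \<phi> lam x)"

end

theory Submission
  imports Defs
begin

text \<open>
  Zooming into \<open>q\<^sub>1\<^sub>/\<^sub>\<epsilon> f\<close> at \<open>x\<^sub>0\<close> and pairing with \<open>\<theta>\<close> is the same as zooming into \<open>f\<close> and pairing with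
  \<open>T\<^sub>\<epsilon> \<theta>\<close>, where \<open>T\<^sub>\<epsilon>\<close> has kernel \<open>N\<^sup>n q\<^sub>0(a + N x, a + N z)\<close> with \<open>N = \<epsilon> 2\<^sup>1\<^sup>/\<^sup>\<epsilon> \<rightarrow> \<infinity>\<close>. Each of the two sides
  of the equivalence makes the rescaled functionals pointwise bounded, hence equicontinuous by the
  Banach--Steinhaus theorem, so everything follows from \<open>T\<^sub>\<epsilon> \<theta> \<rightarrow> \<theta>\<close> in the test space.

  That convergence is a Taylor expansion of \<open>\<theta>\<close> under the integral, provided the kernels
  \<open>\<partial>\<^sup>\<beta> q\<^sub>0\<close>, \<open>|\<beta>| \<le> r\<close>, act on the Taylor polynomials as \<open>\<partial>\<^sup>\<beta>\<close> does. The scaling function itself lies in every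
  \<open>V\<^sub>j\<close>, \<open>j \<ge> 0\<close>, and is therefore reproduced exactly at all dyadic scales; expanding this identity gives the
  moment conditions when applied to the scaling function. They are constant-coefficient differential
  equations, and since the integral of the scaling function does not vanish, convolving with a test function
  and shrinking transfers them to every test function.
\<close>

section \<open>Iterated partial derivatives\<close>

text \<open>Differentiating the kernel operator along a word \<open>ks\<close> costs a factor
  \<open>N ^ length ks\<close>, so its integral must be known up to an error of smaller order than
  the reciprocal of that factor. Test functions of class \<open>C_class r\<close> allow just this:
  Taylor's formula of order \<open>length ks\<close>, with remainder governed by the modulus of
  continuity of the top derivatives. Hence every lower Taylor term has to vanish exactly and the top
  one has to return the derivative. This is needed at every base point
  \<open>a + N *\<^sub>R z\<close> of the kernel, although self-reproduction is known only for
  powers of two and base point 0. Polynomials are not test functions, so the moment conditions are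
  never tested on them. They are identities between differential operators acting on test functions,
  which also spares the evaluation of single moments. Exponential and polynomial weights share one
  argument, resting on a few axioms on a family of radial weights. Lattice sums and integrals are
  dominated by one and the same function, \<open>decay\<close>.\<close>

definition pd :: "'n::finite list \<Rightarrow> (real^'n \<Rightarrow> complex) \<Rightarrow> real^'n \<Rightarrow> complex" where
  "pd ks f = foldr partial_deriv ks f"

lemma pd_Nil [simp]: "pd [] f = f"
  and pd_Cons: "pd (k # ks) f = partial_deriv k (pd ks f)"
  and pd_append: "pd (ks @ ls) f = pd ks (pd ls f)"
  by (simp_all add: pd_def)

text \<open>\<open>C_class\<close> recurses on the derivative taken first, while words in
  \<open>pd\<close> grow at the derivative taken last; hence the splitting at the last letter.
  Words, unlike multi-indices, allow induction on the order before mixed derivatives are known to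
  commute.\<close>

lemma C_class_iff_pd:
  "C_class r f \<longleftrightarrow> (\<forall>ks. length ks \<le> r \<longrightarrow> continuous_on UNIV (pd ks f))
     \<and> (\<forall>ks i x. length ks < r \<longrightarrow> (\<lambda>t::real. pd ks f (x + t *\<^sub>R axis i 1)) differentiable (at 0))"
proof (induction r arbitrary: f)
  case (Suc r)
  have split: "(\<forall>ks::'a list. length ks \<le> Suc m \<longrightarrow> P ks) \<longleftrightarrow> P [] \<and> (\<forall>i ks. length ks \<le> m \<longrightarrow> P (ks @ [i]))"
    for P m
    by (metis length_append_singleton length_0_conv le0 not_less_eq_eq rev_exhaust list.size(3))
  have split': "(\<forall>ks::'a list. length ks < Suc m \<longrightarrow> P ks) \<longleftrightarrow> P [] \<and> (\<forall>i ks. length ks < m \<longrightarrow> P (ks @ [i]))"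
    for P m
    by (metis length_append_singleton length_0_conv zero_less_Suc not_less_eq rev_exhaust list.size(3))
  have s: "pd (ks @ [i]) f = pd ks (partial_deriv i f)" for ks i
    by (simp add: pd_def)
  have 1: "(\<forall>ks. length ks \<le> Suc r \<longrightarrow> continuous_on UNIV (pd ks f)) \<longleftrightarrow>
    continuous_on UNIV f \<and> (\<forall>i ks. length ks \<le> r \<longrightarrow> continuous_on UNIV (pd ks (partial_deriv i f)))"
    by (subst split) (simp add: s)
  have 2: "(\<forall>ks. length ks < Suc r \<longrightarrow> (\<forall>i x. (\<lambda>t::real. pd ks f (x + t *\<^sub>R axis i 1)) differentiable (at 0))) \<longleftrightarrow>
    (\<forall>i x. (\<lambda>t::real. f (x + t *\<^sub>R axis i 1)) differentiable (at 0)) \<and>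
    (\<forall>j ks. length ks < r \<longrightarrow> (\<forall>i x. (\<lambda>t::real. pd ks (partial_deriv j f) (x + t *\<^sub>R axis i 1)) differentiable (at 0)))"
    by (subst split') (simp add: s)
  show ?case
    using 1 2 unfolding C_class.simps Suc.IH by metis
qed simp

lemma C_class_continuous: "C_class r f \<Longrightarrow> length ks \<le> r \<Longrightarrow> continuous_on UNIV (pd ks f)"
  by (simp add: C_class_iff_pd)

lemma C_class_has_derivative:
  assumes "C_class r f" "length ks < r"
  shows "((\<lambda>t. pd ks f (x + t *\<^sub>R axis i 1)) has_vector_derivative pd (i # ks) f (x + s *\<^sub>R axis i 1)) (at s)"
proof -
  have "((\<lambda>t. pd ks f ((x + s *\<^sub>R axis i 1) + t *\<^sub>R axis i 1)) has_vector_derivative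
      pd (i # ks) f (x + s *\<^sub>R axis i 1)) (at 0)"
    using assms unfolding C_class_iff_pd pd_Cons partial_deriv_def
    by (meson vector_derivative_works)
  then have "(((\<lambda>t. pd ks f ((x + s *\<^sub>R axis i 1) + t *\<^sub>R axis i 1)) \<circ> (\<lambda>t. t - s)) has_vector_derivative
      1 *\<^sub>R pd (i # ks) f (x + s *\<^sub>R axis i 1)) (at s)"
    by (intro vector_diff_chain_at) (auto intro!: derivative_eq_intros)
  then show ?thesis
    by (simp add: o_def algebra_simps)
qed

text \<open>A candidate family of derivatives that is consistent under one further differentiation
  determines all of them. Linear combinations, affine substitutions, conjugates and series are all
  handled by naming such a family.\<close>

lemma C_classI:
  fixes G :: "'n::finite list \<Rightarrow> real^'n \<Rightarrow> complex"
  assumes cont: "\<And>ks. length ks \<le> r \<Longrightarrow> continuous_on UNIV (G ks)"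
    and der: "\<And>ks i x. length ks < r \<Longrightarrow>
      ((\<lambda>t. G ks (x + t *\<^sub>R axis i 1)) has_vector_derivative G (i # ks) x) (at 0)"
  shows "C_class r (G [])" and "length ks \<le> r \<Longrightarrow> pd ks (G []) = G ks"
proof -
  show eq: "pd ks (G []) = G ks" if "length ks \<le> r" for ks
    using that
  proof (induction ks)
    case (Cons i ks)
    then show ?case
      using der[of ks] by (auto simp: pd_Cons partial_deriv_def fun_eq_iff intro!: vector_derivative_at)
  qed simp
  show "C_class r (G [])"
    unfolding C_class_iff_pd
  proof (intro conjI allI impI)
    fix ks :: "'n list" and i x
    assume ks: "length ks < r"
    with der[OF ks, of x i] show "(\<lambda>t. pd ks (G []) (x + t *\<^sub>R axis i 1)) differentiable (at 0)"
      by (metis eq has_vector_derivative_def differentiable_def less_imp_le)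
  qed (use cont eq in auto)
qed

section \<open>Symmetry of mixed partial derivatives\<close>

lemma mvt_linearization_bound:
  fixes g :: "real \<Rightarrow> 'b::real_normed_vector"
  assumes "0 \<le> s" and der: "\<And>t. 0 \<le> t \<Longrightarrow> t \<le> s \<Longrightarrow> (g has_vector_derivative g' t) (at t)"
    and B: "\<And>t. 0 \<le> t \<Longrightarrow> t \<le> s \<Longrightarrow> norm (g' t - c) \<le> B"
  shows "norm (g s - g 0 - s *\<^sub>R c) \<le> s * B"
proof -
  have "norm ((g s - s *\<^sub>R c) - (g 0 - 0 *\<^sub>R c)) \<le> B * norm (s - 0)"
  proof (rule differentiable_bound[where S="{0..s}" and f'="\<lambda>t h. h *\<^sub>R (g' t - c)"])
    fix t assume t: "t \<in> {0..s}"
    show "((\<lambda>t. g t - t *\<^sub>R c) has_derivative (\<lambda>h. h *\<^sub>R (g' t - c))) (at t within {0..s})"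
      unfolding scaleR_diff_right
      using der[of t] t unfolding has_vector_derivative_def
      by (intro has_derivative_diff has_derivative_scaleR_left has_derivative_ident)
        (simp add: has_derivative_at_withinI)
    show "onorm (\<lambda>h. h *\<^sub>R (g' t - c)) \<le> B"
    proof (rule onorm_le)
      fix h :: real
      have "\<bar>h\<bar> * norm (g' t - c) \<le> \<bar>h\<bar> * B"
        using B[of t] t by (intro mult_left_mono) auto
      then show "norm (h *\<^sub>R (g' t - c)) \<le> B * norm h"
        by (simp add: mult.commute)
    qed
  qed (use assms in auto)
  then show ?thesis
    using assms(1) by (simp add: algebra_simps)
qed

text \<open>The mean value inequality is applied twice: along \<open>j\<close> to the increment of
  \<open>h\<close> in direction \<open>i\<close>, then along \<open>i\<close> to \<open>hj\<close>.
  The intermediate points differ from \<open>x\<close> by two steps of length at most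
  \<open>s\<close>, hence the radius \<open>2 * s\<close>.\<close>

lemma second_difference_bound:
  fixes h hj hij :: "real^'n::finite \<Rightarrow> complex"
  assumes hj: "\<And>x t. ((\<lambda>t. h (x + t *\<^sub>R axis j 1)) has_vector_derivative hj (x + t *\<^sub>R axis j 1)) (at t)"
    and hij: "\<And>x t. ((\<lambda>t. hj (x + t *\<^sub>R axis i 1)) has_vector_derivative hij (x + t *\<^sub>R axis i 1)) (at t)"
    and s: "0 \<le> s" and near: "\<And>y. norm (y - x) \<le> 2 * s \<Longrightarrow> norm (hij y - hij x) \<le> e"
  shows "norm (h (x + s *\<^sub>R axis i 1 + s *\<^sub>R axis j 1) - h (x + s *\<^sub>R axis j 1)
           - (h (x + s *\<^sub>R axis i 1) - h x) - s *\<^sub>R s *\<^sub>R hij x) \<le> s * (s * e)"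
proof -
  let ?g = "\<lambda>t. h (x + s *\<^sub>R axis i 1 + t *\<^sub>R axis j 1) - h (x + t *\<^sub>R axis j 1)"
  have "norm (?g s - ?g 0 - s *\<^sub>R s *\<^sub>R hij x) \<le> s * (s * e)"
  proof (rule mvt_linearization_bound[OF s])
    fix t :: real assume t: "0 \<le> t" "t \<le> s"
    show "(?g has_vector_derivative (hj (x + s *\<^sub>R axis i 1 + t *\<^sub>R axis j 1) - hj (x + t *\<^sub>R axis j 1))) (at t)"
      using hj[of "x + s *\<^sub>R axis i 1" t] hj[of x t] by (rule has_vector_derivative_diff)
    let ?k = "\<lambda>u. hj ((x + t *\<^sub>R axis j 1) + u *\<^sub>R axis i 1)"
    have "norm (?k s - ?k 0 - s *\<^sub>R hij x) \<le> s * e"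
    proof (rule mvt_linearization_bound[OF s])
      fix u :: real assume u: "0 \<le> u" "u \<le> s"
      show "(?k has_vector_derivative hij (x + t *\<^sub>R axis j 1 + u *\<^sub>R axis i 1)) (at u)"
        by (rule hij)
      have "norm (t *\<^sub>R axis j 1 + u *\<^sub>R axis i 1 :: real^'n) \<le> \<bar>t\<bar> + \<bar>u\<bar>"
        by (rule order_trans[OF norm_triangle_ineq]) simp
      then show "norm (hij (x + t *\<^sub>R axis j 1 + u *\<^sub>R axis i 1) - hij x) \<le> e"
        using t u by (intro near) (simp add: add.assoc)
    qed
    then show "norm (hj (x + s *\<^sub>R axis i 1 + t *\<^sub>R axis j 1) - hj (x + t *\<^sub>R axis j 1) - s *\<^sub>R hij x) \<le> s * e"
      by (simp add: algebra_simps)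
  qed
  then show ?thesis by simp
qed

text \<open>Schwarz's theorem: the second difference does not depend on the order of the two
  directions, and up to \<open>s * s * (e / 2)\<close> it equals \<open>s * s\<close> times either
  mixed derivative, both being continuous.\<close>

lemma pd_swap:
  assumes C: "C_class r f" and len: "length ks + 2 \<le> r"
  shows "pd (i # j # ks) f = pd (j # i # ks) f"
proof
  fix x
  let ?h = "pd ks f" and ?a = "pd (i # j # ks) f" and ?b = "pd (j # i # ks) f"
  have "norm (?a x - ?b x) \<le> 0 + e" if e: "e > 0" for e
  proof -
    have near: "\<exists>d>0. \<forall>y. norm (y - x) < d \<longrightarrow> norm (pd ls f y - pd ls f x) < e / 2" if "length ls \<le> r" for ls
      using C_class_continuous[OF C that] half_gt_zero[OF e]
      unfolding continuous_on_eq_continuous_at[OF open_UNIV] continuous_at_eps_delta dist_norm by blast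
    obtain d1 where d1: "d1 > 0" "\<And>y. norm (y - x) < d1 \<Longrightarrow> norm (?a y - ?a x) < e / 2"
      using near[of "i # j # ks"] len by auto
    obtain d2 where d2: "d2 > 0" "\<And>y. norm (y - x) < d2 \<Longrightarrow> norm (?b y - ?b x) < e / 2"
      using near[of "j # i # ks"] len by auto
    define s where "s = min d1 d2 / 3"
    have s: "s > 0" "2 * s < d1" "2 * s < d2" using d1(1) d2(1) by (auto simp: s_def)
    let ?D1 = "?h (x + s *\<^sub>R axis i 1 + s *\<^sub>R axis j 1) - ?h (x + s *\<^sub>R axis j 1) - (?h (x + s *\<^sub>R axis i 1) - ?h x)"
    have 1: "norm (?D1 - s *\<^sub>R s *\<^sub>R ?a x) \<le> s * (s * (e / 2))"
    proof (rule second_difference_bound[where hj="pd (j # ks) f"])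
      show "norm (?a y - ?a x) \<le> e / 2" if "norm (y - x) \<le> 2 * s" for y
        using d1(2)[of y] that s by simp
    qed (use C_class_has_derivative[OF C] len s in auto)
    let ?D2 = "?h (x + s *\<^sub>R axis j 1 + s *\<^sub>R axis i 1) - ?h (x + s *\<^sub>R axis i 1) - (?h (x + s *\<^sub>R axis j 1) - ?h x)"
    have 2: "norm (?D2 - s *\<^sub>R s *\<^sub>R ?b x) \<le> s * (s * (e / 2))"
    proof (rule second_difference_bound[where hj="pd (i # ks) f"])
      show "norm (?b y - ?b x) \<le> e / 2" if "norm (y - x) \<le> 2 * s" for y
        using d2(2)[of y] that s by simp
    qed (use C_class_has_derivative[OF C] len s in auto)
    have swap: "x + s *\<^sub>R axis j 1 + s *\<^sub>R axis i 1 = x + s *\<^sub>R axis i 1 + s *\<^sub>R axis j 1"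
      by (simp only: add.assoc add.commute[of "s *\<^sub>R axis j 1"])
    have "\<And>a b c d :: complex. a - b - (c - d) = a - c - (b - d)" by simp
    then have D: "?D2 = ?D1" unfolding swap by blast
    have "norm (s *\<^sub>R s *\<^sub>R (?a x - ?b x)) = norm ((?D1 - s *\<^sub>R s *\<^sub>R ?b x) - (?D1 - s *\<^sub>R s *\<^sub>R ?a x))"
      by (rule arg_cong[where f=norm]) (simp add: scaleR_diff_right)
    also have "\<dots> \<le> s * (s * (e / 2)) + s * (s * (e / 2))"
      using add_mono[OF 2[unfolded D] 1] by (rule order_trans[OF norm_triangle_ineq4])
    finally have "s * (s * norm (?a x - ?b x)) \<le> s * (s * e)"
      using s(1) by (simp del: scaleR_scaleR scaleR_diff_right)
    then show ?thesis using s(1) by simp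
  qed
  then have "norm (?a x - ?b x) \<le> 0" by (rule field_le_epsilon)
  then show "?a x = ?b x" by simp
qed

lemma pd_move:
  assumes C: "C_class r f" and "length as + length bs < r"
  shows "pd (as @ i # bs) f = pd (i # as @ bs) f"
  using assms(2)
proof (induction as)
  case (Cons a as)
  then have "pd ((a # as) @ i # bs) f = pd (a # i # as @ bs) f"
    by (simp add: pd_Cons)
  also have "\<dots> = pd (i # a # as @ bs) f"
    using Cons.prems by (intro pd_swap[OF C]) auto
  finally show ?case by simp
qed simp

text \<open>Each letter is brought to the front by \<open>pd_move\<close>. Only the multiset of
  letters matters, so \<open>mi_deriv\<close>, which fixes an order of the coordinates, can be
  replaced by derivatives along arbitrary words.\<close>

lemma pd_perm:
  assumes C: "C_class r f" and "mset ks = mset ls" "length ks \<le> r"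
  shows "pd ks f = pd ls f"
  using assms(2,3)
proof (induction ks arbitrary: ls)
  case (Cons i ks)
  then obtain as bs where ls: "ls = as @ i # bs"
    by (metis list.set_intros(1) mset_eq_setD split_list)
  with Cons.prems have "mset ks = mset (as @ bs)" by simp
  then have "pd ks f = pd (as @ bs) f" using Cons by simp
  moreover have "length as + length bs < r"
    using Cons.prems ls by (metis mset_eq_length add_Suc_right length_Cons length_append less_eq_Suc_le)
  ultimately show ?case using pd_move[OF C] ls by (simp add: pd_Cons)
qed simp

section \<open>Multi-indices as words of coordinates\<close>

definition mi_list :: "('n::finite \<Rightarrow> nat) \<Rightarrow> 'n list" where
  "mi_list \<beta> = concat (map (\<lambda>i. replicate (\<beta> i) i) coord_list)"

lemma coord_list: "distinct (coord_list :: 'n::finite list)" "set (coord_list :: 'n list) = UNIV"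
proof -
  have "\<exists>xs :: 'n list. distinct xs \<and> set xs = UNIV"
    using finite_distinct_list[of "UNIV :: 'n set"] by auto
  then show "distinct (coord_list :: 'n::finite list)" "set (coord_list :: 'n list) = UNIV"
    unfolding coord_list_def by (metis (mono_tags, lifting) someI_ex)+
qed

lemma mi_deriv_eq_pd: "mi_deriv \<beta> f = pd (mi_list \<beta>) f"
proof -
  have rep: "foldr g (replicate n i) h = (g i ^^ n) h" for g :: "'a \<Rightarrow> 'c \<Rightarrow> 'c" and n i h
    by (induction n) auto
  have "foldr (\<lambda>i h. (partial_deriv i ^^ \<beta> i) h) xs f = foldr partial_deriv (concat (map (\<lambda>i. replicate (\<beta> i) i) xs)) f"
    for xs by (induction xs) (auto simp: rep)
  then show ?thesis by (simp add: mi_deriv_def pd_def mi_list_def)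
qed

lemma length_mi_list: "length (mi_list \<beta>) = mi_order \<beta>"
proof -
  have "length (mi_list \<beta>) = sum_list (map \<beta> coord_list)"
    by (simp add: mi_list_def length_concat o_def)
  then show ?thesis
    by (simp add: sum_list_distinct_conv_sum_set coord_list mi_order_def)
qed

lemma mset_mi_list: "mset (mi_list (count (mset ks))) = mset ks"
proof (rule multiset_eqI)
  fix i
  have *: "count (mset (concat (map (\<lambda>j. replicate (\<beta> j) j) xs))) i = (if i \<in> set xs then \<beta> i else 0)"
    if "distinct xs" for xs and \<beta> :: "'a \<Rightarrow> nat"
    using that by (induction xs) auto
  show "count (mset (mi_list (count (mset ks)))) i = count (mset ks) i"
    unfolding mi_list_def *[OF coord_list(1)] by (simp add: coord_list(2))
qed

lemma mi_order_count: "mi_order (count (mset ks)) = length ks"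
  by (metis length_mi_list mset_mi_list size_mset)

text \<open>Chain rule from coordinate derivatives alone. The coordinates of \<open>v\<close> are
  switched on one at a time (\<open>u S\<close> is \<open>v\<close> restricted to \<open>S\<close>),
  each step being the theorem that a function of two real variables is differentiable when one
  partial derivative is continuous.\<close>

lemma C_class_has_derivative_line:
  assumes C: "C_class r f" and len: "length ks < r"
  shows "((\<lambda>t. pd ks f (z + t *\<^sub>R v)) has_vector_derivative
     (\<Sum>i\<in>UNIV. v $ i *\<^sub>R pd (i # ks) f (z + s *\<^sub>R v))) (at s)"
proof -
  define u where "u S = (\<Sum>i\<in>S. v $ i *\<^sub>R axis i 1 :: real^'a)" for S
  let ?h = "pd ks f"
  have "((\<lambda>t. ?h (z + t *\<^sub>R u S)) has_vector_derivative
     (\<Sum>i\<in>S. v $ i *\<^sub>R pd (i # ks) f (z + s *\<^sub>R u S))) (at s)" if "finite S" for S z s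
    using that
  proof (induction S arbitrary: z s)
    case (insert i S)
    let ?D = "\<Sum>j\<in>S. v $ j *\<^sub>R pd (j # ks) f (z + s *\<^sub>R u S + (s * v $ i) *\<^sub>R axis i 1)"
    \<comment> \<open>The old direction needs a derivative at one point only, given by the induction
      hypothesis with shifted base point; joint continuity is required just for the new
      coordinate.\<close>
    have fx: "((\<lambda>x. ?h (z + x *\<^sub>R u S + (s * v $ i) *\<^sub>R axis i 1)) has_derivative (\<lambda>h. h *\<^sub>R ?D)) (at s)"
      using insert.IH[of "z + (s * v $ i) *\<^sub>R axis i 1" s]
      by (simp add: has_vector_derivative_def algebra_simps)
    have fy: "((\<lambda>y. ?h (z + x *\<^sub>R u S + y *\<^sub>R axis i 1)) has_derivative
        blinfun_apply (blinfun_scaleR_left (pd (i # ks) f (z + x *\<^sub>R u S + y *\<^sub>R axis i 1)))) (at y)" for x y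
      using C_class_has_derivative[OF C len, of "z + x *\<^sub>R u S" i y]
      by (simp add: has_vector_derivative_def)
    have cont: "continuous_on UNIV (pd (i # ks) f)"
      using C len by (intro C_class_continuous) auto
    have cont2: "continuous (at (s, s * v $ i)) (\<lambda>(x, y). blinfun_scaleR_left (pd (i # ks) f (z + x *\<^sub>R u S + y *\<^sub>R axis i 1)))"
    proof -
      have "continuous_on UNIV (\<lambda>p::real\<times>real. blinfun_scaleR_left (pd (i # ks) f (z + fst p *\<^sub>R u S + snd p *\<^sub>R axis i 1)) :: real \<Rightarrow>\<^sub>L complex)"
        by (intro continuous_intros continuous_on_compose2[OF cont] bounded_linear.continuous_on[OF bounded_linear_blinfun_scaleR_left]) auto
      then show ?thesis
        by (simp add: continuous_on_eq_continuous_at case_prod_unfold)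
    qed
    have "((\<lambda>(x, y). ?h (z + x *\<^sub>R u S + y *\<^sub>R axis i 1)) has_derivative
        (\<lambda>(tx, ty). tx *\<^sub>R ?D + blinfun_apply (blinfun_scaleR_left (pd (i # ks) f (z + s *\<^sub>R u S + (s * v $ i) *\<^sub>R axis i 1))) ty))
        (at (s, s * v $ i))"
      using has_derivative_partialsI[where X=UNIV and Y=UNIV, OF fx fy _ UNIV_I convex_UNIV] cont2 by simp
    moreover have "((\<lambda>t. (t, t * v $ i)) has_derivative (\<lambda>h. (h, h * v $ i))) (at s)"
      by (auto intro!: derivative_eq_intros)
    ultimately have "((\<lambda>t. ?h (z + t *\<^sub>R u S + (t * v $ i) *\<^sub>R axis i 1)) has_derivative
        (\<lambda>h. h *\<^sub>R ?D + (h * v $ i) *\<^sub>R pd (i # ks) f (z + s *\<^sub>R u S + (s * v $ i) *\<^sub>R axis i 1))) (at s)"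
      using has_derivative_compose[where s=UNIV and f="\<lambda>t. (t, t * v $ i)" and g="\<lambda>(x, y). ?h (z + x *\<^sub>R u S + y *\<^sub>R axis i 1)"]
      by fastforce
    moreover have "z + t *\<^sub>R u S + (t * v $ i) *\<^sub>R axis i 1 = z + t *\<^sub>R u (insert i S)" for t
      using insert.hyps by (simp add: u_def algebra_simps)
    ultimately show ?case
      using insert.hyps by (simp add: has_vector_derivative_def algebra_simps)
  qed (simp add: u_def)
  from this[of UNIV z s] show ?thesis
    by (simp add: u_def) (simp add: basis_expansion flip: scalar_mult_eq_scaleR)
qed

section \<open>Taylor's formula\<close>

text \<open>The derivative of the remainder is the remainder of one order less for the derivative,
  and integrating over a length of at most 1 does not enlarge the bound. Only the oscillation of the
  last derivative enters, so no further derivative is required.\<close>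

lemma taylor_bound_real:
  fixes g :: "nat \<Rightarrow> real \<Rightarrow> 'b::real_normed_vector"
  assumes "\<And>i t. i < k \<Longrightarrow> 0 \<le> t \<Longrightarrow> t \<le> 1 \<Longrightarrow> (g i has_vector_derivative g (Suc i) t) (at t)"
    and "\<And>t. 0 \<le> t \<Longrightarrow> t \<le> 1 \<Longrightarrow> norm (g k t - g k 0) \<le> B"
    and "0 \<le> s" "s \<le> 1"
  shows "norm (g 0 s - (\<Sum>i\<le>k. (s ^ i / fact i) *\<^sub>R g i 0)) \<le> B"
  using assms
proof (induction k arbitrary: g s)
  case (Suc k)
  let ?h = "\<lambda>t. g 0 t - (\<Sum>i\<le>Suc k. (t ^ i / fact i) *\<^sub>R g i 0)"
  have "norm (?h s - ?h 0 - s *\<^sub>R 0) \<le> s * B"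
  proof (rule mvt_linearization_bound)
    fix t assume t: "0 \<le> t" "t \<le> s"
    have "((\<lambda>t. (t ^ Suc i / fact (Suc i)) *\<^sub>R g (Suc i) 0) has_vector_derivative (t ^ i / fact i) *\<^sub>R g (Suc i) 0) (at t)" for i
    proof -
      have "((\<lambda>t. t ^ Suc i / fact (Suc i)) has_real_derivative (real (Suc i) * t ^ i / fact (Suc i))) (at t)"
        by (auto intro!: derivative_eq_intros simp del: power_Suc fact_Suc of_nat_Suc simp: field_simps)
      then have "((\<lambda>t. t ^ Suc i / fact (Suc i)) has_real_derivative (t ^ i / fact i)) (at t)"
        by (simp del: of_nat_Suc power_Suc)
      from has_vector_derivative_scaleR[OF this has_vector_derivative_const[of "g (Suc i) 0"]]
      show ?thesis by simp
    qed
    then have "((\<lambda>t. g 0 t - (g 0 0 + (\<Sum>i\<le>k. (t ^ Suc i / fact (Suc i)) *\<^sub>R g (Suc i) 0)))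
        has_vector_derivative (g (Suc 0) t - (0 + (\<Sum>i\<le>k. (t ^ i / fact i) *\<^sub>R g (Suc i) 0)))) (at t)"
      using Suc.prems(1)[of 0 t] Suc.prems(4) t
      by (intro has_vector_derivative_diff has_vector_derivative_add has_vector_derivative_sum has_vector_derivative_const) auto
    then show "(?h has_vector_derivative (g (Suc 0) t - (\<Sum>i\<le>k. (t ^ i / fact i) *\<^sub>R g (Suc i) 0))) (at t)"
      unfolding sum.atMost_Suc_shift by simp
    have "norm (g (Suc 0) t - (\<Sum>i\<le>k. (t ^ i / fact i) *\<^sub>R g (Suc i) 0)) \<le> B"
      using Suc.IH[of "\<lambda>i. g (Suc i)" t] Suc.prems t by simp
    then show "norm (g (Suc 0) t - (\<Sum>i\<le>k. (t ^ i / fact i) *\<^sub>R g (Suc i) 0) - 0) \<le> B" by simp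
  qed (use Suc.prems in auto)
  moreover have "?h 0 = 0" unfolding sum.atMost_Suc_shift by simp
  moreover have "s * B \<le> 1 * B"
    using Suc.prems(2)[of 0] Suc.prems(3,4) by (intro mult_right_mono) auto
  ultimately show ?case by simp
qed (use order_trans in auto)

definition lists_of :: "nat \<Rightarrow> 'n list set" where
  "lists_of k = {ks. length ks = k}"

definition vpow :: "real^'n \<Rightarrow> 'n list \<Rightarrow> real" where
  "vpow v ks = prod_list (map (\<lambda>j. v $ j) ks)"

text \<open>The \<open>k\<close>-th derivative along \<open>v\<close>. In a sum over words each
  multi-index appears with its multinomial multiplicity, which is why Taylor's formula below carries
  the single coefficient \<open>1 / fact i\<close>.\<close>

definition dir_deriv :: "nat \<Rightarrow> real^'n \<Rightarrow> (real^'n::finite \<Rightarrow> complex) \<Rightarrow> real^'n \<Rightarrow> complex" where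
  "dir_deriv k v f z = (\<Sum>ks\<in>lists_of k. vpow v ks *\<^sub>R pd ks f z)"

lemma lists_of_0 [simp]: "lists_of 0 = {[]}"
  by (auto simp: lists_of_def)

lemma sum_lists_of_Suc:
  "(\<Sum>ks\<in>lists_of (Suc k). g ks) = (\<Sum>ks\<in>lists_of k. \<Sum>i\<in>(UNIV::'n::finite set). g (i # ks))"
proof -
  have "lists_of (Suc k) = (\<lambda>(ks, i). i # ks) ` (lists_of k \<times> (UNIV::'n set))"
    by (auto simp: lists_of_def length_Suc_conv)
  moreover have "inj_on (\<lambda>(ks, i). i # ks) (lists_of k \<times> (UNIV::'n set))"
    by (auto simp: inj_on_def)
  ultimately show ?thesis
    by (simp add: sum.reindex sum.cartesian_product case_prod_unfold)
qed

lemma abs_vpow_le: "\<bar>vpow v ks\<bar> \<le> norm v ^ length ks"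
proof (induction ks)
  case (Cons k ks)
  then show ?case
    using component_le_norm_cart[of v k] by (auto simp: vpow_def abs_mult intro!: mult_mono)
qed (simp add: vpow_def)

lemma vpow_scaleR: "vpow (c *\<^sub>R v) ks = c ^ length ks * vpow v ks"
  by (induction ks) (auto simp: vpow_def)

lemma continuous_on_vpow [continuous_intros]: "continuous_on A (\<lambda>v. vpow v ks)"
  by (induction ks) (auto simp: vpow_def intro!: continuous_intros)

text \<open>A remainder of Peano type: the choice \<open>k = r\<close> is allowed because
  \<open>B\<close> only measures how much the derivatives of order \<open>k\<close> vary along the
  segment. The cardinality counts the words of that order.\<close>

lemma taylor_pd:
  fixes f :: "real^'n::finite \<Rightarrow> complex"
  assumes C: "C_class r f" and k: "k \<le> r"
    and B: "\<And>ks t. length ks = k \<Longrightarrow> 0 \<le> t \<Longrightarrow> t \<le> 1 \<Longrightarrow> cmod (pd ks f (z + t *\<^sub>R v) - pd ks f z) \<le> B"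
  shows "cmod (f (z + v) - (\<Sum>i\<le>k. (1 / fact i) *\<^sub>R dir_deriv i v f z))
    \<le> real (card (lists_of k :: 'n list set)) * (norm v ^ k * B)"
proof -
  have "norm (dir_deriv 0 v f (z + 1 *\<^sub>R v) - (\<Sum>i\<le>k. (1 ^ i / fact i) *\<^sub>R dir_deriv i v f (z + 0 *\<^sub>R v)))
    \<le> (\<Sum>ks\<in>(lists_of k :: 'n list set). norm v ^ k * B)"
  proof (rule taylor_bound_real[where g="\<lambda>i t. dir_deriv i v f (z + t *\<^sub>R v)"])
    fix i t assume i: "i < k"
    have "((\<lambda>t. \<Sum>ks\<in>lists_of i. vpow v ks *\<^sub>R pd ks f (z + t *\<^sub>R v)) has_vector_derivative
       (\<Sum>ks\<in>lists_of i. vpow v ks *\<^sub>R (\<Sum>j\<in>UNIV. v $ j *\<^sub>R pd (j # ks) f (z + t *\<^sub>R v)))) (at t)"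
      using i k
      by (intro has_vector_derivative_sum bounded_linear.has_vector_derivative[OF bounded_linear_scaleR_right]
          C_class_has_derivative_line[OF C]) (auto simp: lists_of_def)
    then show "((\<lambda>t. dir_deriv i v f (z + t *\<^sub>R v)) has_vector_derivative dir_deriv (Suc i) v f (z + t *\<^sub>R v)) (at t)"
      by (simp add: dir_deriv_def sum_lists_of_Suc scaleR_sum_right vpow_def mult.commute)
  next
    fix t :: real assume t: "0 \<le> t" "t \<le> 1"
    have "norm (dir_deriv k v f (z + t *\<^sub>R v) - dir_deriv k v f (z + 0 *\<^sub>R v))
       = norm (\<Sum>ks\<in>lists_of k. vpow v ks *\<^sub>R (pd ks f (z + t *\<^sub>R v) - pd ks f z))"
      by (simp add: dir_deriv_def scaleR_diff_right sum_subtractf)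
    also have "\<dots> \<le> (\<Sum>ks\<in>(lists_of k :: 'n list set). norm v ^ k * B)"
      using B t abs_vpow_le[of v]
      by (intro sum_norm_le) (auto simp: lists_of_def intro!: mult_mono)
    finally show "norm (dir_deriv k v f (z + t *\<^sub>R v) - dir_deriv k v f (z + 0 *\<^sub>R v)) \<le> (\<Sum>ks\<in>(lists_of k :: 'n list set). norm v ^ k * B)" .
  qed auto
  then show ?thesis by (simp add: dir_deriv_def[of 0] vpow_def)
qed

section \<open>Linear combinations, affine substitutions and conjugates\<close>

lemma C_class_lincomb:
  assumes f: "C_class r f" and g: "C_class r g"
  shows "C_class r (\<lambda>x. c * f x + d * g x)"
    and "length ks \<le> r \<Longrightarrow> pd ks (\<lambda>x. c * f x + d * g x) = (\<lambda>x. c * pd ks f x + d * pd ks g x)"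
proof -
  let ?G = "\<lambda>ks x. c * pd ks f x + d * pd ks g x"
  have 1: "continuous_on UNIV (?G ks)" if "length ks \<le> r" for ks
    using that f g by (intro continuous_intros C_class_continuous)
  have 2: "((\<lambda>t. ?G ks (x + t *\<^sub>R axis i 1)) has_vector_derivative ?G (i # ks) x) (at 0)" if "length ks < r" for ks i x
    using C_class_has_derivative[OF f that, of x i 0] C_class_has_derivative[OF g that, of x i 0]
    by (auto intro!: derivative_eq_intros)
  show "C_class r (\<lambda>x. c * f x + d * g x)"
    using C_classI(1)[of r ?G, OF 1 2] by simp
  show "pd ks (\<lambda>x. c * f x + d * g x) = ?G ks" if "length ks \<le> r"
    using C_classI(2)[of r ?G, OF 1 2 that] by simp
qed

lemma C_class_affine:
  fixes f :: "real^'n::finite \<Rightarrow> complex"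
  assumes f: "C_class r f"
  shows "C_class r (\<lambda>x. f (c + b *\<^sub>R x))"
    and "length ks \<le> r \<Longrightarrow> pd ks (\<lambda>x. f (c + b *\<^sub>R x)) = (\<lambda>x. b ^ length ks *\<^sub>R pd ks f (c + b *\<^sub>R x))"
proof -
  let ?G = "\<lambda>ks x. b ^ length ks *\<^sub>R pd ks f (c + b *\<^sub>R x)"
  have 1: "continuous_on UNIV (?G ks)" if "length ks \<le> r" for ks
    using that by (intro continuous_intros continuous_on_compose2[OF C_class_continuous[OF f]]) auto
  have 2: "((\<lambda>t. ?G ks (x + t *\<^sub>R axis i 1)) has_vector_derivative ?G (i # ks) x) (at 0)"
    if "length ks < r" for ks :: "'n list" and i x
  proof -
    have "((\<lambda>t. pd ks f ((c + b *\<^sub>R x) + t *\<^sub>R axis i 1)) has_vector_derivative pd (i # ks) f ((c + b *\<^sub>R x) + (b * 0) *\<^sub>R axis i 1)) (at (b * 0))"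
      by (rule C_class_has_derivative[OF f that])
    then have "(((\<lambda>t. pd ks f ((c + b *\<^sub>R x) + t *\<^sub>R axis i 1)) \<circ> (\<lambda>t. b * t)) has_vector_derivative b *\<^sub>R pd (i # ks) f (c + b *\<^sub>R x)) (at 0)"
      by (intro vector_diff_chain_at) (auto intro!: derivative_eq_intros)
    then have "((\<lambda>t. b ^ length ks *\<^sub>R pd ks f ((c + b *\<^sub>R x) + (b * t) *\<^sub>R axis i 1)) has_vector_derivative b ^ length ks *\<^sub>R b *\<^sub>R pd (i # ks) f (c + b *\<^sub>R x)) (at 0)"
      unfolding o_def by (rule bounded_linear.has_vector_derivative[OF bounded_linear_scaleR_right])
    then show ?thesis by (simp add: algebra_simps)
  qed
  show "C_class r (\<lambda>x. f (c + b *\<^sub>R x))"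
    using C_classI(1)[of r ?G, OF 1 2] by simp
  show "pd ks (\<lambda>x. f (c + b *\<^sub>R x)) = ?G ks" if "length ks \<le> r"
    using C_classI(2)[of r ?G, OF 1 2 that] by simp
qed

lemma C_class_cnj:
  assumes f: "C_class r f"
  shows "C_class r (\<lambda>x. cnj (f x))"
    and "length ks \<le> r \<Longrightarrow> pd ks (\<lambda>x. cnj (f x)) = (\<lambda>x. cnj (pd ks f x))"
proof -
  let ?G = "\<lambda>ks x. cnj (pd ks f x)"
  have 1: "continuous_on UNIV (?G ks)" if "length ks \<le> r" for ks
    using that f by (intro continuous_intros C_class_continuous)
  have 2: "((\<lambda>t. ?G ks (x + t *\<^sub>R axis i 1)) has_vector_derivative ?G (i # ks) x) (at 0)" if "length ks < r" for ks i x
    using C_class_has_derivative[OF f that, of x i 0]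
    by (auto intro!: bounded_linear.has_vector_derivative[OF bounded_linear_cnj])
  show "C_class r (\<lambda>x. cnj (f x))"
    using C_classI(1)[of r ?G, OF 1 2] by simp
  show "pd ks (\<lambda>x. cnj (f x)) = ?G ks" if "length ks \<le> r"
    using C_classI(2)[of r ?G, OF 1 2 that] by simp
qed

section \<open>Weighted test spaces\<close>

text \<open>The norms range over multi-indices; by symmetry of the derivatives, arbitrary words
  contribute no new values.\<close>

lemma pd_in_wnorm_values:
  assumes "C_class r \<phi>" "length ks \<le> r"
  shows "w l x * cmod (pd ks \<phi> x) \<in> wnorm_values w r l \<phi>"
proof -
  have "pd ks \<phi> = mi_deriv (count (mset ks)) \<phi>"
    unfolding mi_deriv_eq_pd by (rule pd_perm[OF assms(1) _ assms(2)]) (simp add: mset_mi_list)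
  then show ?thesis
    using assms(2) mi_order_count[of ks] unfolding wnorm_values_def by force
qed

lemma wnorm_values_eq:
  assumes "C_class r \<phi>"
  shows "wnorm_values w r l \<phi> = {w l x * cmod (pd ks \<phi> x) | ks x. length ks \<le> r}"
proof -
  have "w l x * cmod (mi_deriv \<beta> \<phi> x) \<in> {w l x * cmod (pd ks \<phi> x) | ks x. length ks \<le> r}"
    if "mi_order \<beta> \<le> r" for \<beta> x
    using that unfolding mi_deriv_eq_pd length_mi_list[symmetric] by blast
  then have "wnorm_values w r l \<phi> \<subseteq> {w l x * cmod (pd ks \<phi> x) | ks x. length ks \<le> r}"
    unfolding wnorm_values_def by blast
  then show ?thesis
    using pd_in_wnorm_values[OF assms] by blast
qed

lemma test_space_iff:
  "\<phi> \<in> test_space w r \<longleftrightarrow> C_class r \<phi> \<and>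
    (\<forall>l. \<exists>B. \<forall>ks x. length ks \<le> r \<longrightarrow> w l x * cmod (pd ks \<phi> x) \<le> B)"
proof (cases "C_class r \<phi>")
  case True
  have "bdd_above {w l x * cmod (pd ks \<phi> x) | ks x. length ks \<le> r} \<longleftrightarrow>
      (\<exists>B. \<forall>ks x. length ks \<le> r \<longrightarrow> w l x * cmod (pd ks \<phi> x) \<le> B)" for l
    unfolding bdd_above_def by blast
  with True show ?thesis
    unfolding test_space_def mem_Collect_eq wnorm_values_eq[OF True] by simp
qed (simp add: test_space_def)

lemma wnorm_upper:
  assumes "\<phi> \<in> test_space w r" "length ks \<le> r"
  shows "w l x * cmod (pd ks \<phi> x) \<le> wnorm w r l \<phi>"
  unfolding wnorm_def using assms pd_in_wnorm_values by (intro cSup_upper) (auto simp: test_space_def)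

lemma wnorm_least:
  assumes "C_class r \<phi>" "\<And>ks x. length ks \<le> r \<Longrightarrow> w l x * cmod (pd ks \<phi> x) \<le> B"
  shows "wnorm w r l \<phi> \<le> B"
  unfolding wnorm_def
proof (rule cSup_least)
  show "wnorm_values w r l \<phi> \<noteq> {}" using pd_in_wnorm_values[OF assms(1), of "[]"] by force
qed (use assms(2) wnorm_values_eq[OF assms(1)] in auto)

lemma test_space_C_class: "\<phi> \<in> test_space w r \<Longrightarrow> C_class r \<phi>"
  by (simp add: test_space_def)

lemma test_space_continuous: "\<phi> \<in> test_space w r \<Longrightarrow> length ks \<le> r \<Longrightarrow> continuous_on UNIV (pd ks \<phi>)"
  using C_class_continuous test_space_C_class by blast

lemma test_space_lincomb:
  assumes w: "\<And>l x. 0 \<le> w l x" and f: "f \<in> test_space w r" and g: "g \<in> test_space w r"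
  shows "(\<lambda>x. c * f x + d * g x) \<in> test_space w r"
    and "wnorm w r l (\<lambda>x. c * f x + d * g x) \<le> cmod c * wnorm w r l f + cmod d * wnorm w r l g"
proof -
  note C = C_class_lincomb[OF test_space_C_class[OF f] test_space_C_class[OF g]]
  have B: "w l x * cmod (pd ks (\<lambda>x. c * f x + d * g x) x) \<le> cmod c * wnorm w r l f + cmod d * wnorm w r l g"
    if "length ks \<le> r" for ks x l
  proof -
    have "w l x * cmod (c * pd ks f x + d * pd ks g x) \<le> w l x * (cmod c * cmod (pd ks f x) + cmod d * cmod (pd ks g x))"
      by (intro mult_left_mono w) (metis norm_mult norm_triangle_ineq)
    also have "\<dots> = cmod c * (w l x * cmod (pd ks f x)) + cmod d * (w l x * cmod (pd ks g x))"
      by (simp add: algebra_simps)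
    also have "\<dots> \<le> cmod c * wnorm w r l f + cmod d * wnorm w r l g"
      using f g that by (intro add_mono mult_left_mono wnorm_upper) auto
    finally show ?thesis using C(2)[OF that] by simp
  qed
  show "(\<lambda>x. c * f x + d * g x) \<in> test_space w r"
    unfolding test_space_iff using C(1) B by blast
  show "wnorm w r l (\<lambda>x. c * f x + d * g x) \<le> cmod c * wnorm w r l f + cmod d * wnorm w r l g"
    using C(1) B by (rule wnorm_least)
qed

lemma test_space_cnj:
  assumes f: "f \<in> test_space w r"
  shows "(\<lambda>x. cnj (f x)) \<in> test_space w r"
  using f C_class_cnj[of r f] unfolding test_space_iff by auto

lemma test_space_zero:
  shows "(\<lambda>x. 0) \<in> test_space w r" and "wnorm w r l (\<lambda>x. 0) \<le> 0"
proof -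
  have "C_class r (\<lambda>x::real^'a. 0::complex)" and "length ks \<le> r \<Longrightarrow> pd ks (\<lambda>x::real^'a. 0::complex) = (\<lambda>x. 0)" for ks
    using C_classI[of r "\<lambda>ks x::real^'a. 0"] by auto
  then show "(\<lambda>x. 0) \<in> test_space w r" "wnorm w r l (\<lambda>x. 0) \<le> 0"
    unfolding test_space_iff by (auto intro!: wnorm_least)
qed

text \<open>What the two kinds of weights have in common. The doubled index in
  \<open>w_submult\<close> mirrors the inequality of \<open>M (t + s)\<close> with
  \<open>M (2 * t) + M (2 * s)\<close>; \<open>w_poly\<close> says that polynomial factors are
  absorbed by a larger index; \<open>w_mono\<close> makes the weights radial.\<close>

locale weight_family =
  fixes w :: "nat \<Rightarrow> real^'n::finite \<Rightarrow> real"
  assumes w_ge1: "1 \<le> w l x"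
    and w_mono: "norm x \<le> norm y \<Longrightarrow> w l x \<le> w l y"
    and w_mono_index: "l \<le> l' \<Longrightarrow> w l x \<le> w l' x"
    and w_submult: "w l (x + y) \<le> w (2 * l) x * w (2 * l) y"
    and w_poly: "\<exists>l' C. 0 < C \<and> (\<forall>x. w l x * (1 + norm x) ^ p \<le> C * w l' x)"
    and w_scale: "\<exists>l' C. 0 < C \<and> (\<forall>x. w l (b *\<^sub>R x) \<le> C * w l' x)"
begin

lemma w_pos: "0 < w l x" and w_nonneg: "0 \<le> w l x"
  using w_ge1[of l x] by linarith+

lemma w_norm_eq: "norm x = norm y \<Longrightarrow> w l x = w l y"
  by (intro antisym w_mono) auto

lemma wnorm_nonneg: "\<phi> \<in> test_space w r \<Longrightarrow> 0 \<le> wnorm w r l \<phi>"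
  by (rule order_trans[OF _ wnorm_upper[of \<phi> w r "[]" l 0]]) (auto simp: w_nonneg)

lemma wnorm_mono_index:
  assumes "\<phi> \<in> test_space w r" "l \<le> l'"
  shows "wnorm w r l \<phi> \<le> wnorm w r l' \<phi>"
proof (rule wnorm_least[OF test_space_C_class[OF assms(1)]])
  fix ks :: "'n list" and x assume "length ks \<le> r"
  then have "w l' x * cmod (pd ks \<phi> x) \<le> wnorm w r l' \<phi>" using assms by (intro wnorm_upper)
  then show "w l x * cmod (pd ks \<phi> x) \<le> wnorm w r l' \<phi>"
    using mult_right_mono[OF w_mono_index[OF assms(2)], of "cmod (pd ks \<phi> x)" x] by simp
qed

lemmas test_lincomb = test_space_lincomb[OF w_nonneg]

lemma test_decay:
  assumes "f \<in> test_space w r"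
  shows "\<exists>C>0. \<forall>ks x. length ks \<le> r \<longrightarrow> w l x * (1 + norm x) ^ p * cmod (pd ks f x) \<le> C"
proof -
  obtain l' C where C: "0 < C" "\<And>x. w l x * (1 + norm x) ^ p \<le> C * w l' x" using w_poly by blast
  have "w l x * (1 + norm x) ^ p * cmod (pd ks f x) \<le> C * (wnorm w r l' f + 1)" if "length ks \<le> r" for ks x
  proof -
    have "w l x * (1 + norm x) ^ p * cmod (pd ks f x) \<le> C * w l' x * cmod (pd ks f x)"
      using C by (intro mult_right_mono) auto
    also have "\<dots> \<le> C * wnorm w r l' f"
      using C wnorm_upper[OF assms that, of l' x] by (simp add: mult.assoc)
    finally show ?thesis using C by (simp add: algebra_simps)
  qed
  moreover have "0 < C * (wnorm w r l' f + 1)"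
    using C wnorm_nonneg[OF assms, of l'] by simp
  ultimately show ?thesis by blast
qed

text \<open>The translation enters only through the factor \<open>w l' c\<close>, so series of
  translates converge as soon as their coefficients decay faster than every weight.
  \<open>(1 + \<bar>b\<bar>) ^ r\<close> dominates all powers of \<open>\<bar>b\<bar>\<close> up to
  \<open>r\<close>, whether \<open>b\<close> is small or large.\<close>

lemma test_affine:
  assumes "b \<noteq> 0"
  shows "\<exists>l' C. 0 < C \<and> (\<forall>c. \<forall>f\<in>test_space w r. (\<lambda>x. f (c + b *\<^sub>R x)) \<in> test_space w r \<and>
     wnorm w r l (\<lambda>x. f (c + b *\<^sub>R x)) \<le> C * w l' c * wnorm w r l' f)"
proof -
  have ex: "\<exists>l' C. 0 < C \<and> (\<forall>c. \<forall>f\<in>test_space w r. \<forall>ks x. length ks \<le> r \<longrightarrow>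
     w l x * cmod (pd ks (\<lambda>x. f (c + b *\<^sub>R x)) x) \<le> C * w l' c * wnorm w r l' f)" for l
  proof -
    obtain l' C where C: "0 < C" "\<And>x. w l ((1/b) *\<^sub>R x) \<le> C * w l' x" using w_scale by blast
    define D where "D = C * (1 + \<bar>b\<bar>) ^ r"
    have "w l x * cmod (pd ks (\<lambda>x. f (c + b *\<^sub>R x)) x) \<le> D * w (2*l') c * wnorm w r (2*l') f"
      if f: "f \<in> test_space w r" and ks: "length ks \<le> r" for c f ks x
    proof -
      have "w l x \<le> C * w l' (b *\<^sub>R x)" using C(2)[of "b *\<^sub>R x"] assms by simp
      also have "w l' (b *\<^sub>R x) = w l' ((c + b *\<^sub>R x) + - c)" by simp
      also have "\<dots> \<le> w (2*l') (c + b *\<^sub>R x) * w (2*l') (- c)" by (rule w_submult)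
      also have "w (2*l') (- c) = w (2*l') c" by (rule w_norm_eq) simp
      finally have 1: "w l x \<le> C * (w (2*l') (c + b *\<^sub>R x) * w (2*l') c)" using C(1) by simp
      have "\<bar>b\<bar> ^ length ks \<le> (1 + \<bar>b\<bar>) ^ length ks" by (intro power_mono) auto
      also have "\<dots> \<le> (1 + \<bar>b\<bar>) ^ r" using ks by (intro power_increasing) auto
      finally have 2: "\<bar>b\<bar> ^ length ks \<le> (1 + \<bar>b\<bar>) ^ r" .
      have "w l x * cmod (pd ks (\<lambda>x. f (c + b *\<^sub>R x)) x) = w l x * (\<bar>b\<bar> ^ length ks * cmod (pd ks f (c + b *\<^sub>R x)))"
        using C_class_affine(2)[OF test_space_C_class[OF f] ks, of c b] by (simp add: power_abs)
      also have "\<dots> \<le> (C * (w (2*l') (c + b *\<^sub>R x) * w (2*l') c)) * ((1 + \<bar>b\<bar>) ^ r * cmod (pd ks f (c + b *\<^sub>R x)))"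
        using 1 2 C(1) w_nonneg by (intro mult_mono) auto
      also have "\<dots> = D * w (2*l') c * (w (2*l') (c + b *\<^sub>R x) * cmod (pd ks f (c + b *\<^sub>R x)))"
        by (simp add: D_def)
      also have "\<dots> \<le> D * w (2*l') c * wnorm w r (2*l') f"
        using C(1) f ks w_nonneg by (intro mult_left_mono wnorm_upper) (auto simp: D_def)
      finally show ?thesis .
    qed
    moreover have "0 < D" using C(1) by (simp add: D_def zero_less_power)
    ultimately show ?thesis by blast
  qed
  have mem: "(\<lambda>x. f (c + b *\<^sub>R x)) \<in> test_space w r" if "f \<in> test_space w r" for c f
    unfolding test_space_iff using ex that C_class_affine(1)[OF test_space_C_class[OF that]] by meson
  obtain l' C where "0 < C" "\<And>c f ks x. f \<in> test_space w r \<Longrightarrow> length ks \<le> r \<Longrightarrow>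
     w l x * cmod (pd ks (\<lambda>x. f (c + b *\<^sub>R x)) x) \<le> C * w l' c * wnorm w r l' f"
    using ex[of l] by blast
  then have "\<forall>c. \<forall>f\<in>test_space w r. (\<lambda>x. f (c + b *\<^sub>R x)) \<in> test_space w r \<and>
     wnorm w r l (\<lambda>x. f (c + b *\<^sub>R x)) \<le> C * w l' c * wnorm w r l' f"
    using mem test_space_C_class by (blast intro: wnorm_least)
  with \<open>0 < C\<close> show ?thesis by blast
qed

text \<open>Induction over the generation of the topology shows that every open set containing 0
  contains a ball of one single norm; finite intersections are harmless because the norms increase
  with the index. Scaling then turns boundedness on a ball into a seminorm estimate.\<close>

lemma dual_bounded:
  assumes f: "f \<in> dual_space w r"
  shows "\<exists>l C. 0 < C \<and> (\<forall>\<phi>\<in>test_space w r. cmod (f \<phi>) \<le> C * wnorm w r l \<phi>)"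
proof -
  let ?X = "test_space w r"
  define S where "S = {{\<psi> \<in> ?X. wnorm w r l (\<lambda>x. \<psi> x - \<phi> x) < e} | l \<phi> e. \<phi> \<in> ?X \<and> e > 0}"
  have nbhd: "\<exists>l e. 0 < e \<and> (\<forall>\<psi>\<in>?X. wnorm w r l \<psi> < e \<longrightarrow> \<psi> \<in> U)"
    if "generate_topology_on S U" "(\<lambda>x. 0) \<in> U" for U
    using that
  proof induction
    case (Int a b)
    then obtain l e l' e' where "0 < e" "\<And>\<psi>. \<psi> \<in> ?X \<Longrightarrow> wnorm w r l \<psi> < e \<Longrightarrow> \<psi> \<in> a"
      "0 < e'" "\<And>\<psi>. \<psi> \<in> ?X \<Longrightarrow> wnorm w r l' \<psi> < e' \<Longrightarrow> \<psi> \<in> b" by blast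
    moreover have "wnorm w r l \<psi> \<le> wnorm w r (max l l') \<psi>" "wnorm w r l' \<psi> \<le> wnorm w r (max l l') \<psi>" if "\<psi> \<in> ?X" for \<psi>
      using that by (auto intro: wnorm_mono_index)
    ultimately show ?case
      by (intro exI[of _ "max l l'"] exI[of _ "min e e'"]) force
  next
    case (UN K)
    then show ?case by blast
  next
    case (Basis s)
    then obtain l \<phi> e where s: "s = {\<psi> \<in> ?X. wnorm w r l (\<lambda>x. \<psi> x - \<phi> x) < e}" and \<phi>: "\<phi> \<in> ?X" "e > 0"
      by (auto simp: S_def)
    have small: "wnorm w r l (\<lambda>x. 0 - \<phi> x) < e" using Basis s by auto
    show ?case
    proof (intro exI conjI ballI impI)
      show "0 < e - wnorm w r l (\<lambda>x. 0 - \<phi> x)" using small by simp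
      fix \<psi> assume \<psi>: "\<psi> \<in> ?X" "wnorm w r l \<psi> < e - wnorm w r l (\<lambda>x. 0 - \<phi> x)"
      have m: "(\<lambda>x. 0 - \<phi> x) \<in> ?X" using test_lincomb(1)[OF \<phi>(1) \<phi>(1), of "-1" 0] by simp
      have "wnorm w r l (\<lambda>x. \<psi> x - \<phi> x) \<le> wnorm w r l \<psi> + wnorm w r l (\<lambda>x. 0 - \<phi> x)"
        using test_lincomb(2)[OF \<psi>(1) m, of l 1 1] by simp
      then show "\<psi> \<in> s" using \<psi> s by simp
    qed
  qed simp
  have hom: "f (\<lambda>x. c * \<phi> x) = c * f \<phi>" if "\<phi> \<in> ?X" for c \<phi>
    using f that by (auto simp: dual_space_def)
  have top: "topspace (test_topology w r) = ?X"
  proof -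
    have "\<psi> \<in> {\<psi>' \<in> ?X. wnorm w r 0 (\<lambda>x. \<psi>' x - \<psi> x) < 1}" if "\<psi> \<in> ?X" for \<psi>
      using that test_space_zero(2)[of w r 0] by simp
    moreover have "{\<psi>' \<in> ?X. wnorm w r 0 (\<lambda>x. \<psi>' x - \<psi> x) < 1} \<in> S" if "\<psi> \<in> ?X" for \<psi>
      unfolding S_def using that zero_less_one by blast
    ultimately have "?X \<subseteq> \<Union>S" by blast
    moreover have "\<Union>S \<subseteq> ?X" by (auto simp: S_def)
    ultimately show ?thesis
      unfolding test_topology_def topology_generated_by_topspace S_def by (rule equalityI[rotated])
  qed
  have f0: "f (\<lambda>x. 0) = 0" using hom[OF test_space_zero(1), of 0] by simp
  have "continuous_map (test_topology w r) euclidean f" using f by (simp add: dual_space_def)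
  then have "openin (test_topology w r) {\<phi> \<in> topspace (test_topology w r). f \<phi> \<in> ball 0 1}"
    by (rule openin_continuous_map_preimage) auto
  then have "generate_topology_on S {\<phi> \<in> ?X. f \<phi> \<in> ball 0 1}"
    unfolding top unfolding test_topology_def S_def openin_topology_generated_by_iff .
  from nbhd[OF this] f0 test_space_zero(1) obtain l e where e: "0 < e"
    "\<And>\<psi>. \<psi> \<in> ?X \<Longrightarrow> wnorm w r l \<psi> < e \<Longrightarrow> cmod (f \<psi>) < 1" by force
  have "cmod (f \<phi>) \<le> 2 / e * wnorm w r l \<phi>" if \<phi>: "\<phi> \<in> ?X" for \<phi>
  proof (rule field_le_epsilon)
    fix d :: real assume d: "0 < d"
    \<comment> \<open>The summand \<open>e * d / 2\<close> keeps \<open>\<nu>\<close> positive when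
      the norm of \<open>\<phi>\<close> is zero, and produces exactly the error \<open>d\<close> at
      the end.\<close>
    define \<nu> where "\<nu> = wnorm w r l \<phi> + e * d / 2"
    have \<nu>: "\<nu> > 0" "wnorm w r l \<phi> < \<nu>" using wnorm_nonneg[OF \<phi>, of l] d e by (auto simp: \<nu>_def add_nonneg_pos)
    let ?c = "of_real (e / (2 * \<nu>)) :: complex"
    have "wnorm w r l (\<lambda>x. ?c * \<phi> x) \<le> e / (2 * \<nu>) * wnorm w r l \<phi>"
      using test_lincomb(2)[OF \<phi> \<phi>, of l ?c 0] e \<nu> by (simp add: norm_divide)
    also have "\<dots> \<le> e / (2 * \<nu>) * \<nu>" using e \<nu> by (intro mult_left_mono) auto
    also have "\<dots> < e" using e \<nu> by simp
    finally have "cmod (f (\<lambda>x. ?c * \<phi> x)) < 1"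
      using test_lincomb(1)[OF \<phi> \<phi>, of ?c 0] by (intro e(2)) auto
    then have "e / (2 * \<nu>) * cmod (f \<phi>) < 1" unfolding hom[OF \<phi>] using e \<nu> by (simp add: norm_mult norm_divide)
    then have "cmod (f \<phi>) < 2 * \<nu> / e" using e \<nu> by (simp add: field_simps)
    then show "cmod (f \<phi>) \<le> 2 / e * wnorm w r l \<phi> + d" using e by (simp add: \<nu>_def field_simps)
  qed
  with e show ?thesis by (intro exI[of _ l] exI[of _ "2 / e"]) auto
qed

end

section \<open>Series of test functions and uniform boundedness\<close>

lemma has_vector_derivative_suminf:
  fixes f :: "nat \<Rightarrow> real \<Rightarrow> 'b::banach"
  assumes der: "\<And>n t. (f n has_vector_derivative f' n t) (at t)"
    and bound: "\<And>n t. norm (f' n t) \<le> M n" and M: "summable M"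
    and sum: "\<And>t. summable (\<lambda>n. f n t)"
  shows "((\<lambda>t. \<Sum>n. f n t) has_vector_derivative (\<Sum>n. f' n t)) (at t)"
proof -
  have unif: "uniform_limit UNIV (\<lambda>n t. \<Sum>i<n. f' i t) (\<lambda>t. \<Sum>i. f' i t) sequentially"
    using bound M by (intro Weierstrass_m_test) auto
  have "\<exists>g. \<forall>x\<in>UNIV. (\<lambda>n. f n x) sums g x \<and> (g has_derivative (\<lambda>h. h *\<^sub>R (\<Sum>n. f' n x))) (at x within UNIV)"
  proof (rule has_derivative_series[where f'="\<lambda>n t h. h *\<^sub>R f' n t" and x=0])
    fix e :: real assume "e > 0"
    then have "\<forall>\<^sub>F n in sequentially. \<forall>t. norm ((\<Sum>i<n. f' i t) - (\<Sum>i. f' i t)) < e"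
      using unif by (auto simp: uniform_limit_iff dist_norm)
    then show "\<forall>\<^sub>F n in sequentially. \<forall>t\<in>UNIV. \<forall>h. norm ((\<Sum>i<n. h *\<^sub>R f' i t) - h *\<^sub>R (\<Sum>i. f' i t)) \<le> e * norm h"
    proof eventually_elim
      case (elim n)
      have "norm ((\<Sum>i<n. h *\<^sub>R f' i t) - h *\<^sub>R (\<Sum>i. f' i t)) = \<bar>h\<bar> * norm ((\<Sum>i<n. f' i t) - (\<Sum>i. f' i t))" for t h
        by (simp flip: scaleR_sum_right scaleR_diff_right)
      moreover have "\<bar>h\<bar> * norm ((\<Sum>i<n. f' i t) - (\<Sum>i. f' i t)) \<le> \<bar>h\<bar> * e" for t h
        using elim by (intro mult_left_mono) (auto intro: less_imp_le)
      ultimately show ?case by (simp add: mult.commute)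
    qed
  qed (use der sum in \<open>auto simp: has_vector_derivative_def intro: summable_sums\<close>)
  then obtain g where g: "\<And>x. (\<lambda>n. f n x) sums g x" "\<And>x. (g has_derivative (\<lambda>h. h *\<^sub>R (\<Sum>n. f' n x))) (at x)"
    by auto
  have "g = (\<lambda>t. \<Sum>n. f n t)" using g(1) by (simp add: fun_eq_iff sums_iff)
  then show ?thesis using g(2) by (simp add: has_vector_derivative_def)
qed

text \<open>Continuity in the form of one seminorm estimate. It passes easily to dilated functionals
  and is the only form in which continuity is used from here on.\<close>

definition bounded_functional ::
  "(nat \<Rightarrow> real^'n::finite \<Rightarrow> real) \<Rightarrow> nat \<Rightarrow> 'n distr \<Rightarrow> bool" where
  "bounded_functional w r f \<longleftrightarrow>
     (\<forall>\<phi>\<in>test_space w r. \<forall>\<psi>\<in>test_space w r. f (\<lambda>x. \<phi> x + \<psi> x) = f \<phi> + f \<psi>)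
   \<and> (\<forall>c. \<forall>\<phi>\<in>test_space w r. f (\<lambda>x. c * \<phi> x) = c * f \<phi>)
   \<and> (\<exists>l C. 0 < C \<and> (\<forall>\<phi>\<in>test_space w r. cmod (f \<phi>) \<le> C * wnorm w r l \<phi>))"

context weight_family begin

lemma dual_bounded_functional: "f \<in> dual_space w r \<Longrightarrow> bounded_functional w r f"
  using dual_bounded[of f] by (simp add: bounded_functional_def dual_space_def)

lemma bounded_functional_lincomb:
  assumes f: "bounded_functional w r f" and "\<phi> \<in> test_space w r" "\<psi> \<in> test_space w r"
  shows "f (\<lambda>x. c * \<phi> x + d * \<psi> x) = c * f \<phi> + d * f \<psi>"
proof -
  have "(\<lambda>x. c * \<phi> x) \<in> test_space w r" "(\<lambda>x. d * \<psi> x) \<in> test_space w r"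
    using test_lincomb(1)[OF assms(2,2), of c 0] test_lincomb(1)[OF assms(3,3), of d 0] by auto
  then show ?thesis using assms by (auto simp: bounded_functional_def)
qed

lemma test_minus:
  assumes "\<phi> \<in> test_space w r" "\<psi> \<in> test_space w r"
  shows "(\<lambda>x. \<phi> x - \<psi> x) \<in> test_space w r"
  using test_lincomb(1)[OF assms, of 1 "-1"] by simp

lemma bounded_functional_minus:
  assumes f: "bounded_functional w r f" and "\<phi> \<in> test_space w r" "\<psi> \<in> test_space w r"
  shows "f (\<lambda>x. \<phi> x - \<psi> x) = f \<phi> - f \<psi>"
  using bounded_functional_lincomb[OF assms, of 1 "-1"] by simp

lemma test_sum:
  assumes "\<And>k. k \<in> A \<Longrightarrow> h k \<in> test_space w r"
  shows "(\<lambda>x. \<Sum>k\<in>A. h k x) \<in> test_space w r"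
  using assms
proof (induction A rule: infinite_finite_induct)
  case (insert a A)
  then show ?case using test_lincomb(1)[where f="h a" and g="\<lambda>x. \<Sum>k\<in>A. h k x" and c=1 and d=1] by simp
qed (auto simp: test_space_zero)

lemma bounded_functional_sum:
  assumes f: "bounded_functional w r f" and "\<And>k. k \<in> A \<Longrightarrow> h k \<in> test_space w r"
  shows "f (\<lambda>x. \<Sum>k\<in>A. h k x) = (\<Sum>k\<in>A. f (h k))"
proof -
  have f0: "f (\<lambda>x. 0) = 0"
    using bounded_functional_lincomb[OF f test_space_zero(1) test_space_zero(1), of 0 0] by simp
  show ?thesis
    using assms(2)
  proof (induction A rule: infinite_finite_induct)
    case (insert a A)
    then show ?case
      using bounded_functional_lincomb[OF f, of "h a" "\<lambda>x. \<Sum>k\<in>A. h k x" 1 1] test_sum[of A h] by simp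
  qed (auto simp: f0)
qed

text \<open>This takes the place of completeness of the test space: summability of all norms makes
  the pointwise sum a test function. As the weights are at least 1, the norm of index 0 dominates
  every derivative uniformly and permits termwise differentiation.\<close>

lemma
  assumes h: "\<And>k. h k \<in> test_space w r" and S: "\<And>l. summable (\<lambda>k. wnorm w r l (h k))"
  shows test_suminf: "(\<lambda>x. \<Sum>k. h k x) \<in> test_space w r"
    and pd_suminf: "length ks \<le> r \<Longrightarrow> pd ks (\<lambda>x. \<Sum>k. h k x) = (\<lambda>x. \<Sum>k. pd ks (h k) x)"
    and summable_pd: "length ks \<le> r \<Longrightarrow> summable (\<lambda>k. cmod (pd ks (h k) x))"
    and wnorm_suminf: "wnorm w r l (\<lambda>x. \<Sum>k. h k x) \<le> (\<Sum>k. wnorm w r l (h k))"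
proof -
  let ?G = "\<lambda>ks x. \<Sum>k. pd ks (h k) x"
  have b: "cmod (pd ks (h k) x) \<le> wnorm w r 0 (h k)" if "length ks \<le> r" for ks k x
    using wnorm_upper[OF h that, of 0 x k] mult_right_mono[OF w_ge1[of 0 x], of "cmod (pd ks (h k) x)"] by simp
  have sm: "summable (\<lambda>k. cmod (pd ks (h k) x))" if "length ks \<le> r" for ks x
    by (rule summable_comparison_test'[OF S[of 0], of 0]) (use b that in auto)
  have sm': "summable (\<lambda>k. pd ks (h k) x)" if "length ks \<le> r" for ks x
    using sm[OF that] by (rule summable_norm_cancel)
  have 1: "continuous_on UNIV (?G ks)" if ks: "length ks \<le> r" for ks
  proof (rule uniform_limit_theorem[OF _ Weierstrass_m_test[OF b[OF ks] S[of 0]]])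
    show "\<forall>\<^sub>F n in sequentially. continuous_on UNIV (\<lambda>x. \<Sum>k<n. pd ks (h k) x)"
      using test_space_continuous[OF h ks] by (intro always_eventually allI continuous_on_sum) auto
  qed auto
  have 2: "((\<lambda>t. ?G ks (x + t *\<^sub>R axis i 1)) has_vector_derivative ?G (i # ks) x) (at 0)" if ks: "length ks < r" for ks i x
  proof -
    have "((\<lambda>t. ?G ks (x + t *\<^sub>R axis i 1)) has_vector_derivative (\<Sum>k. pd (i # ks) (h k) (x + 0 *\<^sub>R axis i 1))) (at 0)"
      using C_class_has_derivative[OF test_space_C_class[OF h] ks] b[of "i # ks"] sm'[of ks] ks S[of 0]
      by (intro has_vector_derivative_suminf[where M="\<lambda>k. wnorm w r 0 (h k)"]) auto
    then show ?thesis by simp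
  qed
  have C: "C_class r (\<lambda>x. \<Sum>k. h k x)"
    using C_classI(1)[of r ?G, OF 1 2] by simp
  have eq: "pd ks (\<lambda>x. \<Sum>k. h k x) = ?G ks" if "length ks \<le> r" for ks
    using C_classI(2)[of r ?G, OF 1 2 that] by simp
  have B: "w l x * cmod (pd ks (\<lambda>x. \<Sum>k. h k x) x) \<le> (\<Sum>k. wnorm w r l (h k))" if ks: "length ks \<le> r" for ks l x
  proof -
    have "w l x * cmod (?G ks x) \<le> w l x * (\<Sum>k. cmod (pd ks (h k) x))"
      by (intro mult_left_mono summable_norm sm ks w_nonneg)
    also have "\<dots> = (\<Sum>k. w l x * cmod (pd ks (h k) x))" by (rule suminf_mult[symmetric, OF sm[OF ks]])
    also have "\<dots> \<le> (\<Sum>k. wnorm w r l (h k))"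
      by (intro suminf_le summable_mult sm ks S wnorm_upper h)
    finally show ?thesis using eq[OF ks] by simp
  qed
  show "(\<lambda>x. \<Sum>k. h k x) \<in> test_space w r" unfolding test_space_iff using C B by blast
  show "wnorm w r l (\<lambda>x. \<Sum>k. h k x) \<le> (\<Sum>k. wnorm w r l (h k))" using C B by (rule wnorm_least)
  show "length ks \<le> r \<Longrightarrow> pd ks (\<lambda>x. \<Sum>k. h k x) = ?G ks" by (rule eq)
  show "length ks \<le> r \<Longrightarrow> summable (\<lambda>k. cmod (pd ks (h k) x))" by (rule sm)
qed

lemma suminf_split_at:
  assumes h: "\<And>k. h k \<in> test_space w r" and S: "\<And>l. summable (\<lambda>k. wnorm w r l (h k))"
  shows "(\<lambda>x. (\<Sum>k. h k x) - (\<Sum>k<n. h k x)) = (\<lambda>x. \<Sum>k. h (k + n) x)"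
proof
  fix x
  have "summable (\<lambda>k. cmod (pd [] (h k) x))" by (rule summable_pd[OF h S]) simp
  then have "summable (\<lambda>k. h k x)" by (simp add: summable_norm_cancel)
  then show "(\<Sum>k. h k x) - (\<Sum>k<n. h k x) = (\<Sum>k. h (k + n) x)"
    by (rule suminf_minus_initial_segment[symmetric])
qed

lemma bounded_functional_suminf:
  assumes f: "bounded_functional w r f"
    and h: "\<And>k. h k \<in> test_space w r" and S: "\<And>l. summable (\<lambda>k. wnorm w r l (h k))"
  shows "(\<lambda>k. f (h k)) sums f (\<lambda>x. \<Sum>k. h k x)"
proof -
  obtain l C where C: "0 < C" "\<And>\<phi>. \<phi> \<in> test_space w r \<Longrightarrow> cmod (f \<phi>) \<le> C * wnorm w r l \<phi>"
    using f unfolding bounded_functional_def by blast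
  let ?H = "\<lambda>x. \<Sum>k. h k x" and ?a = "\<lambda>k. wnorm w r l (h k)"
  have "cmod ((\<Sum>k<n. f (h k)) - f ?H) \<le> C * ((\<Sum>k. ?a k) - (\<Sum>k<n. ?a k))" for n
  proof -
    have S': "summable (\<lambda>k. wnorm w r l (h (k + n)))" for l using S[of l] by (subst summable_iff_shift)
    have "f ?H - (\<Sum>k<n. f (h k)) = f (\<lambda>x. ?H x - (\<Sum>k<n. h k x))"
      using bounded_functional_minus[OF f test_suminf[OF h S] test_sum[of "{..<n}" h]]
        bounded_functional_sum[OF f, of "{..<n}" h] h by simp
    then have "cmod ((\<Sum>k<n. f (h k)) - f ?H) = cmod (f (\<lambda>x. \<Sum>k. h (k + n) x))"
      unfolding suminf_split_at[OF h S, of n] using norm_minus_commute[of "\<Sum>k<n. f (h k)" "f ?H"] by simp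
    also have "\<dots> \<le> C * wnorm w r l (\<lambda>x. \<Sum>k. h (k + n) x)"
      by (intro C(2) test_suminf h S')
    also have "\<dots> \<le> C * (\<Sum>k. ?a (k + n))"
      using C(1) by (intro mult_left_mono wnorm_suminf h S') auto
    finally show ?thesis by (simp add: suminf_minus_initial_segment[OF S])
  qed
  moreover have "(\<lambda>n. C * ((\<Sum>k. ?a k) - (\<Sum>k<n. ?a k))) \<longlonglongrightarrow> C * ((\<Sum>k. ?a k) - (\<Sum>k. ?a k))"
    by (intro tendsto_intros summable_LIMSEQ S)
  then have "(\<lambda>n. C * ((\<Sum>k. ?a k) - (\<Sum>k<n. ?a k))) \<longlonglongrightarrow> 0" by simp
  ultimately have "(\<lambda>n. (\<Sum>k<n. f (h k)) - f ?H) \<longlonglongrightarrow> 0"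
    by (rule Lim_null_comparison[OF always_eventually, OF allI])
  then show ?thesis unfolding sums_def by (simp add: LIM_zero_iff)
qed

text \<open>Sokal's argument: as \<open>F (x + \<psi>) - F (x - \<psi>) = 2 F \<psi>\<close>, each step can be taken in the direction that
  makes the functional at least as large as on the increment, so no cross terms have to be controlled.\<close>

lemma uniform_boundedness:
  fixes F :: "nat \<Rightarrow> 'n distr"
  assumes F: "\<And>k. bounded_functional w r (F k)"
    and pw: "\<And>\<theta>. \<theta> \<in> test_space w r \<Longrightarrow> \<exists>B. \<forall>k. cmod (F k \<theta>) \<le> B"
  shows "\<exists>l C. 0 < C \<and> (\<forall>k. \<forall>\<theta>\<in>test_space w r. cmod (F k \<theta>) \<le> C * wnorm w r l \<theta>)"
proof (rule ccontr)
  let ?X = "test_space w r"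
  assume "\<not> ?thesis"
  then have unb: "\<exists>k. \<exists>\<theta>\<in>?X. C * wnorm w r l \<theta> < cmod (F k \<theta>)" if "0 < C" for l C
    using that by (meson not_le)
  have step: "\<exists>k. \<exists>\<psi>\<in>?X. wnorm w r l \<psi> \<le> e \<and> A < cmod (F k \<psi>)" if e: "0 < e" and A: "0 \<le> A" for l e A
  proof -
    \<comment> \<open>The constant is such that scaling \<open>\<theta>\<close> until the functional
      has modulus \<open>A + 1\<close> leaves a norm of at most \<open>e\<close>.\<close>
    obtain k \<theta> where \<theta>: "\<theta> \<in> ?X" and big: "(A + 1) / e * wnorm w r l \<theta> < cmod (F k \<theta>)"
      using unb[of "(A + 1) / e" l] e A by auto
    have pos: "0 < cmod (F k \<theta>)"
      using big e A wnorm_nonneg[OF \<theta>, of l] by (smt (verit) divide_nonneg_pos mult_nonneg_nonneg)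
    let ?c = "of_real ((A + 1) / cmod (F k \<theta>)) :: complex"
    have c: "cmod ?c = (A + 1) / cmod (F k \<theta>)" using A by (simp add: norm_divide)
    have "wnorm w r l (\<lambda>x. ?c * \<theta> x) \<le> (A + 1) / cmod (F k \<theta>) * wnorm w r l \<theta>"
      using test_lincomb(2)[OF \<theta> \<theta>, of l ?c 0] c by simp
    also have "\<dots> \<le> e" using big e A pos by (simp add: field_simps)
    finally have 1: "wnorm w r l (\<lambda>x. ?c * \<theta> x) \<le> e" .
    have "F k (\<lambda>x. ?c * \<theta> x) = ?c * F k \<theta>" using bounded_functional_lincomb[OF F \<theta> \<theta>, of k ?c 0] by simp
    then have "cmod (F k (\<lambda>x. ?c * \<theta> x)) = cmod ?c * cmod (F k \<theta>)" by (simp only: norm_mult)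
    then have "cmod (F k (\<lambda>x. ?c * \<theta> x)) = A + 1" unfolding c using pos by simp
    then have 2: "A < cmod (F k (\<lambda>x. ?c * \<theta> x))" by simp
    have "(\<lambda>x. ?c * \<theta> x) \<in> ?X" using test_lincomb(1)[OF \<theta> \<theta>, of ?c 0] by simp
    with 1 2 show ?thesis by blast
  qed
  \<comment> \<open>A state holds the current point \<open>x\<close>, a norm index \<open>p\<close>,
    a radius \<open>e\<close> and the number \<open>k\<close> of a functional that is large at
    \<open>x\<close>. The last clause protects this: a perturbation of norm at most
    \<open>2 * e\<close> changes the value by at most 1.\<close>
  define P where "P n s = (case s of (x, p, e, k) \<Rightarrow> x \<in> ?X \<and> 0 < e \<and> real n < cmod (F k x)
     \<and> (\<forall>\<psi>\<in>?X. wnorm w r p \<psi> \<le> 2 * e \<longrightarrow> cmod (F k \<psi>) \<le> 1))" for n :: nat and s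
  define Q where "Q s s' = (case s of (x, p, e, k) \<Rightarrow> case s' of (x', p', e', k') \<Rightarrow>
     p + 1 \<le> p' \<and> e' \<le> e / 2 \<and> wnorm w r p (\<lambda>y. x' y - x y) \<le> e)"
    for s s' :: "(real^'n \<Rightarrow> complex) \<times> nat \<times> real \<times> nat"
  have next_state: "\<exists>s'. P n s' \<and> Q (x, p, e, k) s'" if x: "x \<in> ?X" and e: "0 < e" for x p e k n
  proof -
    obtain k' \<psi> where \<psi>: "\<psi> \<in> ?X" "wnorm w r p \<psi> \<le> e" "real n < cmod (F k' \<psi>)"
      using step[OF e, of "real n" p] by auto
    let ?y = "\<lambda>c z. 1 * x z + c * \<psi> z"
    have yX: "?y c \<in> ?X" for c by (rule test_lincomb(1)[OF x \<psi>(1)])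
    have Fy: "F k' (?y c) = F k' x + c * F k' \<psi>" for c
      using bounded_functional_lincomb[OF F x \<psi>(1), of k' 1 c] by simp
    have "2 * cmod (F k' \<psi>) = cmod (F k' (?y 1) - F k' (?y (-1)))" unfolding Fy by (simp add: norm_mult flip: mult_2)
    also have "\<dots> \<le> cmod (F k' (?y 1)) + cmod (F k' (?y (-1)))" by (rule norm_triangle_ineq4)
    finally have "real n < cmod (F k' (?y 1)) \<or> real n < cmod (F k' (?y (-1)))" using \<psi>(3) by linarith
    then obtain c :: complex where c: "cmod c = 1" "real n < cmod (F k' (?y c))"
    proof
      assume "real n < cmod (F k' (?y 1))"
      then show thesis by (intro that[of 1]) auto
    next
      assume "real n < cmod (F k' (?y (-1)))"
      then show thesis by (intro that[of "-1"]) auto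
    qed
    have "wnorm w r p (\<lambda>z. ?y c z - x z) \<le> e"
      using test_lincomb(2)[OF \<psi>(1) \<psi>(1), of p c 0] c \<psi>(2) by simp
    moreover obtain l C where C: "0 < C" "\<And>\<phi>. \<phi> \<in> ?X \<Longrightarrow> cmod (F k' \<phi>) \<le> C * wnorm w r l \<phi>"
      using F[of k'] unfolding bounded_functional_def by blast
    \<comment> \<open>The new radius makes \<open>C\<close> times twice the radius at most 1, while
      the new index exceeds both the old one and the index in the estimate for \<open>F k'\<close>.
      Halving the radius makes all later increments summable.\<close>
    have "cmod (F k' \<phi>) \<le> 1" if "\<phi> \<in> ?X" "wnorm w r (max (p + 1) l) \<phi> \<le> 2 * min (e / 2) (1 / (2 * C))" for \<phi>
    proof -
      have "cmod (F k' \<phi>) \<le> C * wnorm w r (max (p + 1) l) \<phi>"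
        using C(1) wnorm_mono_index[OF that(1), of l "max (p + 1) l"]
        by (intro order_trans[OF C(2)[OF that(1)]] mult_left_mono) auto
      also have "\<dots> \<le> C * (2 * (1 / (2 * C)))" using C(1) that(2) by (intro mult_left_mono) auto
      finally show ?thesis using C(1) by simp
    qed
    ultimately have "P n (?y c, max (p + 1) l, min (e / 2) (1 / (2 * C)), k') \<and>
        Q (x, p, e, k) (?y c, max (p + 1) l, min (e / 2) (1 / (2 * C)), k')"
      unfolding P_def Q_def prod.case using yX[of c] c(2) e C(1) by (intro conjI ballI impI) simp_all
    then show ?thesis by blast
  qed
  have "\<exists>s. \<forall>n. P n (s n) \<and> Q (s n) (s (Suc n))"
  proof (rule dependent_nat_choice)
    show "\<exists>s. P 0 s" using next_state[OF test_space_zero(1) zero_less_one, of 0] by blast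
    show "\<exists>s'. P (Suc n) s' \<and> Q s s'" if "P n s" for s n
    proof (cases s)
      case (fields x p e k)
      with that have "x \<in> ?X" "0 < e" by (auto simp: P_def)
      then show ?thesis unfolding fields by (rule next_state)
    qed
  qed
  then obtain s where s: "\<And>n. P n (s n)" "\<And>n. Q (s n) (s (Suc n))" by auto
  define x where "x n = fst (s n)" for n
  define p where "p n = fst (snd (s n))" for n
  define e where "e n = fst (snd (snd (s n)))" for n
  define k where "k n = snd (snd (snd (s n)))" for n
  have x: "x n \<in> ?X" and e: "0 < e n" and big: "real n < cmod (F (k n) (x n))"
    and small: "\<And>\<psi>. \<psi> \<in> ?X \<Longrightarrow> wnorm w r (p n) \<psi> \<le> 2 * e n \<Longrightarrow> cmod (F (k n) \<psi>) \<le> 1" for n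
    using s(1)[of n] by (auto simp: P_def x_def p_def e_def k_def case_prod_unfold)
  have p: "p n + 1 \<le> p (Suc n)" and e2: "e (Suc n) \<le> e n / 2"
    and inc: "wnorm w r (p n) (\<lambda>y. x (Suc n) y - x n y) \<le> e n" for n
    using s(2)[of n] by (auto simp: Q_def x_def p_def e_def case_prod_unfold)
  have p_ge: "p n + m \<le> p (n + m)" for n m
  proof (induction m)
    case (Suc m) then show ?case using p[of "n + m"] by simp
  qed simp
  have e_le: "e (n + m) \<le> e n * (1/2) ^ m" for n m
  proof (induction m)
    case (Suc m) then show ?case using e2[of "n + m"] by simp
  qed simp
  define h where "h n = (\<lambda>y. x (Suc n) y - x n y)" for n
  have h: "h n \<in> ?X" for n unfolding h_def by (intro test_minus x)
  have h_le: "wnorm w r l (h (n + m)) \<le> e n * (1/2) ^ m" if "l \<le> p (n + m)" for l n m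
    using wnorm_mono_index[OF h[of "n + m"] that] inc[of "n + m"] e_le[of n m] unfolding h_def by linarith
  have geo: "summable (\<lambda>m. e n * (1/2) ^ m)" for n by (intro summable_mult summable_geometric) auto
  have S: "summable (\<lambda>n. wnorm w r l (h n))" for l
  proof (rule summable_comparison_test'[OF geo[of 0], of l])
    show "norm (wnorm w r l (h n)) \<le> e 0 * (1/2) ^ n" if "l \<le> n" for n
      using h_le[of l 0 n] p_ge[of 0 n] wnorm_nonneg[OF h, of l n] that by simp
  qed
  define z where "z = (\<lambda>y. x 0 y + (\<Sum>n. h n y))"
  have z: "z \<in> ?X" unfolding z_def using test_lincomb(1)[OF x[of 0] test_suminf[OF h S], of 1 1] by simp
  have tel: "x n y = x 0 y + (\<Sum>m<n. h m y)" for n y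
    by (induction n) (auto simp: h_def)
  have zx: "(\<lambda>y. z y - x n y) = (\<lambda>y. \<Sum>m. h (m + n) y)" for n
    unfolding suminf_split_at[OF h S, of n, symmetric] by (auto simp: z_def tel[of n])
  \<comment> \<open>In the norm of index \<open>p n\<close> the increments after stage
    \<open>n\<close> add up to at most \<open>2 * e n\<close>, the perturbation allowed by
    \<open>P\<close>. So the value at the limit drops below that at \<open>x n\<close> by at most
    1.\<close>
  have "real n - 1 \<le> cmod (F (k n) z)" for n
  proof -
    have S': "summable (\<lambda>m. wnorm w r l (h (m + n)))" for l using S[of l] by (subst summable_iff_shift)
    have "wnorm w r (p n) (\<lambda>y. z y - x n y) \<le> (\<Sum>m. wnorm w r (p n) (h (m + n)))"
      unfolding zx by (rule wnorm_suminf[OF h S'])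
    also have "\<dots> \<le> (\<Sum>m. e n * (1/2) ^ m)"
    proof (rule suminf_le[OF _ S' geo])
      show "wnorm w r (p n) (h (m + n)) \<le> e n * (1/2) ^ m" for m
        using h_le[of "p n" n m] p_ge[of n m] by (simp add: add.commute)
    qed
    also have "\<dots> = 2 * e n" by (simp add: suminf_mult suminf_geometric)
    finally have "cmod (F (k n) (\<lambda>y. z y - x n y)) \<le> 1" by (intro small test_minus z x)
    then have "cmod (F (k n) z - F (k n) (x n)) \<le> 1" using bounded_functional_minus[OF F z x] by simp
    then show ?thesis using big[of n] norm_triangle_ineq2[of "F (k n) (x n)" "F (k n) z"]
      by (simp add: norm_minus_commute)
  qed
  moreover obtain B where "\<And>k. cmod (F k z) \<le> B" using pw[OF z] by blast
  ultimately have "real n - 1 \<le> B" for n using order_trans by blast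
  then show False using reals_Archimedean2[of "B + 1"] by (meson diff_le_eq not_le)
qed

text \<open>Functionals and arguments may vary together: a common seminorm bound transfers the
  convergence of \<open>\<eta> k\<close> to 0 in every norm to the values.\<close>

lemma pointwise_bounded_null:
  assumes F: "\<And>k. bounded_functional w r (F k)"
    and pw: "\<And>\<theta>. \<theta> \<in> test_space w r \<Longrightarrow> \<exists>B. \<forall>k. cmod (F k \<theta>) \<le> B"
    and \<eta>: "\<And>k. \<eta> k \<in> test_space w r" and null: "\<And>l. (\<lambda>k. wnorm w r l (\<eta> k)) \<longlonglongrightarrow> 0"
  shows "(\<lambda>k. F k (\<eta> k)) \<longlonglongrightarrow> 0"
proof -
  obtain l C where C: "\<And>k \<theta>. \<theta> \<in> test_space w r \<Longrightarrow> cmod (F k \<theta>) \<le> C * wnorm w r l \<theta>"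
    using uniform_boundedness[OF F pw] by blast
  show ?thesis
  proof (rule Lim_null_comparison)
    show "\<forall>\<^sub>F k in sequentially. cmod (F k (\<eta> k)) \<le> C * wnorm w r l (\<eta> k)"
      by (intro always_eventually allI C \<eta>)
    show "(\<lambda>k. C * wnorm w r l (\<eta> k)) \<longlonglongrightarrow> 0"
      using null[of l] by (rule tendsto_mult_right_zero)
  qed
qed

end

section \<open>Lattice sums\<close>

lemma
  fixes f :: "'a::euclidean_space \<Rightarrow> 'b::{banach, second_countable_topology}"
  assumes c: "c \<noteq> 0" and f: "integrable lborel f"
  shows lborel_integrable_affine: "integrable lborel (\<lambda>x. f (t + c *\<^sub>R x))"
    and lborel_integral_affine: "(\<integral>x. f x \<partial>lborel) = \<bar>c\<bar> ^ DIM('a) *\<^sub>R (\<integral>x. f (t + c *\<^sub>R x) \<partial>lborel)"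
proof -
  have m [measurable]: "f \<in> borel_measurable borel" using f by (simp add: borel_measurable_integrable)
  have T [measurable]: "(\<lambda>x. t + c *\<^sub>R x) \<in> lborel \<rightarrow>\<^sub>M borel" by simp
  have "integrable (density (distr lborel borel (\<lambda>x. t + c *\<^sub>R x)) (\<lambda>_. ennreal (\<bar>c\<bar> ^ DIM('a)))) f"
    using f lborel_affine[OF c, of t] by metis
  then have "integrable (distr lborel borel (\<lambda>x. t + c *\<^sub>R x)) (\<lambda>x. \<bar>c\<bar> ^ DIM('a) *\<^sub>R f x)"
    by (subst (asm) integrable_density) auto
  then have "integrable lborel (\<lambda>x. \<bar>c\<bar> ^ DIM('a) *\<^sub>R f (t + c *\<^sub>R x))"
    by (subst (asm) integrable_distr_eq) auto
  from integrable_scaleR_right[OF this, of "inverse (\<bar>c\<bar> ^ DIM('a))"]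
  show "integrable lborel (\<lambda>x. f (t + c *\<^sub>R x))" using c by simp
  have "(\<integral>x. f x \<partial>lborel) = (\<integral>x. f x \<partial>density (distr lborel borel (\<lambda>x. t + c *\<^sub>R x)) (\<lambda>_. ennreal (\<bar>c\<bar> ^ DIM('a))))"
    using lborel_affine[OF c, of t] by metis
  also have "\<dots> = (\<integral>x. \<bar>c\<bar> ^ DIM('a) *\<^sub>R f x \<partial>distr lborel borel (\<lambda>x. t + c *\<^sub>R x))"
    by (subst integral_density) auto
  also have "\<dots> = (\<integral>x. \<bar>c\<bar> ^ DIM('a) *\<^sub>R f (t + c *\<^sub>R x) \<partial>lborel)"
    by (subst integral_distr) auto
  finally show "(\<integral>x. f x \<partial>lborel) = \<bar>c\<bar> ^ DIM('a) *\<^sub>R (\<integral>x. f (t + c *\<^sub>R x) \<partial>lborel)"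
    by simp
qed

text \<open>The exponent is the first integer above the dimension, which makes the function
  integrable over the space and summable over the lattice.\<close>

definition decay :: "real^'n::finite \<Rightarrow> real" where
  "decay x = inverse ((1 + norm x) ^ (CARD('n) + 1))"

lemma decay_pos: "0 < decay (x :: real^'a::finite)" and decay_le1: "decay x \<le> 1" and decay_minus [simp]: "decay (- x) = decay x"
proof -
  have "1 \<le> (1 + norm x) ^ (CARD('a) + 1)" by (intro one_le_power) simp
  then show "0 < decay x" "decay x \<le> 1"
    unfolding decay_def inverse_le_1_iff inverse_positive_iff_positive by linarith+
  show "decay (- x) = decay x" by (simp add: decay_def)
qed

lemma decay_nonneg [simp]: "0 \<le> decay x" using decay_pos[of x] by simp

lemma continuous_on_decay [continuous_intros]:
  "continuous_on A f \<Longrightarrow> continuous_on A (\<lambda>x. decay (f x))"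
  unfolding decay_def using norm_ge_zero
  by (intro continuous_intros) (auto simp: add_nonneg_eq_0_iff)

lemma borel_measurable_decay [measurable]: "decay \<in> borel_measurable borel"
  by (rule borel_measurable_continuous_onI) (intro continuous_intros)

text \<open>Domination by a sum over dyadic balls: the height on the ball of radius
  \<open>2 ^ k\<close> times its volume is a constant times \<open>(1 / 2) ^ k\<close>. At a given
  point, the smallest ball containing it already dominates, since its radius is at most
  \<open>2 * (1 + norm x)\<close>.\<close>

lemma integrable_decay: "integrable lborel (decay :: real^'n::finite \<Rightarrow> real)"
proof -
  let ?P = "CARD('n) + 1"
  define f where "f k x = (2::real) ^ ?P / (2 ^ k) ^ ?P * indicator (ball 0 (2 ^ k)) x" for k and x :: "real^'n"
  have int_f: "integrable lborel (f k)" for k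
    unfolding f_def by (intro integrable_mult_right integrable_real_indicator) (auto simp: emeasure_ball)
  have f_nonneg: "0 \<le> f k x" for k x by (simp add: f_def)
  have geo: "(2::real) ^ ?P / (2 ^ k) ^ ?P = 2 ^ ?P * (1 / 2 ^ ?P) ^ k" for k
    by (simp add: power_divide mult.commute flip: power_mult)
  have sum_geo: "summable (\<lambda>k. (2::real) ^ ?P / (2 ^ k) ^ ?P)"
    unfolding geo by (intro summable_mult summable_geometric) (simp add: less_1_mult)
  have sum_f: "summable (\<lambda>k. norm (f k x))" for x
    by (rule summable_comparison_test'[OF sum_geo, of 0]) (simp add: f_def indicator_def)
  have "(\<integral>x. norm (f k x) \<partial>lborel) = 2 ^ ?P * unit_ball_vol CARD('n) * (1 / 2) ^ k" for k
  proof -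
    have "(\<integral>x. norm (f k x) \<partial>lborel) = 2 ^ ?P / (2 ^ k) ^ ?P * measure lborel (ball (0 :: real^'n) (2 ^ k))"
      using f_nonneg by (simp add: f_def)
    also have "measure lborel (ball (0 :: real^'n) (2 ^ k)) = unit_ball_vol CARD('n) * (2 ^ k) ^ CARD('n)"
      using content_ball[of "2 ^ k" "0 :: real^'n"] by simp
    finally show ?thesis by (simp add: field_simps)
  qed
  then have "summable (\<lambda>k. \<integral>x. norm (f k x) \<partial>lborel)"
    by (simp only:) (intro summable_mult summable_geometric, simp)
  then have "integrable lborel (\<lambda>x. \<Sum>k. f k x)"
    using sum_f by (intro integrable_suminf int_f) auto
  then show ?thesis
  proof (rule Bochner_Integration.integrable_bound)
    have "decay x \<le> (\<Sum>k. f k x)" for x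
    proof -
      obtain k0 where "norm x < 2 ^ k0" using real_arch_pow[of 2 "norm x"] by auto
      define k where "k = (LEAST k. norm x < 2 ^ k)"
      have k: "norm x < 2 ^ k" unfolding k_def by (rule LeastI) fact
      have "2 ^ k \<le> 2 * (1 + norm x)"
      proof (cases k)
        case (Suc j)
        then have "\<not> norm x < 2 ^ j" unfolding k_def using not_less_Least by (metis lessI)
        then show ?thesis using Suc by simp
      qed simp
      then have "(2 ^ k / 2) ^ ?P \<le> (1 + norm x) ^ ?P" by (intro power_mono) auto
      then have "decay x \<le> inverse ((2 ^ k / 2) ^ ?P)" unfolding decay_def by (intro le_imp_inverse_le) auto
      also have "\<dots> = f k x" using k by (simp add: f_def power_divide)
      also have "\<dots> \<le> (\<Sum>k. f k x)"
        using sum_le_suminf[of "\<lambda>k. f k x" "{k}"] sum_f[of x] f_nonneg by simp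
      finally show ?thesis .
    qed
    then show "AE x in lborel. norm (decay x) \<le> norm (\<Sum>k. f k x)"
      by (intro AE_I2) (simp add: order_trans[OF _ abs_ge_self])
  qed simp
qed

lemma borel_measurable_cnj [measurable]:
  "f \<in> borel_measurable M \<Longrightarrow> (\<lambda>x. cnj (f x)) \<in> borel_measurable M"
  by (rule borel_measurable_continuous_on[OF continuous_on_cnj[OF continuous_on_id]])

lemma integrable_decay_affine:
  "c \<noteq> 0 \<Longrightarrow> integrable lborel (\<lambda>x. decay (t + c *\<^sub>R x :: real^'n::finite))"
  by (rule lborel_integrable_affine[OF _ integrable_decay])

lemma
  fixes f :: "real^'n::finite \<Rightarrow> complex"
  assumes [measurable]: "f \<in> borel_measurable borel" and b: "\<And>x. cmod (f x) \<le> C * decay x"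
  shows integrable_decay_bound: "integrable lborel f"
    and integral_decay_bound: "(\<integral>x. cmod (f x) \<partial>lborel) \<le> C * (\<integral>x. decay (x :: real^'n) \<partial>lborel)"
proof -
  have i: "integrable lborel (\<lambda>x::real^'n. C * decay x)" by (intro integrable_mult_right integrable_decay)
  have C: "0 \<le> C * decay x" for x :: "real^'n" using b[of x] norm_ge_zero order_trans by blast
  show f: "integrable lborel f"
    by (rule Bochner_Integration.integrable_bound[OF i]) (use b C in auto)
  have "(\<integral>x. cmod (f x) \<partial>lborel) \<le> (\<integral>x. C * decay (x :: real^'n) \<partial>lborel)"
    by (intro integral_mono integrable_norm f i b)
  then show "(\<integral>x. cmod (f x) \<partial>lborel) \<le> C * (\<integral>x. decay (x :: real^'n) \<partial>lborel)" by simp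
qed

lemma decay_le_shift:
  fixes x y :: "real^'n::finite"
  assumes "norm (x - y) \<le> 1"
  shows "decay x \<le> 2 ^ (CARD('n) + 1) * decay y"
proof -
  have "norm y \<le> norm x + norm (y - x)" by (rule norm_triangle_sub)
  then have "1 + norm y \<le> 2 * (1 + norm x)"
    using assms norm_minus_commute[of y x] norm_ge_zero[of x] by argo
  then have "(1 + norm y) ^ (CARD('n) + 1) \<le> (2 * (1 + norm x)) ^ (CARD('n) + 1)"
    by (intro power_mono) auto
  then have le: "(1 + norm y) ^ (CARD('n) + 1) \<le> 2 ^ (CARD('n) + 1) * (1 + norm x) ^ (CARD('n) + 1)"
    by (simp only: power_mult_distrib)
  have "0 < (1 + norm z) ^ (CARD('n) + 1)" for z :: "real^'n"
    by (intro zero_less_power add_pos_nonneg) auto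
  with le show ?thesis unfolding decay_def by (simp only: field_simps) (simp add: mult_ac)
qed

text \<open>An enumeration of the lattice turns sums over it into series, to which termwise
  differentiation and integration apply. Absolute convergence makes the choice of the order
  irrelevant.\<close>

definition lat :: "nat \<Rightarrow> int^'n::finite" where "lat = from_nat_into UNIV"

definition node :: "nat \<Rightarrow> real^'n::finite" where "node k = lattice_pt (lat k)"

lemma bij_lat: "bij (lat :: nat \<Rightarrow> int^'n::finite)"
proof -
  have "infinite (range (\<lambda>i::nat. \<chi> _::'n. int i))"
    by (rule range_inj_infinite) (auto simp: inj_on_def vec_eq_iff)
  then have "infinite (UNIV :: (int^'n) set)" by (rule contrapos_nn) (rule finite_subset[OF subset_UNIV])
  then show ?thesis unfolding lat_def by (intro bij_betw_from_nat_into) auto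
qed

lemma norm_node_diff: "j \<noteq> k \<Longrightarrow> 1 \<le> norm (node j - node k :: real^'n::finite)"
proof -
  assume "j \<noteq> k"
  then have "lat j \<noteq> (lat k :: int^'n)" using bij_lat by (auto simp: bij_def inj_def)
  then obtain i where i: "lat j $ i \<noteq> (lat k :: int^'n) $ i" by (auto simp: vec_eq_iff)
  have "1 \<le> \<bar>real_of_int (lat j $ i - (lat k :: int^'n) $ i)\<bar>" using i by linarith
  also have "\<dots> = \<bar>(node j - node k :: real^'n) $ i\<bar>" by (simp add: node_def lattice_pt_def)
  also have "\<dots> \<le> norm (node j - node k :: real^'n)" by (rule component_le_norm_cart)
  finally show ?thesis .
qed

text \<open>Comparison with the integral. The balls of radius \<open>1/2\<close> about the nodes are
  disjoint, and on each of them \<open>decay\<close> varies by at most the factor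
  \<open>2 ^ (CARD('n) + 1)\<close>. The bound is uniform in \<open>x\<close> because the integral
  is translation invariant.\<close>

lemma lattice_sum_bound:
  "\<exists>S>0. \<forall>x. summable (\<lambda>k. decay (x - node k)) \<and> (\<Sum>k. decay (x - node k :: real^'n::finite)) \<le> S"
proof -
  define c0 where "c0 = measure lborel (ball (0 :: real^'n) (1/2))"
  have ball_m: "measure lborel (ball t (1/2)) = c0" for t :: "real^'n"
    unfolding c0_def by (simp add: content_ball)
  have c0: "0 < c0" unfolding c0_def by (simp add: content_ball unit_ball_vol_pos)
  let ?I = "\<integral>x. decay (x :: real^'n) \<partial>lborel" and ?D = "2 ^ (CARD('n) + 1) :: real"
  have fin: "(\<Sum>k<m. decay (x - node k)) \<le> ?D * ?I / c0" for m and x :: "real^'n"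
  proof -
    have dJ: "integrable lborel (\<lambda>y. decay (x - y))" and eqI: "(\<integral>y. decay (x - y) \<partial>lborel) = ?I"
      using integrable_decay_affine[of "-1" x] lborel_integral_affine[OF _ integrable_decay, of "-1" x] by auto
    have disj: "disjoint_family_on (\<lambda>k. ball (node k :: real^'n) (1/2)) {..<m}"
      unfolding disjoint_family_on_def
    proof (intro ballI impI)
      fix i j :: nat assume "i \<noteq> j"
      show "ball (node i :: real^'n) (1/2) \<inter> ball (node j) (1/2) = {}"
        using norm_node_diff[OF \<open>i \<noteq> j\<close>, where 'n='n] by (intro disjoint_ballI) (simp add: dist_norm)
    qed
    have ind_int: "integrable lborel (\<lambda>y. indicator (ball (node k) (1/2)) y * (?D * decay (x - y)))" for k
      by (rule Bochner_Integration.integrable_bound[OF integrable_mult_right[OF dJ, of ?D]])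
        (auto simp: indicator_def decay_nonneg)
    have "c0 * decay (x - node k) \<le> (\<integral>y. indicator (ball (node k) (1/2)) y * (?D * decay (x - y)) \<partial>lborel)" for k
    proof -
      have "c0 * decay (x - node k) = (\<integral>y. indicator (ball (node k :: real^'n) (1/2)) y * decay (x - node k) \<partial>lborel)"
        by (simp add: ball_m)
      also have "\<dots> \<le> (\<integral>y. indicator (ball (node k) (1/2)) y * (?D * decay (x - y)) \<partial>lborel)"
      proof (rule integral_mono[OF _ ind_int])
        show "integrable lborel (\<lambda>y. indicator (ball (node k :: real^'n) (1/2)) y * decay (x - node k))"
          by (intro integrable_mult_left integrable_real_indicator) (auto simp: emeasure_ball)
        show "indicator (ball (node k) (1/2)) y * decay (x - node k) \<le> indicator (ball (node k) (1/2)) y * (?D * decay (x - y))" for y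
          using decay_le_shift[of "x - node k" "x - y"] by (auto simp: indicator_def dist_norm norm_minus_commute)
      qed
      finally show ?thesis .
    qed
    then have "c0 * (\<Sum>k<m. decay (x - node k)) \<le> (\<Sum>k<m. \<integral>y. indicator (ball (node k) (1/2)) y * (?D * decay (x - y)) \<partial>lborel)"
      unfolding sum_distrib_left by (intro sum_mono)
    also have "\<dots> = (\<integral>y. (\<Sum>k<m. indicator (ball (node k) (1/2)) y * (?D * decay (x - y))) \<partial>lborel)"
      by (rule Bochner_Integration.integral_sum[symmetric]) (rule ind_int)
    also have "\<dots> \<le> (\<integral>y. ?D * decay (x - y) \<partial>lborel)"
    proof (rule integral_mono)
      show "integrable lborel (\<lambda>y. \<Sum>k<m. indicator (ball (node k) (1/2)) y * (?D * decay (x - y)))"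
        by (intro Bochner_Integration.integrable_sum ind_int)
      show "integrable lborel (\<lambda>y. ?D * decay (x - y))" by (intro integrable_mult_right dJ)
      fix y
      have "(\<Sum>k<m. indicator (ball (node k) (1/2)) y * (?D * decay (x - y)))
        = indicator (\<Union>k<m. ball (node k) (1/2)) y * (?D * decay (x - y))"
        by (simp add: sum_distrib_right[symmetric] indicator_UN_disjoint[OF _ disj])
      also have "\<dots> \<le> ?D * decay (x - y)" by (auto simp: indicator_def decay_nonneg)
      finally show "(\<Sum>k<m. indicator (ball (node k) (1/2)) y * (?D * decay (x - y))) \<le> ?D * decay (x - y)" .
    qed
    also have "\<dots> = ?D * ?I" by (simp add: eqI)
    finally show ?thesis using c0 by (simp add: field_simps)
  qed
  have "0 \<le> ?I" by (intro integral_nonneg_AE) (simp add: decay_nonneg)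
  then have "0 < ?D * ?I / c0 + 1" using c0 by (simp add: add_nonneg_pos)
  moreover have "summable (\<lambda>k. decay (x - node k))" for x :: "real^'n"
    by (rule summableI_nonneg_bounded[OF decay_nonneg fin])
  moreover have "(\<Sum>k. decay (x - node k)) \<le> ?D * ?I / c0 + 1" for x :: "real^'n"
    using suminf_le_const[OF calculation(2) fin, of x] by simp
  ultimately show ?thesis by blast
qed

lemma summable_decay_node: "summable (\<lambda>k. decay (x - node k :: real^'n::finite))"
  using lattice_sum_bound by blast

context weight_family begin

text \<open>The weight divided by \<open>decay\<close>. A bound by \<open>1 / W l\<close> therefore
  still leaves an integrable and summable factor after the weight \<open>w l\<close> has been
  spent.\<close>

definition W :: "nat \<Rightarrow> real^'n \<Rightarrow> real" where
  "W l x = w l x * (1 + norm x) ^ (CARD('n) + 1)"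

lemma W_eq: "W l x = w l x / decay x"
  by (simp add: W_def decay_def field_simps)

lemma W_pos: "0 < W l x" unfolding W_eq by (rule divide_pos_pos[OF w_pos decay_pos])

lemma W_nonneg [simp]: "0 \<le> W l x" using W_pos[of l x] by simp

lemma inverse_W_le: "1 / W l x \<le> decay x"
  unfolding W_eq using w_ge1[of l x] decay_pos[of x] by (simp add: field_simps)

lemma W_minus [simp]: "W l (- x) = W l x"
  unfolding W_def using w_norm_eq[of "- x" x] by simp

lemma W_submult: "W l (x + y) \<le> W (2 * l) x * W (2 * l) y"
proof -
  have "(1 + norm (x + y)) \<le> (1 + norm x) * (1 + norm y)"
  proof -
    have "(1 + norm x) * (1 + norm y) = 1 + norm x + norm y + norm x * norm y" by (simp add: algebra_simps)
    moreover have "0 \<le> norm x * norm y" by simp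
    ultimately show ?thesis using norm_triangle_ineq[of x y] by linarith
  qed
  then have "(1 + norm (x + y)) ^ (CARD('n) + 1) \<le> ((1 + norm x) * (1 + norm y)) ^ (CARD('n) + 1)"
    by (intro power_mono) auto
  then have "W l (x + y) \<le> (w (2*l) x * w (2*l) y) * ((1 + norm x) * (1 + norm y)) ^ (CARD('n) + 1)"
    unfolding W_def by (intro mult_mono w_submult) (auto simp: w_nonneg)
  then show ?thesis unfolding W_def power_mult_distrib by (simp only: ac_simps)
qed

lemma W_diff: "W l (x - y) \<le> W (2 * l) x * W (2 * l) y"
  using W_submult[of l x "- y"] by simp

lemma W_scale: "\<exists>l' C. 0 < C \<and> (\<forall>x. W l (b *\<^sub>R x) \<le> C * W l' x)"
proof -
  obtain l' C where C: "0 < C" "\<And>x. w l (b *\<^sub>R x) \<le> C * w l' x" using w_scale by blast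
  have "W l (b *\<^sub>R x) \<le> (C * (1 + \<bar>b\<bar>) ^ (CARD('n) + 1)) * W l' x" for x
  proof -
    have "1 + norm (b *\<^sub>R x) \<le> (1 + \<bar>b\<bar>) * (1 + norm x)" by (simp add: algebra_simps)
    then have "(1 + norm (b *\<^sub>R x)) ^ (CARD('n) + 1) \<le> ((1 + \<bar>b\<bar>) * (1 + norm x)) ^ (CARD('n) + 1)"
      by (intro power_mono) auto
    then have "W l (b *\<^sub>R x) \<le> (C * w l' x) * ((1 + \<bar>b\<bar>) * (1 + norm x)) ^ (CARD('n) + 1)"
      unfolding W_def using C by (intro mult_mono) (auto simp: w_nonneg)
    then show ?thesis unfolding W_def power_mult_distrib by (simp only: ac_simps)
  qed
  moreover have "0 < C * (1 + \<bar>b\<bar>) ^ (CARD('n) + 1)" using C(1) by (simp add: add_pos_nonneg)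
  ultimately show ?thesis by blast
qed

lemma test_decay_W:
  assumes "f \<in> test_space w r"
  shows "\<exists>C>0. \<forall>ks x. length ks \<le> r \<longrightarrow> cmod (pd ks f x) \<le> C * decay x / W l x"
proof -
  \<comment> \<open>The power is doubled: one copy is part of \<open>W\<close>, the other remains as
    the factor \<open>decay x\<close>.\<close>
  obtain C where C: "0 < C" "\<And>ks x. length ks \<le> r \<Longrightarrow>
      w l x * (1 + norm x) ^ ((CARD('n) + 1) + (CARD('n) + 1)) * cmod (pd ks f x) \<le> C"
    using test_decay[OF assms, of l "(CARD('n) + 1) + (CARD('n) + 1)"] by blast
  have "cmod (pd ks f x) \<le> C * decay x / W l x" if "length ks \<le> r" for ks x
  proof -
    have "W l x / decay x * cmod (pd ks f x) \<le> C"
      using C(2)[OF that, of x] unfolding power_add W_def decay_def by (simp add: divide_inverse mult.assoc)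
    then show ?thesis using W_pos[of l x] decay_pos[of x] by (simp add: field_simps)
  qed
  with C(1) show ?thesis by blast
qed

lemma test_decay_W':
  assumes "f \<in> test_space w r"
  shows "\<exists>C>0. \<forall>ks x. length ks \<le> r \<longrightarrow> cmod (pd ks f x) \<le> C / W l x"
proof -
  obtain C where C: "0 < C" "\<And>ks x. length ks \<le> r \<Longrightarrow> cmod (pd ks f x) \<le> C * decay x / W l x"
    using test_decay_W[OF assms] by blast
  moreover have "C * decay x / W l x \<le> C / W l x" for x
    using C(1) W_pos[of l x] decay_le1[of x] by (intro divide_right_mono) auto
  ultimately show ?thesis by (meson order_trans)
qed

lemma test_measurable [measurable]:
  assumes "f \<in> test_space w r" "length ks \<le> r"
  shows "pd ks f \<in> borel_measurable borel"
  using test_space_continuous[OF assms] by (rule borel_measurable_continuous_onI)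

lemma test_bounded_decay:
  assumes "f \<in> test_space w r"
  shows "\<exists>C>0. \<forall>ks x. length ks \<le> r \<longrightarrow> cmod (pd ks f x) \<le> C * decay x"
proof -
  obtain C where C: "0 < C" "\<And>ks x. length ks \<le> r \<Longrightarrow> cmod (pd ks f x) \<le> C / W 0 x"
    using test_decay_W'[OF assms] by blast
  moreover have "C / W 0 x \<le> C * decay x" for x
    using mult_left_mono[OF inverse_W_le[of 0 x], of C] C(1) by simp
  ultimately show ?thesis by (meson order_trans)
qed

end

section \<open>The reproducing kernel and its rescalings\<close>

text \<open>The word \<open>ks\<close> differentiates in the first variable only. For
  \<open>\<psi>\<close> the conjugate of \<open>\<phi>\<close>, the undifferentiated kernel at
  \<open>u\<close> and \<open>v\<close> is \<open>q0 \<phi> v u\<close>: conjugation swaps the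
  arguments, as transposition under the bilinear pairing demands.\<close>

definition kern :: "(real^'n::finite \<Rightarrow> complex) \<Rightarrow> 'n list \<Rightarrow> real^'n \<Rightarrow> real^'n \<Rightarrow> complex" where
  "kern \<psi> ks u v = (\<Sum>k. pd ks \<psi> (u - node k) * cnj (\<psi> (v - node k)))"

definition coeff :: "(real^'n::finite \<Rightarrow> complex) \<Rightarrow> real \<Rightarrow> real^'n \<Rightarrow> (real^'n \<Rightarrow> complex) \<Rightarrow> nat \<Rightarrow> complex" where
  "coeff \<psi> N a \<theta> k = N ^ CARD('n) *\<^sub>R (\<integral>x. \<theta> x * cnj (\<psi> (a + N *\<^sub>R x - node k)) \<partial>lborel)"

text \<open>For \<open>\<psi> = cnj \<circ> \<phi>\<close> this is the operator with kernel \<open>N\<^sup>n q\<^sub>0(a + N x, a + N z)\<close>. Neither \<open>N\<close>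
  nor \<open>a\<close> is related to the dyadic structure: zooming by \<open>\<epsilon>\<close> at \<open>x\<^sub>0\<close> turns \<open>q\<^sub>1\<^sub>/\<^sub>\<epsilon>\<close> into the case
  \<open>N = \<epsilon> 2\<^sup>1\<^sup>/\<^sup>\<epsilon>\<close>, \<open>a = 2\<^sup>1\<^sup>/\<^sup>\<epsilon> x\<^sub>0\<close>.\<close>

definition approx :: "(real^'n::finite \<Rightarrow> complex) \<Rightarrow> real \<Rightarrow> real^'n \<Rightarrow> (real^'n \<Rightarrow> complex) \<Rightarrow> real^'n \<Rightarrow> complex" where
  "approx \<psi> N a \<theta> z = (\<Sum>k. coeff \<psi> N a \<theta> k * \<psi> (a + N *\<^sub>R z - node k))"

context weight_family begin

text \<open>Off-diagonal decay: \<open>v - u\<close> is the difference of \<open>v - node k\<close>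
  and \<open>u - node k\<close>, so \<open>W_submult\<close> lets the decay of the two factors pay
  for \<open>W l (v - u)\<close>. The surplus \<open>decay (u - node k)\<close> is kept for the sum
  over \<open>k\<close>.\<close>

lemma kern_term_bound:
  assumes \<psi>: "\<psi> \<in> test_space w r"
  shows "\<exists>C>0. \<forall>ks u v k. length ks \<le> r \<longrightarrow>
    cmod (pd ks \<psi> (u - node k) * cnj (\<psi> (v - node k))) \<le> C / W l (v - u) * decay (u - node k)"
proof -
  obtain C where C: "0 < C" "\<And>ks x. length ks \<le> r \<Longrightarrow> cmod (pd ks \<psi> x) \<le> C * decay x / W (2*l) x"
    using test_decay_W[OF \<psi>] by blast
  obtain D where D: "0 < D" "\<And>ks x. length ks \<le> r \<Longrightarrow> cmod (pd ks \<psi> x) \<le> D / W (2*l) x"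
    using test_decay_W'[OF \<psi>] by blast
  have "cmod (pd ks \<psi> (u - t) * cnj (\<psi> (v - t))) \<le> C * D / W l (v - u) * decay (u - t)"
    if "length ks \<le> r" for ks u v t
  proof -
    have "W l ((v - t) - (u - t)) \<le> W (2*l) (v - t) * W (2*l) (u - t)" by (rule W_diff)
    then have le: "W l (v - u) \<le> W (2*l) (v - t) * W (2*l) (u - t)" by simp
    have "cmod (pd ks \<psi> (u - t) * cnj (\<psi> (v - t))) \<le> (C * decay (u - t) / W (2*l) (u - t)) * (D / W (2*l) (v - t))"
      unfolding norm_mult using C(1) D(2)[of "[]" "v - t"] C(2)[OF that] W_pos decay_nonneg
      by (intro mult_mono) (auto intro: less_imp_le)
    also have "\<dots> = C * D * decay (u - t) / (W (2*l) (v - t) * W (2*l) (u - t))" by (simp add: mult_ac)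
    also have "\<dots> \<le> C * D * decay (u - t) / W l (v - u)"
      using C(1) D(1) le W_pos decay_nonneg by (intro divide_left_mono mult_nonneg_nonneg mult_pos_pos) (auto intro: less_imp_le)
    finally show ?thesis by simp
  qed
  moreover have "0 < C * D" using C D by simp
  ultimately show ?thesis by blast
qed

lemma kern_summable:
  assumes "\<psi> \<in> test_space w r" "length ks \<le> r"
  shows "summable (\<lambda>k. cmod (pd ks \<psi> (u - node k) * cnj (\<psi> (v - node k))))"
proof -
  obtain C where "\<And>k. cmod (pd ks \<psi> (u - node k) * cnj (\<psi> (v - node k))) \<le> C / W 0 (v - u) * decay (u - node k)"
    using kern_term_bound[OF assms(1)] assms(2) by meson
  then show ?thesis
    by (intro summable_comparison_test'[OF summable_mult[OF summable_decay_node[of u], of "C / W 0 (v - u)"], of 0]) simp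
qed

lemma kern_bound:
  assumes \<psi>: "\<psi> \<in> test_space w r"
  shows "\<exists>C>0. \<forall>ks u v. length ks \<le> r \<longrightarrow> cmod (kern \<psi> ks u v) \<le> C / W l (v - u)"
proof -
  obtain C where C: "0 < C" "\<And>ks u v k. length ks \<le> r \<Longrightarrow>
    cmod (pd ks \<psi> (u - node k) * cnj (\<psi> (v - node k))) \<le> C / W l (v - u) * decay (u - node k)"
    using kern_term_bound[OF \<psi>] by blast
  obtain S where S: "0 < S" "\<And>x::real^'n. (\<Sum>k. decay (x - node k)) \<le> S" using lattice_sum_bound by blast
  have "cmod (kern \<psi> ks u v) \<le> C * S / W l (v - u)" if ks: "length ks \<le> r" for ks u v
  proof -
    have "cmod (kern \<psi> ks u v) \<le> (\<Sum>k. cmod (pd ks \<psi> (u - node k) * cnj (\<psi> (v - node k))))"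
      unfolding kern_def by (rule summable_norm[OF kern_summable[OF \<psi> ks]])
    also have "\<dots> \<le> (\<Sum>k. C / W l (v - u) * decay (u - node k))"
      by (intro suminf_le C ks kern_summable[OF \<psi>] summable_mult summable_decay_node)
    also have "\<dots> = C / W l (v - u) * (\<Sum>k. decay (u - node k))"
      by (rule suminf_mult[OF summable_decay_node])
    also have "\<dots> \<le> C / W l (v - u) * S"
      using C(1) W_pos[of l "v - u"] S by (intro mult_left_mono) auto
    finally show ?thesis by simp
  qed
  moreover have "0 < C * S" using C S by simp
  ultimately show ?thesis by blast
qed

lemma test_measurable': "\<psi> \<in> test_space w r \<Longrightarrow> \<psi> \<in> borel_measurable borel"
  using test_measurable[of \<psi> r "[]"] by simp

lemma kern_measurable:
  assumes "\<psi> \<in> test_space w r"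
  shows "(\<lambda>v. kern \<psi> ks u v) \<in> borel_measurable borel"
proof -
  note [measurable] = test_measurable'[OF assms]
  show ?thesis unfolding kern_def by measurable
qed

text \<open>Here \<open>node k\<close> is the difference of \<open>a + N *\<^sub>R x\<close> and the
  argument of \<open>\<psi>\<close>: the decay of \<open>\<theta>\<close> pays for the first, that
  of \<open>\<psi>\<close> for the second. The constant depends on \<open>a\<close> and
  \<open>N\<close>, which is enough for the convergence of the series; uniform estimates come from
  the kernel instead.\<close>

lemma coeff_integrand_bound:
  assumes \<theta>: "\<theta> \<in> test_space w r" and \<psi>: "\<psi> \<in> test_space w r"
  shows "\<exists>C>0. \<forall>k x. cmod (\<theta> x * cnj (\<psi> (a + N *\<^sub>R x - node k))) \<le> C / W l (node k) * decay x"
proof -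
  obtain l' B where B: "0 < B" "\<And>x. W (2*(2*l)) (N *\<^sub>R x) \<le> B * W l' x" using W_scale by blast
  obtain C where C: "0 < C" "\<And>ks x. length ks \<le> r \<Longrightarrow> cmod (pd ks \<theta> x) \<le> C * decay x / W l' x"
    using test_decay_W[OF \<theta>] by blast
  obtain D where D: "0 < D" "\<And>ks x. length ks \<le> r \<Longrightarrow> cmod (pd ks \<psi> x) \<le> D / W (2*l) x"
    using test_decay_W'[OF \<psi>] by blast
  let ?A = "W (2*(2*l)) a * B"
  have "cmod (\<theta> x * cnj (\<psi> (a + N *\<^sub>R x - t))) \<le> C * D * ?A / W l t * decay x" for x t
  proof -
    have "W l ((a + N *\<^sub>R x) - (a + N *\<^sub>R x - t)) \<le> W (2*l) (a + N *\<^sub>R x) * W (2*l) (a + N *\<^sub>R x - t)"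
      by (rule W_diff)
    also have "\<dots> \<le> (W (2*(2*l)) a * (B * W l' x)) * W (2*l) (a + N *\<^sub>R x - t)"
      by (intro mult_right_mono order_trans[OF W_submult] mult_left_mono B) (auto intro: less_imp_le[OF W_pos])
    finally have "W l t \<le> ?A * (W l' x * W (2*l) (a + N *\<^sub>R x - t))" by (simp add: mult_ac)
    then have le: "1 / (W l' x * W (2*l) (a + N *\<^sub>R x - t)) \<le> ?A / W l t"
      using W_pos[of l t] W_pos[of l' x] W_pos[of "2*l" "a + N *\<^sub>R x - t"] by (simp add: divide_simps mult_ac)
    have "cmod (\<theta> x * cnj (\<psi> (a + N *\<^sub>R x - t))) \<le> (C * decay x / W l' x) * (D / W (2*l) (a + N *\<^sub>R x - t))"
      unfolding norm_mult using C(1) D(2)[of "[]" "a + N *\<^sub>R x - t"] C(2)[of "[]" x] W_pos decay_nonneg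
      by (intro mult_mono) (auto intro: less_imp_le)
    also have "\<dots> = C * D * decay x * (1 / (W l' x * W (2*l) (a + N *\<^sub>R x - t)))" by simp
    also have "\<dots> \<le> C * D * decay x * (?A / W l t)"
      using C(1) D(1) decay_nonneg by (intro mult_left_mono[OF le]) auto
    finally show ?thesis by (simp add: mult_ac)
  qed
  moreover have "0 < C * D * ?A" using C D B W_pos by simp
  ultimately show ?thesis by blast
qed

lemma coeff_integrable:
  assumes \<theta>: "\<theta> \<in> test_space w r" and \<psi>: "\<psi> \<in> test_space w r"
  shows "integrable lborel (\<lambda>x. \<theta> x * cnj (\<psi> (a + N *\<^sub>R x - node k)))"
proof -
  note [measurable] = test_measurable'[OF \<theta>] test_measurable'[OF \<psi>]
  obtain C where "\<And>x. cmod (\<theta> x * cnj (\<psi> (a + N *\<^sub>R x - node k))) \<le> C / W 0 (node k) * decay x"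
    using coeff_integrand_bound[OF assms] by meson
  then show ?thesis by (intro integrable_decay_bound[where C="C / W 0 (node k)"]) auto
qed

lemma coeff_integral_bound:
  assumes \<theta>: "\<theta> \<in> test_space w r" and \<psi>: "\<psi> \<in> test_space w r"
  shows "\<exists>C>0. \<forall>k. (\<integral>x. cmod (\<theta> x * cnj (\<psi> (a + N *\<^sub>R x - node k))) \<partial>lborel) \<le> C / W l (node k)"
proof -
  note [measurable] = test_measurable'[OF \<theta>] test_measurable'[OF \<psi>]
  obtain C where C: "0 < C" "\<And>k x. cmod (\<theta> x * cnj (\<psi> (a + N *\<^sub>R x - node k))) \<le> C / W l (node k) * decay x"
    using coeff_integrand_bound[OF assms] by meson
  let ?I = "\<integral>x. decay (x :: real^'n) \<partial>lborel"
  have "(\<integral>x. cmod (\<theta> x * cnj (\<psi> (a + N *\<^sub>R x - node k))) \<partial>lborel) \<le> (C * (?I + 1)) / W l (node k)" for k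
  proof -
    have "(\<integral>x. cmod (\<theta> x * cnj (\<psi> (a + N *\<^sub>R x - node k))) \<partial>lborel) \<le> C / W l (node k) * ?I"
      using C(2) by (intro integral_decay_bound) auto
    also have "\<dots> \<le> C / W l (node k) * (?I + 1)" using C(1) W_pos[of l "node k"] by (intro mult_left_mono) auto
    finally show ?thesis by simp
  qed
  moreover have "0 \<le> ?I" by (intro integral_nonneg_AE) (simp add: decay_nonneg)
  ultimately show ?thesis using C(1) by (intro exI[of _ "C * (?I + 1)"] conjI allI mult_pos_pos add_nonneg_pos) auto
qed

lemma coeff_bound:
  assumes \<theta>: "\<theta> \<in> test_space w r" and \<psi>: "\<psi> \<in> test_space w r"
  shows "\<exists>C>0. \<forall>k. cmod (coeff \<psi> N a \<theta> k) \<le> C / W l (node k)"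
proof -
  obtain C where C: "0 < C" "\<And>k. (\<integral>x. cmod (\<theta> x * cnj (\<psi> (a + N *\<^sub>R x - node k))) \<partial>lborel) \<le> C / W l (node k)"
    using coeff_integral_bound[OF assms] by blast
  let ?M = "\<bar>N\<bar> ^ CARD('n)"
  have "cmod (coeff \<psi> N a \<theta> k) \<le> (?M * C + 1) / W l (node k)" for k
  proof -
    have "cmod (coeff \<psi> N a \<theta> k) \<le> ?M * (C / W l (node k))"
      unfolding coeff_def norm_scaleR power_abs
      by (intro mult_left_mono order_trans[OF integral_norm_bound C(2)]) auto
    also have "\<dots> \<le> (?M * C + 1) / W l (node k)" using W_pos[of l "node k"] by (simp add: divide_simps)
    finally show ?thesis .
  qed
  moreover have "0 < ?M * C + 1" using C by (simp add: add_nonneg_pos)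
  ultimately show ?thesis by blast
qed

lemma translate_bound:
  assumes \<psi>: "\<psi> \<in> test_space w r" and N: "N \<noteq> 0"
  shows "(\<lambda>z. \<psi> (a + N *\<^sub>R z - node k)) \<in> test_space w r"
    and "\<exists>l' C. 0 < C \<and> (\<forall>k. wnorm w r l (\<lambda>z. \<psi> (a + N *\<^sub>R z - node k)) \<le> C * w l' (node k))"
proof -
  have *: "(\<lambda>z. \<psi> (a + N *\<^sub>R z - t)) = (\<lambda>z. \<psi> ((a - t) + N *\<^sub>R z))" for t by (simp add: algebra_simps)
  show "(\<lambda>z. \<psi> (a + N *\<^sub>R z - node k)) \<in> test_space w r"
    unfolding * using test_affine[OF N] \<psi> by blast
  obtain l' C where C: "0 < C" "\<And>c. wnorm w r l (\<lambda>x. \<psi> (c + N *\<^sub>R x)) \<le> C * w l' c * wnorm w r l' \<psi>"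
    using test_affine[OF N, of r l] \<psi> by blast
  let ?B = "C * w (2*l') a * (wnorm w r l' \<psi> + 1)"
  have "wnorm w r l (\<lambda>z. \<psi> (a + N *\<^sub>R z - t)) \<le> ?B * w (2*l') t" for t
  proof -
    have "w l' (a + - t) \<le> w (2*l') a * w (2*l') (- t)" by (rule w_submult)
    also have "w (2*l') (- t) = w (2*l') t" by (rule w_norm_eq) simp
    finally have "C * w l' (a - t) * wnorm w r l' \<psi> \<le> C * (w (2*l') a * w (2*l') t) * (wnorm w r l' \<psi> + 1)"
      using C(1) wnorm_nonneg[OF \<psi>, of l'] w_nonneg by (intro mult_mono) auto
    then show ?thesis unfolding * using C(2)[of "a - t"] by (simp add: mult_ac)
  qed
  moreover have "0 < ?B" using C(1) w_pos wnorm_nonneg[OF \<psi>, of l'] by (intro mult_pos_pos) auto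
  ultimately show "\<exists>l' C. 0 < C \<and> (\<forall>k. wnorm w r l (\<lambda>z. \<psi> (a + N *\<^sub>R z - node k)) \<le> C * w l' (node k))"
    by blast
qed

text \<open>The norms of translates grow at most like a weight at the node, while the coefficients
  lie below the reciprocal of every \<open>W l\<close>. The product is bounded by a multiple of
  \<open>decay\<close> at the node.\<close>

lemma weighted_series:
  assumes h: "\<And>k. h k \<in> test_space w r" and h_bd: "\<And>l. \<exists>l' C. \<forall>k. wnorm w r l (h k) \<le> C * w l' (node k)"
    and c: "\<And>l. \<exists>C. \<forall>k. cmod (c k) \<le> C / W l (node k)"
  shows "(\<lambda>x. c k * h k x) \<in> test_space w r" and "summable (\<lambda>k. wnorm w r l (\<lambda>x. c k * h k x))"
proof -
  show mem: "(\<lambda>x. c k * h k x) \<in> test_space w r" for k using test_lincomb(1)[OF h h, of "c k" k 0 k] by simp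
  obtain l' C where C: "\<And>k. wnorm w r l (h k) \<le> C * w l' (node k)" using h_bd by blast
  obtain D where D: "\<And>k. cmod (c k) \<le> D / W l' (node k)" using c by blast
  have "norm (wnorm w r l (\<lambda>x. c k * h k x)) \<le> D * C * decay (0 - node k :: real^'n)" for k
  proof -
    have "norm (wnorm w r l (\<lambda>x. c k * h k x)) = wnorm w r l (\<lambda>x. c k * h k x)" using wnorm_nonneg[OF mem] by simp
    also have "\<dots> \<le> cmod (c k) * wnorm w r l (h k)" using test_lincomb(2)[OF h h, of l "c k" k 0 k] by simp
    also have "\<dots> \<le> (D / W l' (node k)) * (C * w l' (node k))"
      using order_trans[OF norm_ge_zero D] by (intro mult_mono C D wnorm_nonneg h) auto
    also have "\<dots> = D * C * decay (0 - node k :: real^'n)"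
      unfolding W_eq using w_pos[of l' "node k"] by simp
    finally show ?thesis .
  qed
  then show "summable (\<lambda>k. wnorm w r l (\<lambda>x. c k * h k x))"
    by (intro summable_comparison_test'[OF summable_mult[OF summable_decay_node[of 0], of "D * C"], of 0])
qed

lemma approx_series:
  assumes \<theta>: "\<theta> \<in> test_space w r" and \<psi>: "\<psi> \<in> test_space w r" and N: "N \<noteq> 0"
  shows "(\<lambda>z. coeff \<psi> N a \<theta> k * \<psi> (a + N *\<^sub>R z - node k)) \<in> test_space w r"
    and "summable (\<lambda>k. wnorm w r l (\<lambda>z. coeff \<psi> N a \<theta> k * \<psi> (a + N *\<^sub>R z - node k)))"
  using weighted_series[of "\<lambda>k z. \<psi> (a + N *\<^sub>R z - node k)" r "coeff \<psi> N a \<theta>", OF translate_bound(1)[OF \<psi> N]]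
    translate_bound(2)[OF \<psi> N] coeff_bound[OF \<theta> \<psi>] by (meson less_imp_le)+

lemma approx_in_test:
  assumes "\<theta> \<in> test_space w r" "\<psi> \<in> test_space w r" "N \<noteq> 0"
  shows "approx \<psi> N a \<theta> \<in> test_space w r"
  using test_suminf[OF approx_series[OF assms]] by (simp add: approx_def[abs_def])

text \<open>After the substitution \<open>x = z + (1 / N) *\<^sub>R v\<close> the parameter
  \<open>a\<close> survives only in the base point of the kernel, where all estimates are uniform.
  Each derivative falls on \<open>\<psi>\<close> and produces a factor \<open>N\<close>; absolute
  convergence justifies exchanging sum and integral.\<close>

lemma pd_approx:
  assumes \<theta>: "\<theta> \<in> test_space w r" and \<psi>: "\<psi> \<in> test_space w r" and N: "0 < N" and ks: "length ks \<le> r"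
  shows "pd ks (approx \<psi> N a \<theta>) z = N ^ length ks *\<^sub>R
    (\<integral>v. \<theta> (z + (1 / N) *\<^sub>R v) * kern \<psi> ks (a + N *\<^sub>R z) (a + N *\<^sub>R z + v) \<partial>lborel)"
    and "integrable lborel (\<lambda>v. \<theta> (z + (1 / N) *\<^sub>R v) * kern \<psi> ks (a + N *\<^sub>R z) (a + N *\<^sub>R z + v))"
proof -
  let ?u = "a + N *\<^sub>R z"
  let ?p = "\<lambda>k. pd ks \<psi> (?u - node k)"
  let ?f = "\<lambda>k x. ?p k * (\<theta> x * cnj (\<psi> (a + N *\<^sub>R x - node k)))"
  have N0: "N \<noteq> 0" using N by simp
  have int_f: "integrable lborel (?f k)" for k by (intro integrable_mult_right coeff_integrable[OF \<theta> \<psi>])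
  have eq: "(\<Sum>k. ?f k x) = \<theta> x * kern \<psi> ks ?u (a + N *\<^sub>R x)" and sm: "summable (\<lambda>k. norm (?f k x))" for x
  proof -
    have s: "summable (\<lambda>k. cmod (?p k * cnj (\<psi> (a + N *\<^sub>R x - node k))))"
      by (rule kern_summable[OF \<psi> ks])
    show "summable (\<lambda>k. norm (?f k x))"
      using summable_mult[OF s, of "cmod (\<theta> x)"] by (simp add: norm_mult mult_ac)
    show "(\<Sum>k. ?f k x) = \<theta> x * kern \<psi> ks ?u (a + N *\<^sub>R x)"
      unfolding kern_def suminf_mult[OF summable_norm_cancel[OF s], symmetric] by (simp add: mult_ac)
  qed
  obtain B where "0 < B" "\<And>x. cmod (pd ks \<psi> x) \<le> B * decay x"
    using test_bounded_decay[OF \<psi>] ks by blast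
  then have B: "cmod (pd ks \<psi> x) \<le> B" for x
    using mult_left_mono[OF decay_le1[of x], of B] by (fastforce intro: order_trans)
  obtain C where C: "0 < C" "\<And>k. (\<integral>x. cmod (\<theta> x * cnj (\<psi> (a + N *\<^sub>R x - node k))) \<partial>lborel) \<le> C / W 0 (node k)"
    using coeff_integral_bound[OF \<theta> \<psi>] by blast
  have si: "summable (\<lambda>k. \<integral>x. norm (?f k x) \<partial>lborel)"
  proof (rule summable_comparison_test'[OF summable_mult[OF summable_decay_node[of 0], of "B * C"], of 0])
    fix k
    have "norm (\<integral>x. norm (?f k x) \<partial>lborel) = cmod (?p k) * (\<integral>x. cmod (\<theta> x * cnj (\<psi> (a + N *\<^sub>R x - node k))) \<partial>lborel)"
      unfolding norm_mult[of "?p k"] by (simp add: integral_nonneg_AE abs_mult)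
    also have "\<dots> \<le> B * (C / W 0 (node k))"
      using order_trans[OF norm_ge_zero B] by (intro mult_mono B C integral_nonneg_AE) auto
    also have "\<dots> \<le> B * (C * decay (0 - node k :: real^'n))"
      using order_trans[OF norm_ge_zero B] mult_left_mono[OF inverse_W_le[of 0 "node k"], of C] C(1)
      by (intro mult_left_mono) auto
    finally show "norm (\<integral>x. norm (?f k x) \<partial>lborel) \<le> B * C * decay (0 - node k :: real^'n)" by simp
  qed
  have int1: "integrable lborel (\<lambda>x. \<theta> x * kern \<psi> ks ?u (a + N *\<^sub>R x))"
    using integrable_suminf[OF int_f _ si] sm unfolding eq by simp
  have int2: "(\<lambda>k. \<integral>x. ?f k x \<partial>lborel) sums (\<integral>x. \<theta> x * kern \<psi> ks ?u (a + N *\<^sub>R x) \<partial>lborel)"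
    using sums_integral[OF int_f _ si] sm unfolding eq by simp
  have shift: "a + N *\<^sub>R (z + (1 / N) *\<^sub>R v) = ?u + v" for v using N by (simp add: algebra_simps)
  show "integrable lborel (\<lambda>v. \<theta> (z + (1 / N) *\<^sub>R v) * kern \<psi> ks ?u (?u + v))"
    using lborel_integrable_affine[OF _ int1, of "1 / N" z] N0 by (simp add: shift)
  have sub: "N ^ CARD('n) *\<^sub>R (\<integral>x. \<theta> x * kern \<psi> ks ?u (a + N *\<^sub>R x) \<partial>lborel)
     = (\<integral>v. \<theta> (z + (1 / N) *\<^sub>R v) * kern \<psi> ks ?u (?u + v) \<partial>lborel)"
    using lborel_integral_affine[OF _ int1, of "1 / N" z] N unfolding shift by (simp add: power_divide)
  have "pd ks (approx \<psi> N a \<theta>) z = (\<Sum>k. pd ks (\<lambda>z. coeff \<psi> N a \<theta> k * \<psi> (a + N *\<^sub>R z - node k)) z)"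
    using pd_suminf[OF approx_series[OF \<theta> \<psi> N0, where a=a] ks] by (simp add: approx_def[abs_def])
  also have "\<dots> = (\<Sum>k. N ^ length ks *\<^sub>R N ^ CARD('n) *\<^sub>R (\<integral>x. ?f k x \<partial>lborel))"
  proof (rule suminf_cong)
    fix k
    have C\<psi>: "C_class r (\<lambda>z. \<psi> ((a - node k) + N *\<^sub>R z))" and
      pd: "pd ks (\<lambda>z. \<psi> ((a - node k) + N *\<^sub>R z)) = (\<lambda>z. N ^ length ks *\<^sub>R pd ks \<psi> ((a - node k) + N *\<^sub>R z))"
      using C_class_affine[OF test_space_C_class[OF \<psi>]] ks by auto
    have re: "(\<lambda>z. \<psi> (a + N *\<^sub>R z - node k)) = (\<lambda>z. \<psi> ((a - node k) + N *\<^sub>R z))" by (simp add: algebra_simps)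
    have "pd ks (\<lambda>z. coeff \<psi> N a \<theta> k * \<psi> (a + N *\<^sub>R z - node k)) z
       = coeff \<psi> N a \<theta> k * (N ^ length ks *\<^sub>R pd ks \<psi> ((a - node k) + N *\<^sub>R z))"
      using C_class_lincomb(2)[OF C\<psi> C\<psi> ks, of "coeff \<psi> N a \<theta> k" 0] fun_cong[OF pd, of z] by (simp add: algebra_simps)
    also have "\<dots> = N ^ length ks *\<^sub>R N ^ CARD('n) *\<^sub>R (\<integral>x. ?f k x \<partial>lborel)"
    proof -
      have "(a - node k) + N *\<^sub>R z = a + N *\<^sub>R z - node k" by simp
      then show ?thesis unfolding coeff_def integral_mult_right_zero by (simp only:) (simp add: mult.commute)
    qed
    finally show "pd ks (\<lambda>z. coeff \<psi> N a \<theta> k * \<psi> (a + N *\<^sub>R z - node k)) z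
      = N ^ length ks *\<^sub>R N ^ CARD('n) *\<^sub>R (\<integral>x. ?f k x \<partial>lborel)" .
  qed
  also have "\<dots> = N ^ length ks *\<^sub>R N ^ CARD('n) *\<^sub>R (\<integral>x. \<theta> x * kern \<psi> ks ?u (a + N *\<^sub>R x) \<partial>lborel)"
    by (intro sums_unique[symmetric] sums_scaleR_right int2)
  finally show "pd ks (approx \<psi> N a \<theta>) z = N ^ length ks *\<^sub>R
    (\<integral>v. \<theta> (z + (1 / N) *\<^sub>R v) * kern \<psi> ks ?u (?u + v) \<partial>lborel)"
    unfolding sub .
qed

end

section \<open>Moments of the kernel\<close>

lemma eventually_finite_threshold:
  fixes P :: "'a \<Rightarrow> real \<Rightarrow> bool"
  assumes "finite A" "\<And>a. a \<in> A \<Longrightarrow> \<exists>N0. \<forall>N\<ge>N0. P a N"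
  shows "\<exists>N0\<ge>1. \<forall>a\<in>A. \<forall>N\<ge>N0. P a N"
proof -
  have "eventually (\<lambda>N. \<forall>a\<in>A. P a N) at_top"
    using assms by (intro eventually_ball_finite) (auto simp: eventually_at_top_linorder)
  then obtain N0 where "\<And>N. N \<ge> N0 \<Longrightarrow> \<forall>a\<in>A. P a N" by (auto simp: eventually_at_top_linorder)
  then show ?thesis by (intro exI[of _ "max 1 N0"]) auto
qed

context weight_family begin

section \<open>Weighted moduli of continuity of test functions\<close>

lemma test_difference_bound:
  assumes \<theta>: "\<theta> \<in> test_space w r"
  shows "\<exists>C>0. \<forall>ks z h. length ks \<le> r \<longrightarrow> w l z * cmod (pd ks \<theta> (z + h) - pd ks \<theta> z) \<le> C * w (2 * l) h"
proof -
  let ?A = "wnorm w r (2 * l) \<theta>" and ?B = "wnorm w r l \<theta>"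
  have nn: "0 \<le> ?A" "0 \<le> ?B" using wnorm_nonneg[OF \<theta>] by auto
  have "w l z * cmod (pd ks \<theta> (z + h) - pd ks \<theta> z) \<le> (?A + ?B + 1) * w (2 * l) h" if ks: "length ks \<le> r" for ks z h
  proof -
    have "w l z = w l ((z + h) + - h)" by simp
    also have "\<dots> \<le> w (2*l) (z + h) * w (2*l) (- h)" by (rule w_submult)
    also have "w (2*l) (- h) = w (2*l) h" by (rule w_norm_eq) simp
    finally have "w l z * cmod (pd ks \<theta> (z + h)) \<le> (w (2*l) (z + h) * w (2*l) h) * cmod (pd ks \<theta> (z + h))"
      by (rule mult_right_mono) simp
    also have "\<dots> = w (2*l) h * (w (2*l) (z + h) * cmod (pd ks \<theta> (z + h)))" by simp
    also have "\<dots> \<le> w (2*l) h * ?A" by (intro mult_left_mono wnorm_upper \<theta> ks w_nonneg)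
    finally have 1: "w l z * cmod (pd ks \<theta> (z + h)) \<le> w (2*l) h * ?A" .
    have 2: "w l z * cmod (pd ks \<theta> z) \<le> w (2*l) h * ?B"
      using mult_right_mono[OF w_ge1[of "2*l" h] nn(2)] wnorm_upper[OF \<theta> ks, of l z] by simp
    have "w l z * cmod (pd ks \<theta> (z + h) - pd ks \<theta> z) \<le> w l z * (cmod (pd ks \<theta> (z + h)) + cmod (pd ks \<theta> z))"
      by (intro mult_left_mono norm_triangle_ineq4 w_nonneg)
    also have "\<dots> \<le> w (2*l) h * ?A + w (2*l) h * ?B" using 1 2 by (simp add: distrib_left)
    also have "\<dots> \<le> (?A + ?B + 1) * w (2 * l) h" using w_nonneg[of "2*l" h] by (simp add: algebra_simps)
    finally show ?thesis .
  qed
  moreover have "0 < ?A + ?B + 1" using nn by simp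
  ultimately show ?thesis by blast
qed

text \<open>Far out both values are small by themselves, because the weight with a spare factor
  \<open>1 + norm x\<close> still leaves a bounded function; on the remaining ball compactness gives
  uniform continuity and the weight is bounded.\<close>

lemma test_weighted_uniform_continuity:
  assumes \<theta>: "\<theta> \<in> test_space w r" and ks: "length ks \<le> r" and \<delta>: "0 < \<delta>"
  shows "\<exists>\<eta>>0. \<forall>z h. norm h \<le> \<eta> \<longrightarrow> w l z * cmod (pd ks \<theta> (z + h) - pd ks \<theta> z) \<le> \<delta>"
proof -
  let ?G = "pd ks \<theta>"
  define e where "e = (axis undefined 1 :: real^'n)"
  have e: "norm e = 1" by (simp add: e_def)
  define A where "A = w (2*l) e"
  have A: "1 \<le> A" unfolding A_def by (rule w_ge1)
  obtain C where C: "0 < C" "\<And>x. w (2*l) x * (1 + norm x) * cmod (?G x) \<le> C"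
    using test_decay[OF \<theta>, of "2*l" 1] ks by auto
  \<comment> \<open>For \<open>norm z\<close> at least \<open>R\<close> and \<open>norm h\<close> at
    most 1, the shifted and the unshifted value contribute at most \<open>A * (C / R)\<close> and
    \<open>C / R\<close>. The bound \<open>R \<le> 1 + norm x\<close> still holds at
    \<open>x = z + h\<close>.\<close>
  define R where "R = 1 + (A + 1) * C / \<delta>"
  have R: "1 < R" "(A + 1) * C / R \<le> \<delta>"
    using A C(1) \<delta> by (auto simp: R_def field_simps add_pos_pos)
  have far: "w l z * cmod (?G (z + h) - ?G z) \<le> \<delta>" if h: "norm h \<le> 1" and z: "R \<le> norm z" for z h
  proof -
    have b: "w (2*l) x * cmod (?G x) \<le> C / R" if "R \<le> 1 + norm x" for x
    proof -
      have "(w (2*l) x * cmod (?G x)) * R \<le> (w (2*l) x * cmod (?G x)) * (1 + norm x)"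
        using that by (intro mult_left_mono mult_nonneg_nonneg w_nonneg) auto
      then have "(w (2*l) x * cmod (?G x)) * R \<le> C" using C(2)[of x] by (simp add: mult_ac)
      then show ?thesis using R(1) by (simp add: pos_le_divide_eq)
    qed
    have "w l z = w l ((z + h) + - h)" by simp
    also have "\<dots> \<le> w (2*l) (z + h) * w (2*l) (- h)" by (rule w_submult)
    also have "\<dots> \<le> w (2*l) (z + h) * A"
      unfolding A_def using h e by (intro mult_left_mono w_mono w_nonneg) simp
    finally have "w l z * cmod (?G (z + h)) \<le> A * (w (2*l) (z + h) * cmod (?G (z + h)))"
      using mult_right_mono[of "w l z" "w (2*l) (z + h) * A" "cmod (?G (z + h))"] by (simp add: mult_ac)
    also have "\<dots> \<le> A * (C / R)"
      using A norm_triangle_ineq4[of "z + h" h] h z by (intro mult_left_mono b) auto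
    finally have 1: "w l z * cmod (?G (z + h)) \<le> A * (C / R)" .
    have "w l z * cmod (?G z) \<le> w (2*l) z * cmod (?G z)" by (intro mult_right_mono w_mono_index) auto
    also have "\<dots> \<le> C / R" using z by (intro b) auto
    finally have 2: "w l z * cmod (?G z) \<le> C / R" .
    have "w l z * cmod (?G (z + h) - ?G z) \<le> w l z * (cmod (?G (z + h)) + cmod (?G z))"
      by (intro mult_left_mono norm_triangle_ineq4 w_nonneg)
    also have "\<dots> \<le> A * (C / R) + C / R" using 1 2 by (simp add: distrib_left)
    also have "\<dots> = (A + 1) * C / R" using R(1) by (simp add: field_simps)
    finally show ?thesis using R(2) by simp
  qed
  define B where "B = w l (R *\<^sub>R e)"
  have B: "0 < B" unfolding B_def by (rule w_pos)
  have "uniformly_continuous_on (cball 0 (R + 1)) ?G"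
    using continuous_on_subset[OF test_space_continuous[OF \<theta> ks]] by (intro compact_uniformly_continuous) auto
  then obtain d where d: "0 < d" "\<And>x y. x \<in> cball 0 (R + 1) \<Longrightarrow> y \<in> cball 0 (R + 1) \<Longrightarrow> dist y x < d \<Longrightarrow> dist (?G y) (?G x) < \<delta> / B"
    by (rule uniformly_continuous_onE[OF _ divide_pos_pos[OF \<delta> B]]) blast
  have near: "w l z * cmod (?G (z + h) - ?G z) \<le> \<delta>" if h: "norm h \<le> 1" "norm h < d" and z: "norm z \<le> R" for z h
  proof -
    have "cmod (?G (z + h) - ?G z) \<le> \<delta> / B"
      using d(2)[of z "z + h"] h z norm_triangle_ineq[of z h] by (auto simp add: dist_norm mem_cball_0 simp del: mem_cball intro!: less_imp_le)
    moreover have "w l z \<le> B" unfolding B_def using z R(1) e by (intro w_mono) simp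
    ultimately have "w l z * cmod (?G (z + h) - ?G z) \<le> B * (\<delta> / B)"
      using B by (intro mult_mono) auto
    then show ?thesis using B by simp
  qed
  have "w l z * cmod (?G (z + h) - ?G z) \<le> \<delta>" if "norm h \<le> min 1 (d / 2)" for z h
    using near[of h z] far[of h z] that d(1) by (cases "norm z \<le> R") auto
  then show ?thesis using d(1) by (intro exI[of _ "min 1 (d / 2)"]) auto
qed

lemma test_weighted_uniform_continuity_all:
  assumes \<theta>: "\<theta> \<in> test_space w r" and \<delta>: "0 < \<delta>"
  shows "\<exists>\<eta>>0. \<forall>ks z h. length ks \<le> r \<longrightarrow> norm h \<le> \<eta> \<longrightarrow> w l z * cmod (pd ks \<theta> (z + h) - pd ks \<theta> z) \<le> \<delta>"
proof -
  let ?A = "{ks :: 'n list. length ks \<le> r}"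
  have "finite ?A" using finite_lists_length_le[of "UNIV :: 'n set" r] by simp
  moreover have "\<forall>ks\<in>?A. \<exists>\<eta>>0. \<forall>z h. norm h \<le> \<eta> \<longrightarrow> w l z * cmod (pd ks \<theta> (z + h) - pd ks \<theta> z) \<le> \<delta>"
    using test_weighted_uniform_continuity[OF \<theta> _ \<delta>] by auto
  then obtain \<eta> where \<eta>: "\<And>ks. ks \<in> ?A \<Longrightarrow> 0 < \<eta> ks"
    "\<And>ks z h. ks \<in> ?A \<Longrightarrow> norm h \<le> \<eta> ks \<Longrightarrow> w l z * cmod (pd ks \<theta> (z + h) - pd ks \<theta> z) \<le> \<delta>"
    by metis
  moreover have "?A \<noteq> {}" by (auto intro: exI[of _ "[]"])
  ultimately have "0 < Min (\<eta> ` ?A)" by (subst Min_gr_iff) auto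
  moreover have "Min (\<eta> ` ?A) \<le> \<eta> ks" if "ks \<in> ?A" for ks
    using \<open>finite ?A\<close> that by (intro Min_le) auto
  ultimately have "0 < Min (\<eta> ` ?A)" "\<And>ks. ks \<in> ?A \<Longrightarrow> Min (\<eta> ` ?A) \<le> \<eta> ks" by blast+
  then show ?thesis
    using order_trans[of "norm _" "Min (\<eta> ` ?A)"] by (intro exI[of _ "Min (\<eta> ` ?A)"] conjI allI impI \<eta>(2)) auto
qed

section \<open>Moments and the Taylor expansion under the kernel integral\<close>

lemma kern_moment_bound:
  assumes \<psi>: "\<psi> \<in> test_space w r"
  shows "\<exists>C>0. \<forall>ks u v. length ks \<le> r \<longrightarrow> w l v * (1 + norm v) ^ p * cmod (kern \<psi> ks u (u + v)) \<le> C * decay v"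
proof -
  obtain l' B where B: "0 < B" "\<And>x. w l x * (1 + norm x) ^ p \<le> B * w l' x" using w_poly by blast
  obtain C where C: "0 < C" "\<And>ks u v. length ks \<le> r \<Longrightarrow> cmod (kern \<psi> ks u v) \<le> C / W l' (v - u)"
    using kern_bound[OF \<psi>] by blast
  have "w l v * (1 + norm v) ^ p * cmod (kern \<psi> ks u (u + v)) \<le> B * C * decay v" if "length ks \<le> r" for ks u v
  proof -
    have "w l v * (1 + norm v) ^ p * cmod (kern \<psi> ks u (u + v)) \<le> (B * w l' v) * (C / W l' v)"
      using B(1) C(2)[OF that, of u "u + v"] w_nonneg by (intro mult_mono[OF B(2)]) auto
    also have "\<dots> = B * C * decay v" unfolding W_eq using w_pos[of l' v] by simp
    finally show ?thesis .
  qed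
  moreover have "0 < B * C" using B C by simp
  ultimately show ?thesis by blast
qed

lemma kern_shift_measurable:
  assumes "\<psi> \<in> test_space w r"
  shows "(\<lambda>v. kern \<psi> ks u (u + v)) \<in> borel_measurable borel"
  using measurable_compose[OF _ kern_measurable[OF assms], of "\<lambda>v. u + v" borel] by simp

lemma norm_power_kern_bound:
  assumes \<psi>: "\<psi> \<in> test_space w r"
  shows "\<exists>C>0. \<forall>ks u v. length ks \<le> r \<longrightarrow> norm v ^ p * cmod (kern \<psi> ks u (u + v)) \<le> C * decay v"
proof -
  obtain C where C: "0 < C" "\<And>ks u v. length ks \<le> r \<Longrightarrow> w 0 v * (1 + norm v) ^ p * cmod (kern \<psi> ks u (u + v)) \<le> C * decay v"
    using kern_moment_bound[OF \<psi>, of 0 p] by blast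
  have "norm v ^ p * cmod (kern \<psi> ks u (u + v)) \<le> w 0 v * (1 + norm v) ^ p * cmod (kern \<psi> ks u (u + v))" for ks u v
  proof (rule mult_right_mono)
    have "norm v ^ p \<le> 1 * (1 + norm v) ^ p" by (simp add: power_mono)
    also have "\<dots> \<le> w 0 v * (1 + norm v) ^ p" by (intro mult_right_mono w_ge1) simp
    finally show "norm v ^ p \<le> w 0 v * (1 + norm v) ^ p" .
  qed simp
  then show ?thesis using C by (meson order_trans)
qed

lemma vpow_kern_integrable:
  assumes \<psi>: "\<psi> \<in> test_space w r" and ks: "length ks \<le> r"
  shows "integrable lborel (\<lambda>v. vpow v js *\<^sub>R kern \<psi> ks u (u + v))"
proof -
  obtain C where C: "0 < C" "\<And>v. norm v ^ length js * cmod (kern \<psi> ks u (u + v)) \<le> C * decay v"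
    using norm_power_kern_bound[OF \<psi>] ks by blast
  note [measurable] = kern_shift_measurable[OF \<psi>] borel_measurable_continuous_onI[OF continuous_on_vpow]
  have "cmod (vpow v js *\<^sub>R kern \<psi> ks u (u + v)) \<le> C * decay v" for v
    using mult_right_mono[OF abs_vpow_le[of v js] norm_ge_zero[of "kern \<psi> ks u (u + v)"]] C(2)[of v] by simp
  then show ?thesis by (intro integrable_decay_bound[where C=C]) auto
qed

definition moment :: "(real^'n \<Rightarrow> complex) \<Rightarrow> 'n list \<Rightarrow> 'n list \<Rightarrow> real^'n \<Rightarrow> complex" where
  "moment \<psi> ks js u = (\<integral>v. vpow v js *\<^sub>R kern \<psi> ks u (u + v) \<partial>lborel)"

text \<open>The Taylor term of order \<open>i\<close>, without its factorial, integrated against the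
  kernel. The base point \<open>u\<close> of the kernel and the point \<open>z\<close> of
  differentiation are independent, so for fixed \<open>u\<close> this is a differential operator
  with constant coefficients.\<close>

definition moment_op :: "(real^'n \<Rightarrow> complex) \<Rightarrow> 'n list \<Rightarrow> nat \<Rightarrow> real^'n \<Rightarrow> (real^'n \<Rightarrow> complex) \<Rightarrow> real^'n \<Rightarrow> complex" where
  "moment_op \<psi> ks i u \<theta> z = (\<Sum>js\<in>lists_of i. moment \<psi> ks js u * pd js \<theta> z)"

lemma dir_deriv_kern:
  assumes \<psi>: "\<psi> \<in> test_space w r" and ks: "length ks \<le> r"
  shows "integrable lborel (\<lambda>v. dir_deriv i v \<theta> z * kern \<psi> ks u (u + v))"
    and "(\<integral>v. dir_deriv i v \<theta> z * kern \<psi> ks u (u + v) \<partial>lborel) = moment_op \<psi> ks i u \<theta> z"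
proof -
  have eq: "(\<lambda>v. dir_deriv i v \<theta> z * kern \<psi> ks u (u + v))
     = (\<lambda>v. \<Sum>js\<in>lists_of i. (vpow v js *\<^sub>R kern \<psi> ks u (u + v)) * pd js \<theta> z)"
    by (simp add: dir_deriv_def sum_distrib_right mult.commute[of "kern _ _ _ _"])
  have int: "integrable lborel (\<lambda>v. (vpow v js *\<^sub>R kern \<psi> ks u (u + v)) * pd js \<theta> z)" for js
    by (intro integrable_mult_left vpow_kern_integrable[OF \<psi> ks])
  show "integrable lborel (\<lambda>v. dir_deriv i v \<theta> z * kern \<psi> ks u (u + v))"
    unfolding eq by (intro Bochner_Integration.integrable_sum int)
  show "(\<integral>v. dir_deriv i v \<theta> z * kern \<psi> ks u (u + v) \<partial>lborel) = moment_op \<psi> ks i u \<theta> z"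
    unfolding eq moment_op_def moment_def
    by (subst Bochner_Integration.integral_sum[OF int]) (simp only: integral_mult_left_zero)
qed

lemma dir_deriv_scaleR: "dir_deriv i (c *\<^sub>R v) \<theta> z = c ^ i *\<^sub>R dir_deriv i v \<theta> z"
  by (simp add: dir_deriv_def vpow_scaleR scaleR_sum_right lists_of_def)

lemma test_shift_kern_integrable:
  assumes \<theta>: "\<theta> \<in> test_space w r" and \<psi>: "\<psi> \<in> test_space w r" and ks: "length ks \<le> r"
  shows "integrable lborel (\<lambda>v. \<theta> (z + c *\<^sub>R v) * kern \<psi> ks u (u + v))"
proof -
  note [measurable] = test_measurable'[OF \<theta>] kern_shift_measurable[OF \<psi>]
  obtain B where B: "0 < B" "\<And>x. cmod (\<theta> x) \<le> B * decay x"
    using test_bounded_decay[OF \<theta>] by (metis le0 list.size(3) pd_Nil)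
  obtain C where C: "0 < C" "\<And>v. norm v ^ 0 * cmod (kern \<psi> ks u (u + v)) \<le> C * decay v"
    using norm_power_kern_bound[OF \<psi>] ks by blast
  have "cmod (\<theta> (z + c *\<^sub>R v) * kern \<psi> ks u (u + v)) \<le> B * C * decay v" for v
  proof -
    have "cmod (\<theta> (z + c *\<^sub>R v)) \<le> B * 1"
      using mult_left_mono[OF decay_le1[of "z + c *\<^sub>R v"], of B] B by (meson less_imp_le order_trans)
    then have "cmod (\<theta> (z + c *\<^sub>R v) * kern \<psi> ks u (u + v)) \<le> (B * 1) * (C * decay v)"
      unfolding norm_mult using C(2)[of v] B by (intro mult_mono) auto
    then show ?thesis by simp
  qed
  then show ?thesis by (intro integrable_decay_bound[where C="B * C"]) auto
qed

text \<open>The integral is split at \<open>norm v = \<eta> * N\<close>. Below, the shift is at most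
  \<open>\<eta>\<close> and weighted uniform continuity makes the remainder small. Above, the crude
  difference bound is multiplied by \<open>(1 + norm v) / (\<eta> * N)\<close>, which is at least 1
  there: one additional moment of the kernel buys the missing factor \<open>1 / N\<close>.\<close>

lemma kern_taylor:
  assumes \<theta>: "\<theta> \<in> test_space w r" and \<psi>: "\<psi> \<in> test_space w r" and ks: "length ks \<le> r"
    and k: "k \<le> r" and \<delta>: "0 < \<delta>"
  shows "\<exists>N0\<ge>1. \<forall>N\<ge>N0. \<forall>z u. w l z * cmod ((\<integral>v. \<theta> (z + (1 / N) *\<^sub>R v) * kern \<psi> ks u (u + v) \<partial>lborel)
      - (\<Sum>i\<le>k. (1 / (fact i * N ^ i)) *\<^sub>R moment_op \<psi> ks i u \<theta> z)) \<le> \<delta> / N ^ k"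
proof -
  obtain A1 where A1: "0 < A1" "\<And>u v. norm v ^ k * cmod (kern \<psi> ks u (u + v)) \<le> A1 * decay v"
    using norm_power_kern_bound[OF \<psi>] ks by blast
  obtain A2 where A2: "0 < A2" "\<And>u v. w (2*l) v * (1 + norm v) ^ (k + 1) * cmod (kern \<psi> ks u (u + v)) \<le> A2 * decay v"
    using kern_moment_bound[OF \<psi>] ks by blast
  obtain C where C: "0 < C" "\<And>ks z h. length ks \<le> r \<Longrightarrow> w l z * cmod (pd ks \<theta> (z + h) - pd ks \<theta> z) \<le> C * w (2*l) h"
    using test_difference_bound[OF \<theta>] by blast
  define m where "m = real (card (lists_of k :: 'n list set))"
  define I where "I = (\<integral>x. decay (x :: real^'n) \<partial>lborel)"
  have I: "0 \<le> I" unfolding I_def by (intro integral_nonneg_AE) simp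
  have m: "0 \<le> m" by (simp add: m_def)
  \<comment> \<open>Half of \<open>\<delta>\<close> is reserved for the part with small shifts, and
    \<open>N0\<close> below makes the other part at most the second half. The summand 1 keeps the
    denominator positive.\<close>
  define \<delta>' where "\<delta>' = \<delta> / (2 * (m * A1 * I + 1))"
  have \<delta>': "0 < \<delta>'" unfolding \<delta>'_def using \<delta> m A1(1) I by (intro divide_pos_pos mult_pos_pos add_nonneg_pos) auto
  obtain \<eta> where \<eta>: "0 < \<eta>" "\<And>ks z h. length ks \<le> r \<Longrightarrow> norm h \<le> \<eta> \<Longrightarrow> w l z * cmod (pd ks \<theta> (z + h) - pd ks \<theta> z) \<le> \<delta>'"
    using test_weighted_uniform_continuity_all[OF \<theta> \<delta>'] by blast
  define N0 where "N0 = max 1 (2 * (m * A2 * C * I) / (\<eta> * \<delta>))"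
  have "w l z * cmod ((\<integral>v. \<theta> (z + (1 / N) *\<^sub>R v) * kern \<psi> ks u (u + v) \<partial>lborel)
      - (\<Sum>i\<le>k. (1 / (fact i * N ^ i)) *\<^sub>R moment_op \<psi> ks i u \<theta> z)) \<le> \<delta> / N ^ k" if N: "N0 \<le> N" for N z u
  proof -
    have N1: "1 \<le> N" and N2: "2 * (m * A2 * C * I) / (\<eta> * \<delta>) \<le> N" using N by (auto simp: N0_def)
    let ?T = "\<lambda>v. \<theta> (z + (1 / N) *\<^sub>R v) - (\<Sum>i\<le>k. (1 / (fact i * N ^ i)) *\<^sub>R dir_deriv i v \<theta> z)"
    let ?K = "\<lambda>v. kern \<psi> ks u (u + v)"
    define D where "D = m / N ^ k * (\<delta>' * A1 + C * A2 / (\<eta> * N)) / w l z"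
    have T: "cmod (?T v * ?K v) \<le> D * decay v" for v
    proof -
      define b where "b = \<delta>' + C * (w (2*l) v * (1 + norm v)) / (\<eta> * N)"
      have b0: "0 \<le> b" unfolding b_def using \<delta>' C(1) \<eta>(1) N1 w_nonneg by (intro add_nonneg_nonneg divide_nonneg_nonneg mult_nonneg_nonneg) auto
      have b: "w l z * cmod (pd js \<theta> (z + t *\<^sub>R (1 / N) *\<^sub>R v) - pd js \<theta> z) \<le> b"
        if js: "length js = k" and t: "0 \<le> t" "t \<le> 1" for js t
      proof (cases "norm v \<le> \<eta> * N")
        case True
        have "norm (t *\<^sub>R (1 / N) *\<^sub>R v) \<le> 1 * (norm v / N)"
          using t N1 by (simp add: divide_right_mono mult_left_le_one_le)
        also have "\<dots> \<le> \<eta>" using True N1 by (simp add: pos_divide_le_eq)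
        finally have "w l z * cmod (pd js \<theta> (z + t *\<^sub>R (1 / N) *\<^sub>R v) - pd js \<theta> z) \<le> \<delta>'"
          using js k by (intro \<eta>(2)) auto
        also have "\<dots> \<le> b" unfolding b_def using C(1) \<eta>(1) N1 w_nonneg by (simp add: add_nonneg_nonneg)
        finally show ?thesis .
      next
        case False
        have nn: "norm (t *\<^sub>R (1 / N) *\<^sub>R v) \<le> norm v"
        proof -
          have "t / N \<le> 1" using t N1 by simp
          then have "(t / N) * norm v \<le> 1 * norm v" by (intro mult_right_mono) auto
          then show ?thesis using t N1 by simp
        qed
        have "w l z * cmod (pd js \<theta> (z + t *\<^sub>R (1 / N) *\<^sub>R v) - pd js \<theta> z) \<le> C * w (2*l) (t *\<^sub>R (1 / N) *\<^sub>R v)"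
          using js k by (intro C(2)) auto
        also have "\<dots> \<le> C * w (2*l) v" using C(1) by (intro mult_left_mono w_mono nn) auto
        also have "\<dots> \<le> C * w (2*l) v * ((1 + norm v) / (\<eta> * N))"
        proof -
          have "1 \<le> (1 + norm v) / (\<eta> * N)" using False \<eta>(1) N1 by (simp add: pos_le_divide_eq)
          moreover have "0 \<le> C * w (2*l) v" using C(1) w_nonneg by simp
          ultimately show ?thesis using mult_left_mono by fastforce
        qed
        also have "\<dots> \<le> b" unfolding b_def using \<delta>' by simp
        finally show ?thesis .
      qed
      have "cmod (\<theta> (z + (1 / N) *\<^sub>R v) - (\<Sum>i\<le>k. (1 / fact i) *\<^sub>R dir_deriv i ((1 / N) *\<^sub>R v) \<theta> z))
         \<le> m * (norm ((1 / N) *\<^sub>R v) ^ k * (b / w l z))"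
        unfolding m_def
      proof (rule taylor_pd[OF test_space_C_class[OF \<theta>] k])
        fix js :: "'n list" and t :: real assume "length js = k" "0 \<le> t" "t \<le> 1"
        from b[OF this] show "cmod (pd js \<theta> (z + t *\<^sub>R (1 / N) *\<^sub>R v) - pd js \<theta> z) \<le> b / w l z"
          using w_pos[of l z] by (simp add: pos_le_divide_eq mult.commute)
      qed
      also have "\<theta> (z + (1 / N) *\<^sub>R v) - (\<Sum>i\<le>k. (1 / fact i) *\<^sub>R dir_deriv i ((1 / N) *\<^sub>R v) \<theta> z) = ?T v"
        by (simp add: dir_deriv_scaleR power_divide)
      also have "norm ((1 / N) *\<^sub>R v) ^ k = norm v ^ k / N ^ k" using N1 by (simp add: power_divide)
      finally have "cmod (?T v * ?K v) \<le> m * (norm v ^ k / N ^ k * (b / w l z)) * cmod (?K v)"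
        unfolding norm_mult by (rule mult_right_mono) simp
      also have "\<dots> = m / N ^ k / w l z * (\<delta>' * (norm v ^ k * cmod (?K v))
          + C / (\<eta> * N) * (w (2*l) v * (norm v ^ k * (1 + norm v)) * cmod (?K v)))"
        by (simp add: b_def algebra_simps add_divide_distrib)
      also have "\<dots> \<le> m / N ^ k / w l z * (\<delta>' * (A1 * decay v) + C / (\<eta> * N) * (A2 * decay v))"
      proof (intro mult_left_mono add_mono)
        show "norm v ^ k * cmod (?K v) \<le> A1 * decay v" by (rule A1(2))
        have "w (2*l) v * (norm v ^ k * (1 + norm v)) * cmod (?K v) \<le> w (2*l) v * (1 + norm v) ^ (k + 1) * cmod (?K v)"
        proof (intro mult_right_mono mult_left_mono)
          have "norm v ^ k * (1 + norm v) \<le> (1 + norm v) ^ k * (1 + norm v)"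
            by (intro mult_right_mono power_mono) auto
          then show "norm v ^ k * (1 + norm v) \<le> (1 + norm v) ^ (k + 1)" by (simp add: mult.commute)
        qed (auto simp: w_nonneg)
        also have "\<dots> \<le> A2 * decay v" by (rule A2(2))
        finally show "w (2*l) v * (norm v ^ k * (1 + norm v)) * cmod (?K v) \<le> A2 * decay v" .
      qed (use C(1) \<eta>(1) N1 \<delta>' m w_nonneg in auto)
      also have "\<dots> = D * decay v" by (simp add: D_def algebra_simps add_divide_distrib)
      finally show ?thesis .
    qed
    have int: "integrable lborel (\<lambda>v. \<theta> (z + (1 / N) *\<^sub>R v) * ?K v)" by (rule test_shift_kern_integrable[OF \<theta> \<psi> ks])
    have int': "integrable lborel (\<lambda>v. (1 / (fact i * N ^ i)) *\<^sub>R (dir_deriv i v \<theta> z * ?K v))" for i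
      by (intro integrable_scaleR_right dir_deriv_kern[OF \<psi> ks])
    have eqT: "(\<lambda>v. ?T v * ?K v) = (\<lambda>v. \<theta> (z + (1 / N) *\<^sub>R v) * ?K v - (\<Sum>i\<le>k. (1 / (fact i * N ^ i)) *\<^sub>R (dir_deriv i v \<theta> z * ?K v)))"
      by (simp add: left_diff_distrib sum_distrib_right)
    have intT: "integrable lborel (\<lambda>v. ?T v * ?K v)"
      unfolding eqT by (intro Bochner_Integration.integrable_diff Bochner_Integration.integrable_sum int int')
    have eqI: "(\<integral>v. \<theta> (z + (1 / N) *\<^sub>R v) * ?K v \<partial>lborel) - (\<Sum>i\<le>k. (1 / (fact i * N ^ i)) *\<^sub>R moment_op \<psi> ks i u \<theta> z)
       = (\<integral>v. ?T v * ?K v \<partial>lborel)"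
      unfolding eqT dir_deriv_kern(2)[OF \<psi> ks, symmetric]
      by (subst Bochner_Integration.integral_diff[OF int Bochner_Integration.integrable_sum[OF int']],
          subst Bochner_Integration.integral_sum[OF int']) simp
    have "cmod (\<integral>v. ?T v * ?K v \<partial>lborel) \<le> D * I"
      unfolding I_def using T borel_measurable_integrable[OF intT]
      by (intro order_trans[OF integral_norm_bound integral_decay_bound]) auto
    then have "w l z * cmod ((\<integral>v. \<theta> (z + (1 / N) *\<^sub>R v) * ?K v \<partial>lborel)
        - (\<Sum>i\<le>k. (1 / (fact i * N ^ i)) *\<^sub>R moment_op \<psi> ks i u \<theta> z)) \<le> w l z * (D * I)"
      unfolding eqI by (rule mult_left_mono) (rule w_nonneg)
    also have "\<dots> = (m * A1 * I * \<delta>' + m * A2 * C * I / (\<eta> * N)) / N ^ k"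
    proof -
      have wD: "w l z * D = m / N ^ k * (\<delta>' * A1 + C * A2 / (\<eta> * N))"
        using w_pos[of l z] by (simp add: D_def)
      have "w l z * (D * I) = m / N ^ k * (\<delta>' * A1 + C * A2 / (\<eta> * N)) * I"
        unfolding wD[symmetric] by (rule mult.assoc[symmetric])
      then show ?thesis by (simp add: algebra_simps add_divide_distrib)
    qed
    also have "\<dots> \<le> \<delta> / N ^ k"
    proof (rule divide_right_mono)
      have "m * A1 * I * \<delta>' \<le> (m * A1 * I + 1) * \<delta>'" using \<delta>' by (simp add: distrib_right)
      also have "\<dots> = \<delta> / 2" unfolding \<delta>'_def using m A1(1) I by (simp add: field_simps add_nonneg_eq_0_iff)
      finally have 1: "m * A1 * I * \<delta>' \<le> \<delta> / 2" .
      have "m * A2 * C * I / (\<eta> * N) \<le> \<delta> / 2"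
        using N1 N2 \<eta>(1) \<delta> by (simp add: field_simps)
      with 1 show "m * A1 * I * \<delta>' + m * A2 * C * I / (\<eta> * N) \<le> \<delta>" by linarith
    qed (use N1 in simp)
    finally show ?thesis .
  qed
  then show ?thesis by (intro exI[of _ N0]) (auto simp: N0_def)
qed

end

section \<open>Periodicity of the kernel and integrals of derivatives\<close>

lemma suminf_lat:
  fixes F :: "int^'n::finite \<Rightarrow> complex"
  assumes "summable (\<lambda>k. cmod (F (lat k)))"
  shows "(\<Sum>k. F (lat k)) = infsum F UNIV"
proof -
  have "((\<lambda>k. F (lat k)) has_sum (\<Sum>k. F (lat k))) UNIV"
    using norm_summable_imp_has_sum[OF assms summable_sums[OF summable_norm_cancel[OF assms]]] .
  then have "infsum (\<lambda>k. F (lat k)) UNIV = (\<Sum>k. F (lat k))" by (rule infsumI)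
  then show ?thesis using infsum_reindex_bij_betw[OF bij_lat, of F] by simp
qed

text \<open>By translation invariance every difference quotient has integral 0. The quotients
  converge pointwise to the derivative, and the mean value inequality bounds them by values of
  \<open>decay\<close> at distance at most 1, hence by a fixed multiple of
  \<open>decay x\<close>.\<close>

lemma integral_directional_derivative_zero:
  fixes h h' :: "real^'n::finite \<Rightarrow> complex"
  assumes der: "\<And>x s. ((\<lambda>s. h (x + s *\<^sub>R axis i 1)) has_vector_derivative h' (x + s *\<^sub>R axis i 1)) (at s)"
    and [measurable]: "h \<in> borel_measurable borel" "h' \<in> borel_measurable borel"
    and b: "\<And>x. cmod (h x) \<le> C * decay x" and b': "\<And>x. cmod (h' x) \<le> C * decay x"
  shows "(\<integral>x. h' x \<partial>lborel) = 0"
proof -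
  let ?e = "axis i 1 :: real^'n" and ?s = "\<lambda>n. 1 / real (Suc n)"
  let ?q = "\<lambda>n x. (h (x + ?s n *\<^sub>R ?e) - h x) /\<^sub>R ?s n"
  have inth: "integrable lborel h" using b by (rule integrable_decay_bound[rotated]) simp
  have C: "0 \<le> C" using b'[of 0] decay_pos[of "0 :: real^'n"] by (metis norm_ge_zero order_trans zero_le_mult_iff not_le less_asym)
  have "(\<lambda>n. \<integral>x. ?q n x \<partial>lborel) \<longlonglongrightarrow> (\<integral>x. h' x \<partial>lborel)"
  proof (rule integral_dominated_convergence[where w="\<lambda>x. C * (2 ^ (CARD('n) + 1) * decay x)"])
    show "integrable lborel (\<lambda>x::real^'n. C * (2 ^ (CARD('n) + 1) * decay x))"
      by (intro integrable_mult_right integrable_decay)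
    show "AE x in lborel. (\<lambda>n. ?q n x) \<longlonglongrightarrow> h' x"
    proof (rule AE_I2)
      fix x
      let ?A = "\<lambda>s. h (x + s *\<^sub>R ?e) - h x"
      have "((\<lambda>s. (?A s - s *\<^sub>R h' x) /\<^sub>R \<bar>s\<bar>) \<longlongrightarrow> 0) (at 0)"
        using der[of x 0] by (simp add: has_vector_derivative_def has_derivative_def)
      then have "((\<lambda>s. norm ((?A s - s *\<^sub>R h' x) /\<^sub>R \<bar>s\<bar>)) \<longlongrightarrow> 0) (at 0)" by (rule tendsto_norm_zero)
      moreover have "norm ((?A s - s *\<^sub>R h' x) /\<^sub>R \<bar>s\<bar>) = norm (?A s /\<^sub>R s - h' x)" if "s \<noteq> 0" for s
      proof -
        have "?A s /\<^sub>R s - h' x = (?A s - s *\<^sub>R h' x) /\<^sub>R s" using that by (simp add: scaleR_diff_right)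
        then show ?thesis by simp
      qed
      then have "\<forall>\<^sub>F s in at 0. norm ((?A s - s *\<^sub>R h' x) /\<^sub>R \<bar>s\<bar>) = norm (?A s /\<^sub>R s - h' x)"
        unfolding eventually_at_filter by (intro always_eventually) blast
      ultimately have "((\<lambda>s. norm (?A s /\<^sub>R s - h' x)) \<longlongrightarrow> 0) (at 0)" by (rule Lim_transform_eventually)
      then have "((\<lambda>s. ?A s /\<^sub>R s) \<longlongrightarrow> h' x) (at 0)" by (rule LIM_zero_cancel[OF tendsto_norm_zero_cancel])
      moreover have "filterlim ?s (at 0) sequentially"
        using LIMSEQ_inverse_real_of_nat by (auto simp: filterlim_at inverse_eq_divide)
      ultimately show "(\<lambda>n. ?q n x) \<longlonglongrightarrow> h' x" by (rule filterlim_compose)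
    qed
    show "AE x in lborel. norm (?q n x) \<le> C * (2 ^ (CARD('n) + 1) * decay x)" for n
    proof (rule AE_I2)
      fix x
      have s: "0 < ?s n" "?s n \<le> 1" by auto
      have "norm (h (x + ?s n *\<^sub>R ?e) - h (x + 0 *\<^sub>R ?e) - ?s n *\<^sub>R 0) \<le> ?s n * (C * (2 ^ (CARD('n) + 1) * decay x))"
      proof (rule mvt_linearization_bound[where g'="\<lambda>t. h' (x + t *\<^sub>R ?e)"])
        fix t assume t: "0 \<le> t" "t \<le> ?s n"
        have "cmod (h' (x + t *\<^sub>R ?e)) \<le> C * decay (x + t *\<^sub>R ?e)" by (rule b')
        also have "\<dots> \<le> C * (2 ^ (CARD('n) + 1) * decay x)"
          using t(1) order_trans[OF t(2) s(2)] C by (intro mult_left_mono decay_le_shift) auto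
        finally show "norm (h' (x + t *\<^sub>R ?e) - 0) \<le> C * (2 ^ (CARD('n) + 1) * decay x)" by simp
      qed (use s der in auto)
      then have st: "norm (h (x + ?s n *\<^sub>R ?e) - h x) \<le> ?s n * (C * (2 ^ (CARD('n) + 1) * decay x))" by simp
      have aux: "norm (b /\<^sub>R s) \<le> B" if "norm b \<le> s * B" "0 < s" for b :: complex and s B
        using that by (simp add: field_simps)
      show "norm (?q n x) \<le> C * (2 ^ (CARD('n) + 1) * decay x)"
        by (rule aux[OF st s(1)])
    qed
  qed auto
  moreover have "(\<integral>x. ?q n x \<partial>lborel) = 0" for n
  proof -
    have "integrable lborel (\<lambda>x. h (x + ?s n *\<^sub>R ?e))" "(\<integral>x. h (x + ?s n *\<^sub>R ?e) \<partial>lborel) = (\<integral>x. h x \<partial>lborel)"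
      using lborel_integrable_affine[OF _ inth, of 1 "?s n *\<^sub>R ?e"] lborel_integral_affine[OF _ inth, of 1 "?s n *\<^sub>R ?e"]
      by (simp_all add: add.commute)
    then show ?thesis using inth by simp
  qed
  ultimately have "(\<lambda>n::nat. 0) \<longlonglongrightarrow> (\<integral>x. h' x \<partial>lborel)" by simp
  then show ?thesis by (metis LIMSEQ_unique tendsto_const)
qed

context weight_family begin

lemma kern_periodic:
  assumes \<psi>: "\<psi> \<in> test_space w r" and ks: "length ks \<le> r"
  shows "kern \<psi> ks (u + lattice_pt m) (v + lattice_pt m) = kern \<psi> ks u v"
proof -
  let ?F = "\<lambda>u v j. pd ks \<psi> (u - lattice_pt j) * cnj (\<psi> (v - lattice_pt j))"
  have eq: "kern \<psi> ks u v = infsum (?F u v) UNIV" for u v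
    unfolding kern_def node_def using kern_summable[OF \<psi> ks, of u v] unfolding node_def
    by (intro suminf_lat) simp
  have "?F (u + lattice_pt m) (v + lattice_pt m) = (\<lambda>j. ?F u v (j - m))"
    by (simp add: fun_eq_iff lattice_pt_def vec_eq_iff algebra_simps) 
      (simp add: vec_eq_iff minus_vec_def plus_vec_def algebra_simps)
  moreover have "bij (\<lambda>j. j - m)" by (rule bij_betw_byWitness[where f'="\<lambda>j. j + m"]) auto
  ultimately show ?thesis using infsum_reindex_bij_betw[of "\<lambda>j. j - m" UNIV UNIV "?F u v"] eq by simp
qed

lemma moment_op_continuous:
  assumes \<theta>: "\<theta> \<in> test_space w r" and "i \<le> r"
  shows "isCont (moment_op \<psi> ks i u \<theta>) z"
proof -
  have "continuous_on UNIV (moment_op \<psi> ks i u \<theta>)"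
    unfolding moment_op_def using assms
    by (intro continuous_intros test_space_continuous[OF \<theta>]) (simp add: lists_of_def)
  then show ?thesis by (simp add: continuous_on_eq_continuous_at)
qed

end

text \<open>All that is retained of the multiresolution analysis: a nonzero test function which its
  own kernel reproduces at every scale \<open>2 ^ j\<close>, with base point 0.\<close>

locale refinable = weight_family w for w :: "nat \<Rightarrow> real^'n::finite \<Rightarrow> real" +
  fixes r :: nat and \<psi> :: "real^'n \<Rightarrow> complex"
  assumes \<psi>: "\<psi> \<in> test_space w r"
    and \<psi>_nonzero: "\<exists>x. \<psi> x \<noteq> 0"
    and reproduce: "approx \<psi> (2 ^ j) 0 \<psi> = \<psi>"
begin

text \<open>Take \<open>y\<^sub>j \<rightarrow> x\<close> with \<open>2\<^sup>j y\<^sub>j\<close> congruent to \<open>u\<close> modulo the lattice. By periodicity of the kernel,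
  self-reproduction at scale \<open>2\<^sup>j\<close> and Taylor's formula at \<open>y\<^sub>j\<close> become an asymptotic expansion in \<open>2\<^sup>-\<^sup>j\<close>
  whose coefficients are the moment operators at the fixed point \<open>u\<close>; compare orders.\<close>

lemma moment_op_self:
  assumes ks: "length ks \<le> r" and "i \<le> length ks"
  shows "moment_op \<psi> ks i u \<psi> x = (if i = length ks then fact i * pd ks \<psi> x else 0)"
  using \<open>i \<le> length ks\<close>
proof (induction i arbitrary: u x rule: less_induct)
  case (less i)
  define k where "k = length ks"
  have ik: "i \<le> k" "k \<le> r" using less.prems ks by (auto simp: k_def)
  have lower: "moment_op \<psi> ks i' u \<psi> x = 0" if "i' < i" for i' u x
    using less.IH[OF that] that less.prems by simp
  define m where "m j = (\<chi> q. \<lfloor>(2 ^ j *\<^sub>R x - u) $ q\<rfloor>)" for j :: nat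
  define y where "y j = (1 / 2 ^ j) *\<^sub>R (u + lattice_pt (m j))" for j :: nat
  have y_lim: "y \<longlonglongrightarrow> x"
  proof (rule vec_tendstoI)
    fix q
    have "norm (y j $ q - x $ q) \<le> (1/2) ^ j" for j
    proof -
      let ?a = "2 ^ j * x $ q - u $ q"
      have "norm (c * b) \<le> c" if "0 \<le> c" "\<bar>b\<bar> \<le> 1" for c b :: real
        using mult_left_mono[OF that(2,1)] that(1) by (simp add: abs_mult)
      moreover have "y j $ q - x $ q = (1/2) ^ j * (real_of_int \<lfloor>?a\<rfloor> - ?a)"
        by (simp add: y_def m_def lattice_pt_def field_simps)
      moreover have "\<bar>real_of_int \<lfloor>?a\<rfloor> - ?a\<bar> \<le> 1" by linarith
      ultimately show ?thesis by simp
    qed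
    moreover have "(\<lambda>j. (1/2 :: real) ^ j) \<longlonglongrightarrow> 0" by (intro LIMSEQ_power_zero) auto
    ultimately have "(\<lambda>j. y j $ q - x $ q) \<longlonglongrightarrow> 0"
      by (rule Lim_null_comparison[OF always_eventually, OF allI])
    then show "(\<lambda>j. y j $ q) \<longlonglongrightarrow> x $ q" by (rule LIM_zero_cancel)
  qed
  let ?I = "\<lambda>j. \<integral>v. \<psi> (y j + (1 / 2 ^ j) *\<^sub>R v) * kern \<psi> ks u (u + v) \<partial>lborel"
  let ?M = "\<lambda>j. (1 / fact i :: real) *\<^sub>R moment_op \<psi> ks i u \<psi> (y j)"
  have pdI: "(1 / 2 ^ j) ^ k *\<^sub>R pd ks \<psi> (y j) = ?I j" for j
  proof -
    have uy: "0 + 2 ^ j *\<^sub>R y j = u + lattice_pt (m j)" by (simp add: y_def)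
    have kp: "kern \<psi> ks (u + lattice_pt (m j)) (u + lattice_pt (m j) + v) = kern \<psi> ks u (u + v)" for v
      using kern_periodic[OF \<psi> ks, of u "m j" "u + v"] by (simp add: algebra_simps)
    have "pd ks \<psi> (y j) = (2 ^ j) ^ k *\<^sub>R ?I j"
      using pd_approx(1)[OF \<psi> \<psi> _ ks, of "2 ^ j" 0 "y j"] unfolding uy kp reproduce k_def by simp
    then show ?thesis by (simp add: power_divide)
  qed
  \<comment> \<open>Terms of order below \<open>i\<close> vanish by induction. Multiplying the
    expansion of order \<open>i\<close> by \<open>2 ^ j\<close> to the power \<open>i\<close>
    compares the reproduced derivative, damped by \<open>k - i\<close> powers of the scale, with the
    term of order \<open>i\<close> alone.\<close>
  have close: "\<forall>\<^sub>F j in sequentially. cmod ((1 / 2 ^ j) ^ (k - i) *\<^sub>R pd ks \<psi> (y j) - ?M j) \<le> \<delta>" if \<delta>: "0 < \<delta>" for \<delta>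
  proof -
    obtain N0 where N0: "\<And>N z u. N0 \<le> N \<Longrightarrow> w 0 z * cmod ((\<integral>v. \<psi> (z + (1 / N) *\<^sub>R v) * kern \<psi> ks u (u + v) \<partial>lborel)
      - (\<Sum>i'\<le>i. (1 / (fact i' * N ^ i')) *\<^sub>R moment_op \<psi> ks i' u \<psi> z)) \<le> \<delta> / N ^ i"
      using kern_taylor[OF \<psi> \<psi> ks order_trans[OF ik] \<delta>, of 0] by blast
    obtain j0 where j0: "N0 < 2 ^ j0" using real_arch_pow[of 2 N0] by auto
    show ?thesis
    proof (rule eventually_sequentiallyI[of j0])
      fix j assume "j0 \<le> j"
      then have "(2::real) ^ j0 \<le> 2 ^ j" by (intro power_increasing) auto
      then have N: "N0 \<le> 2 ^ j" using j0 by linarith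
      let ?N = "2 ^ j :: real"
      have "(\<Sum>i'\<le>i. (1 / (fact i' * ?N ^ i')) *\<^sub>R moment_op \<psi> ks i' u \<psi> (y j))
         = (\<Sum>i'\<in>{i}. (1 / (fact i' * ?N ^ i')) *\<^sub>R moment_op \<psi> ks i' u \<psi> (y j))"
        by (rule sum.mono_neutral_right) (auto simp: lower)
      then have "(\<Sum>i'\<le>i. (1 / (fact i' * ?N ^ i')) *\<^sub>R moment_op \<psi> ks i' u \<psi> (y j)) = (1 / ?N ^ i) *\<^sub>R ?M j"
        by simp
      with N0[OF N, of "y j" u] have "w 0 (y j) * cmod (?I j - (1 / ?N ^ i) *\<^sub>R ?M j) \<le> \<delta> / ?N ^ i" by simp
      then have 1: "cmod (?I j - (1 / ?N ^ i) *\<^sub>R ?M j) \<le> \<delta> / ?N ^ i"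
        using mult_right_mono[OF w_ge1[of 0 "y j"], of "cmod (?I j - (1 / ?N ^ i) *\<^sub>R ?M j)"] by simp
      have "(1 / ?N) ^ k = (1 / ?N ^ i) * (1 / ?N) ^ (k - i)"
        using ik(1) by (simp add: power_divide flip: power_add)
      then have "?I j - (1 / ?N ^ i) *\<^sub>R ?M j = (1 / ?N ^ i) *\<^sub>R ((1 / ?N) ^ (k - i) *\<^sub>R pd ks \<psi> (y j) - ?M j)"
        unfolding pdI[symmetric] by (simp add: scaleR_diff_right)
      with 1 have "(1 / ?N ^ i) * cmod ((1 / ?N) ^ (k - i) *\<^sub>R pd ks \<psi> (y j) - ?M j) \<le> \<delta> / ?N ^ i"
        by (simp only: norm_scaleR) simp
      then show "cmod ((1 / ?N) ^ (k - i) *\<^sub>R pd ks \<psi> (y j) - ?M j) \<le> \<delta>"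
        by (simp add: field_simps)
    qed
  qed
  \<comment> \<open>The damping factor tends to 0 below the top order and is 1 at the top order;
    this is where the two cases of the statement come from.\<close>
  let ?c = "if i = k then 1 else 0 :: real"
  have l1: "(\<lambda>j. (1 / 2 ^ j :: real) ^ (k - i)) \<longlonglongrightarrow> ?c"
  proof (cases "i = k")
    case False
    moreover have "(\<lambda>j. (1/2 :: real) ^ j) \<longlonglongrightarrow> 0" by (intro LIMSEQ_power_zero) auto
    ultimately show ?thesis
      using tendsto_null_power[of "\<lambda>j. (1/2 :: real) ^ j" sequentially "k - i"] ik by (simp add: power_divide)
  qed simp
  have l2: "(\<lambda>j. pd ks \<psi> (y j)) \<longlonglongrightarrow> pd ks \<psi> x"
    using test_space_continuous[OF \<psi> ks] y_lim by (simp add: continuous_on_eq_continuous_at isCont_tendsto_compose)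
  have l3: "?M \<longlonglongrightarrow> (1 / fact i :: real) *\<^sub>R moment_op \<psi> ks i u \<psi> x"
    by (rule tendsto_scaleR[OF tendsto_const isCont_tendsto_compose[OF moment_op_continuous[OF \<psi> order_trans[OF ik]] y_lim]])
  have lim: "(\<lambda>j. cmod ((1 / 2 ^ j) ^ (k - i) *\<^sub>R pd ks \<psi> (y j) - ?M j)) \<longlonglongrightarrow>
      cmod (?c *\<^sub>R pd ks \<psi> x - (1 / fact i :: real) *\<^sub>R moment_op \<psi> ks i u \<psi> x)"
    by (rule tendsto_norm[OF tendsto_diff[OF tendsto_scaleR[OF l1 l2] l3]])
  have "cmod (?c *\<^sub>R pd ks \<psi> x - (1 / fact i :: real) *\<^sub>R moment_op \<psi> ks i u \<psi> x) \<le> 0 + \<delta>" if "0 < \<delta>" for \<delta>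
    using tendsto_upperbound[OF lim close[OF that]] by simp
  then have "cmod (?c *\<^sub>R pd ks \<psi> x - (1 / fact i :: real) *\<^sub>R moment_op \<psi> ks i u \<psi> x) \<le> 0" by (rule field_le_epsilon)
  then have "?c *\<^sub>R pd ks \<psi> x = (1 / fact i :: real) *\<^sub>R moment_op \<psi> ks i u \<psi> x" by simp
  then have "moment_op \<psi> ks i u \<psi> x = (fact i * ?c) *\<^sub>R pd ks \<psi> x"
    by (metis scaleR_scaleR nonzero_mult_div_cancel_left fact_nonzero times_divide_eq_right mult.right_neutral scaleR_one)
  then show ?case by (simp add: k_def scaleR_conv_of_real)
qed

text \<open>By the case of order 0 the kernel with base point 0 has integral 1. Integrating its
  series term by term gives multiples of the conjugate of the integral of \<open>\<psi>\<close>, so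
  this integral cannot vanish.\<close>

lemma integral_nonzero: "(\<integral>x. \<psi> x \<partial>lborel) \<noteq> 0"
proof
  assume 0: "(\<integral>x. \<psi> x \<partial>lborel) = 0"
  obtain x where x: "\<psi> x \<noteq> 0" using \<psi>_nonzero by blast
  have "moment_op \<psi> [] 0 0 \<psi> x = \<psi> x" using moment_op_self[of "[]" 0 0 x] by simp
  then have "(\<integral>v. kern \<psi> [] 0 v \<partial>lborel) = 1"
    using x by (simp add: moment_op_def moment_def vpow_def)
  moreover have "(\<integral>v. kern \<psi> [] 0 v \<partial>lborel) = 0"
  proof -
    note [measurable] = test_measurable'[OF \<psi>]
    obtain C where C: "0 < C" "\<And>v k. cmod (pd [] \<psi> (0 - node k) * cnj (\<psi> (v - node k))) \<le> C / W 0 (v - 0) * decay (0 - node k :: real^'n)"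
      using kern_term_bound[OF \<psi>, of 0] by (metis le0 list.size(3))
    let ?f = "\<lambda>k v. pd [] \<psi> (0 - node k) * cnj (\<psi> (v - node k))"
    have b: "cmod (?f k v) \<le> C * decay (0 - node k :: real^'n) * decay v" for k v
    proof -
      have "cmod (?f k v) \<le> C * decay (0 - node k :: real^'n) * (1 / W 0 v)" using C(2)[of k v] by simp
      also have "\<dots> \<le> C * decay (0 - node k :: real^'n) * decay v" using C(1) by (intro mult_left_mono inverse_W_le) simp
      finally show ?thesis .
    qed
    have int: "integrable lborel (?f k)" for k by (rule integrable_decay_bound[OF _ b]) simp
    have si: "summable (\<lambda>k. \<integral>v. norm (?f k v) \<partial>lborel)"
    proof (rule summable_comparison_test'[OF summable_mult[OF summable_decay_node[of 0], of "C * (\<integral>v. decay (v :: real^'n) \<partial>lborel)"], of 0])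
      show "norm (\<integral>v. norm (?f k v) \<partial>lborel) \<le> C * (\<integral>v. decay (v :: real^'n) \<partial>lborel) * decay (0 - node k :: real^'n)" for k
        using integral_decay_bound[OF _ b, of k] by (simp add: integral_nonneg_AE mult_ac)
    qed
    have "(\<integral>v. kern \<psi> [] 0 v \<partial>lborel) = (\<Sum>k. \<integral>v. ?f k v \<partial>lborel)"
      unfolding kern_def using integral_suminf[OF int _ si] kern_summable[OF \<psi>, of "[]" 0] by simp
    moreover have "(\<integral>v. cnj (\<psi> (v - node k)) \<partial>lborel) = 0" for k
    proof -
      have i: "integrable lborel \<psi>"
        using test_bounded_decay[OF \<psi>] integrable_decay_bound[of \<psi>] by (metis test_measurable'[OF \<psi>] le0 list.size(3) pd_Nil)
      have "(\<integral>v. \<psi> (- node k + 1 *\<^sub>R v) \<partial>lborel) = 0"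
        using lborel_integral_affine[OF _ i, of 1 "- node k"] 0 by simp
      then show ?thesis by (simp add: integral_cnj)
    qed
    ultimately show ?thesis by simp
  qed
  ultimately show False by simp
qed

text \<open>One letter is moved at a time. The inner derivative gives \<open>- t\<close>,
  integration by parts gives another sign, so each letter leaves a factor \<open>t\<close>; the
  moved letters arrive in a different order, which \<open>pd_move\<close> repairs.\<close>

lemma integration_by_parts:
  assumes \<theta>: "\<theta> \<in> test_space w r" and "length js + length ls \<le> r"
  shows "(\<integral>x. pd js \<psi> x * pd ls \<theta> (y - t *\<^sub>R x) \<partial>lborel) = t ^ length js *\<^sub>R (\<integral>x. \<psi> x * pd (js @ ls) \<theta> (y - t *\<^sub>R x) \<partial>lborel)"
  using assms(2)
proof (induction js arbitrary: ls)
  case (Cons i js)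
  let ?a = "pd js \<psi>" and ?a' = "pd (i # js) \<psi>" and ?b = "\<lambda>x. pd ls \<theta> (y - t *\<^sub>R x)" and ?b' = "\<lambda>x. pd (i # ls) \<theta> (y - t *\<^sub>R x)"
  have len: "length js \<le> r" "length (i # js) \<le> r" "length ls \<le> r" "length (i # ls) \<le> r" "length js < r" "length ls < r"
    using Cons.prems by auto
  note [measurable] = test_measurable[OF \<psi> len(1)] test_measurable[OF \<psi> len(2)] test_measurable[OF \<theta> len(3)] test_measurable[OF \<theta> len(4)]
  obtain C where C: "0 < C" "\<And>ks x. length ks \<le> r \<Longrightarrow> cmod (pd ks \<psi> x) \<le> C * decay x"
    using test_bounded_decay[OF \<psi>] by blast
  obtain D where D: "0 < D" "\<And>ks x. length ks \<le> r \<Longrightarrow> cmod (pd ks \<theta> x) \<le> D * decay x"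
    using test_bounded_decay[OF \<theta>] by blast
  have D1: "cmod (pd ks \<theta> x) \<le> D" if "length ks \<le> r" for ks x
    by (rule order_trans[OF D(2)[OF that] mult_left_le[OF decay_le1]]) (use D(1) in simp)
  have prod: "cmod (pd ks \<psi> x * pd ls \<theta> x') \<le> C * D * decay x" if "length ks \<le> r" "length ls \<le> r" for ks ls x x'
    unfolding norm_mult using mult_mono[OF C(2)[OF that(1), of x] D1[OF that(2), of x']] C(1) by (simp add: mult_ac)
  have i1: "integrable lborel (\<lambda>x. ?a' x * ?b x)" by (rule integrable_decay_bound[OF _ prod]) (use len in auto)
  have i2: "integrable lborel (\<lambda>x. ?a x * ?b' x)" by (rule integrable_decay_bound[OF _ prod]) (use len in auto)
  have "(\<integral>x. ?a' x * ?b x - t *\<^sub>R (?a x * ?b' x) \<partial>lborel) = 0"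
  proof (rule integral_directional_derivative_zero[where h="\<lambda>x. ?a x * ?b x" and C="C * D * (1 + \<bar>t\<bar>)"])
    fix x :: "real^'n" and s :: real
    have "((\<lambda>s. pd ls \<theta> ((y - t *\<^sub>R x) + s *\<^sub>R axis i 1)) has_vector_derivative pd (i # ls) \<theta> ((y - t *\<^sub>R x) + (- t * s) *\<^sub>R axis i 1)) (at (- t * s))"
      by (rule C_class_has_derivative[OF test_space_C_class[OF \<theta>] len(6)])
    then have "(((\<lambda>s. pd ls \<theta> ((y - t *\<^sub>R x) + s *\<^sub>R axis i 1)) \<circ> (\<lambda>s. - t * s)) has_vector_derivative
        (- t) *\<^sub>R pd (i # ls) \<theta> ((y - t *\<^sub>R x) + (- t * s) *\<^sub>R axis i 1)) (at s)"
      by (intro vector_diff_chain_at) (auto intro!: derivative_eq_intros)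
    then have b: "((\<lambda>s. ?b (x + s *\<^sub>R axis i 1)) has_vector_derivative (- t) *\<^sub>R ?b' (x + s *\<^sub>R axis i 1)) (at s)"
      by (simp add: o_def algebra_simps)
    have "((\<lambda>s. ?a (x + s *\<^sub>R axis i 1) * ?b (x + s *\<^sub>R axis i 1)) has_vector_derivative
       (?a (x + s *\<^sub>R axis i 1) * ((- t) *\<^sub>R ?b' (x + s *\<^sub>R axis i 1)) + ?a' (x + s *\<^sub>R axis i 1) * ?b (x + s *\<^sub>R axis i 1))) (at s)"
      by (rule has_vector_derivative_mult[OF C_class_has_derivative[OF test_space_C_class[OF \<psi>] len(5)] b])
    then show "((\<lambda>s. ?a (x + s *\<^sub>R axis i 1) * ?b (x + s *\<^sub>R axis i 1)) has_vector_derivative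
       (?a' (x + s *\<^sub>R axis i 1) * ?b (x + s *\<^sub>R axis i 1) - t *\<^sub>R (?a (x + s *\<^sub>R axis i 1) * ?b' (x + s *\<^sub>R axis i 1)))) (at s)"
      by (simp add: algebra_simps)
  next
    fix x :: "real^'n"
    have nn: "0 \<le> C * D * decay x" using C D by simp
    have "cmod (?a x * ?b x) \<le> C * D * decay x * 1" using prod[OF len(1) len(3)] by simp
    also have "\<dots> \<le> C * D * decay x * (1 + \<bar>t\<bar>)" using nn by (intro mult_left_mono) auto
    finally show "cmod (?a x * ?b x) \<le> C * D * (1 + \<bar>t\<bar>) * decay x" by (simp add: mult_ac)
    have "cmod (?a' x * ?b x - t *\<^sub>R (?a x * ?b' x)) \<le> cmod (?a' x * ?b x) + \<bar>t\<bar> * cmod (?a x * ?b' x)"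
      by (rule order_trans[OF norm_triangle_ineq4]) simp
    also have "\<dots> \<le> C * D * decay x + \<bar>t\<bar> * (C * D * decay x)"
      by (intro add_mono mult_left_mono prod len) auto
    finally show "cmod (?a' x * ?b x - t *\<^sub>R (?a x * ?b' x)) \<le> C * D * (1 + \<bar>t\<bar>) * decay x" by (simp add: algebra_simps)
  qed auto
  then have "(\<integral>x. ?a' x * ?b x \<partial>lborel) = t *\<^sub>R (\<integral>x. ?a x * ?b' x \<partial>lborel)"
    using i1 i2 by simp
  also have "(\<integral>x. ?a x * ?b' x \<partial>lborel) = t ^ length js *\<^sub>R (\<integral>x. \<psi> x * pd (js @ i # ls) \<theta> (y - t *\<^sub>R x) \<partial>lborel)"
    using Cons.IH[of "i # ls"] Cons.prems by simp
  also have "pd (js @ i # ls) \<theta> = pd ((i # js) @ ls) \<theta>"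
    using pd_move[OF test_space_C_class[OF \<theta>], of js ls i] Cons.prems by simp
  finally show ?case by simp
qed simp

text \<open>The identity passes from \<open>\<psi>\<close> to an arbitrary test function because a homogeneous differential
  operator annihilating \<open>\<psi>\<close> also annihilates \<open>\<psi>\<close> convolved with \<open>\<theta>\<close> at every scale; shrinking the scale
  leaves the operator applied to \<open>\<theta>\<close>, multiplied by the nonzero integral of \<open>\<psi>\<close>.\<close>

lemma moment_identity:
  assumes \<theta>: "\<theta> \<in> test_space w r" and ks: "length ks \<le> r" and i: "i \<le> length ks"
  shows "moment_op \<psi> ks i u \<theta> y = (if i = length ks then fact i * pd ks \<theta> y else 0)"
proof -
  \<comment> \<open>As \<open>d\<close> vanishes unless \<open>i\<close> is the length of
    \<open>ks\<close>, the operator \<open>H\<close> is homogeneous of order \<open>i\<close>. After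
    integration by parts all its terms carry the same factor \<open>t ^ i\<close>, which can be
    cancelled.\<close>
  define d :: complex where "d = (if i = length ks then fact i else 0)"
  define H where "H f z = moment_op \<psi> ks i u f z - d * pd ks f z" for f z
  have ir: "i \<le> r" using i ks by simp
  have H\<psi>: "H \<psi> x = 0" for x using moment_op_self[OF ks i, of u x] by (simp add: H_def d_def)
  note [measurable] = test_measurable'[OF \<psi>] test_measurable'[OF \<theta>]
  obtain C where C: "0 < C" "\<And>ks x. length ks \<le> r \<Longrightarrow> cmod (pd ks \<psi> x) \<le> C * decay x"
    using test_bounded_decay[OF \<psi>] by blast
  obtain D where D: "0 < D" "\<And>ks x. length ks \<le> r \<Longrightarrow> cmod (pd ks \<theta> x) \<le> D * decay x"
    using test_bounded_decay[OF \<theta>] by blast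
  have D1: "cmod (pd ks \<theta> x) \<le> D" if "length ks \<le> r" for ks x
    by (rule order_trans[OF D(2)[OF that] mult_left_le[OF decay_le1]]) (use D(1) in simp)
  have prod: "cmod (pd js \<psi> x * pd ls \<theta> x') \<le> C * D * decay x" if "length js \<le> r" "length ls \<le> r" for js ls x x'
    unfolding norm_mult using mult_mono[OF C(2)[OF that(1), of x] D1[OF that(2), of x']] C(1) by (simp add: mult_ac)
  have int: "integrable lborel (\<lambda>x. pd js \<psi> x * pd ls \<theta> (y - t *\<^sub>R x))" if "length js \<le> r" "length ls \<le> r" for js ls t
  proof -
    note [measurable] = test_measurable[OF \<psi> that(1)] test_measurable[OF \<theta> that(2)]
    show ?thesis by (rule integrable_decay_bound[OF _ prod[OF that]]) simp
  qed
  have vanish: "(\<integral>x. \<psi> x * H \<theta> (y - t *\<^sub>R x) \<partial>lborel) = 0" if t: "0 < t" for t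
  proof -
    let ?J = "\<lambda>js. \<integral>x. \<psi> x * pd js \<theta> (y - t *\<^sub>R x) \<partial>lborel"
    have i1: "integrable lborel (\<lambda>x. \<psi> x * pd js \<theta> (y - t *\<^sub>R x))" if "length js \<le> r" for js
      using int[of "[]" js t] that by simp
    have i2: "integrable lborel (\<lambda>x. pd js \<psi> x * \<theta> (y - t *\<^sub>R x))" if "length js \<le> r" for js
      using int[of js "[]" t] that by simp
    have ibp: "(\<integral>x. pd js \<psi> x * \<theta> (y - t *\<^sub>R x) \<partial>lborel) = t ^ length js *\<^sub>R ?J js" if "length js \<le> r" for js
      using integration_by_parts[OF \<theta>, of js "[]" y t] that by simp
    have "(\<integral>x. \<psi> x * H \<theta> (y - t *\<^sub>R x) \<partial>lborel) =
       (\<integral>x. (\<Sum>js\<in>lists_of i. moment \<psi> ks js u * (\<psi> x * pd js \<theta> (y - t *\<^sub>R x))) - d * (\<psi> x * pd ks \<theta> (y - t *\<^sub>R x)) \<partial>lborel)"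
      by (intro Bochner_Integration.integral_cong refl) (simp add: H_def moment_op_def right_diff_distrib sum_distrib_left mult_ac)
    also have "\<dots> = (\<Sum>js\<in>lists_of i. moment \<psi> ks js u * ?J js) - d * ?J ks"
      using ir ks by (subst Bochner_Integration.integral_diff Bochner_Integration.integral_sum;
          auto intro!: Bochner_Integration.integrable_sum integrable_mult_right i1 simp: lists_of_def)+
    finally have 1: "(\<integral>x. \<psi> x * H \<theta> (y - t *\<^sub>R x) \<partial>lborel) = (\<Sum>js\<in>lists_of i. moment \<psi> ks js u * ?J js) - d * ?J ks" .
    have "0 = (\<integral>x. H \<psi> x * \<theta> (y - t *\<^sub>R x) \<partial>lborel)" by (simp add: H\<psi>)
    also have "\<dots> = (\<integral>x. (\<Sum>js\<in>lists_of i. moment \<psi> ks js u * (pd js \<psi> x * \<theta> (y - t *\<^sub>R x))) - d * (pd ks \<psi> x * \<theta> (y - t *\<^sub>R x)) \<partial>lborel)"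
      by (intro Bochner_Integration.integral_cong refl) (simp add: H_def moment_op_def left_diff_distrib right_diff_distrib sum_distrib_left sum_distrib_right mult_ac)
    also have "\<dots> = (\<Sum>js\<in>lists_of i. moment \<psi> ks js u * (\<integral>x. pd js \<psi> x * \<theta> (y - t *\<^sub>R x) \<partial>lborel)) - d * (\<integral>x. pd ks \<psi> x * \<theta> (y - t *\<^sub>R x) \<partial>lborel)"
      using ir ks by (subst Bochner_Integration.integral_diff Bochner_Integration.integral_sum;
          auto intro!: Bochner_Integration.integrable_sum integrable_mult_right i2 simp: lists_of_def)+
    also have "\<dots> = (\<Sum>js\<in>lists_of i. moment \<psi> ks js u * (t ^ i *\<^sub>R ?J js)) - d * (t ^ i *\<^sub>R ?J ks)"
      using ir ks by (intro arg_cong2[of _ _ _ _ minus] sum.cong) (auto simp: ibp lists_of_def d_def)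
    also have "\<dots> = t ^ i *\<^sub>R ((\<Sum>js\<in>lists_of i. moment \<psi> ks js u * ?J js) - d * ?J ks)"
      by (simp add: scaleR_diff_right scaleR_sum_right)
    finally show ?thesis using 1 t by simp
  qed
  have H_cont: "continuous_on UNIV (H \<theta>)"
    unfolding H_def moment_op_def using ir ks
    by (intro continuous_intros test_space_continuous[OF \<theta>]) (auto simp: lists_of_def)
  define B where "B = (\<Sum>js\<in>(lists_of i :: 'n list set). cmod (moment \<psi> ks js u) * D) + cmod d * D"
  have H_bd: "cmod (H \<theta> z) \<le> B" for z
  proof -
    have "cmod (H \<theta> z) \<le> cmod (moment_op \<psi> ks i u \<theta> z) + cmod (d * pd ks \<theta> z)"
      unfolding H_def by (rule norm_triangle_ineq4)
    also have "\<dots> \<le> B"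
      unfolding B_def moment_op_def norm_mult[of d]
      using ir ks D1 by (intro add_mono sum_norm_le mult_left_mono) (auto simp: norm_mult lists_of_def intro!: mult_left_mono)
    finally show ?thesis .
  qed
  have [measurable]: "H \<theta> \<in> borel_measurable borel" using H_cont by (rule borel_measurable_continuous_onI)
  let ?s = "\<lambda>n. 1 / real (Suc n)"
  have "(\<lambda>n. \<integral>x. \<psi> x * H \<theta> (y - ?s n *\<^sub>R x) \<partial>lborel) \<longlonglongrightarrow> (\<integral>x. \<psi> x * H \<theta> y \<partial>lborel)"
  proof (rule integral_dominated_convergence[where w="\<lambda>x. C * B * decay x"])
    show "integrable lborel (\<lambda>x::real^'n. C * B * decay x)" by (intro integrable_mult_right integrable_decay)
    show "AE x in lborel. norm (\<psi> x * H \<theta> (y - ?s n *\<^sub>R x)) \<le> C * B * decay x" for n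
    proof (rule AE_I2)
      fix x
      have "norm (\<psi> x * H \<theta> (y - ?s n *\<^sub>R x)) \<le> (C * decay x) * B"
        unfolding norm_mult using C(2)[of "[]" x] C(1) by (intro mult_mono H_bd) auto
      then show "norm (\<psi> x * H \<theta> (y - ?s n *\<^sub>R x)) \<le> C * B * decay x" by (simp add: mult_ac)
    qed
    show "AE x in lborel. (\<lambda>n. \<psi> x * H \<theta> (y - ?s n *\<^sub>R x)) \<longlonglongrightarrow> \<psi> x * H \<theta> y"
    proof (rule AE_I2)
      fix x
      have "(\<lambda>n. ?s n) \<longlonglongrightarrow> 0" using LIMSEQ_inverse_real_of_nat by (simp add: inverse_eq_divide)
      then have "(\<lambda>n. y - ?s n *\<^sub>R x) \<longlonglongrightarrow> y - 0 *\<^sub>R x" by (intro tendsto_intros)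
      then have "(\<lambda>n. H \<theta> (y - ?s n *\<^sub>R x)) \<longlonglongrightarrow> H \<theta> y"
        using H_cont by (intro isCont_tendsto_compose[of y "H \<theta>"]) (auto simp: continuous_on_eq_continuous_at)
      then show "(\<lambda>n. \<psi> x * H \<theta> (y - ?s n *\<^sub>R x)) \<longlonglongrightarrow> \<psi> x * H \<theta> y" by (rule tendsto_mult_left)
    qed
  qed auto
  moreover have "(\<integral>x. \<psi> x * H \<theta> (y - ?s n *\<^sub>R x) \<partial>lborel) = 0" for n by (rule vanish) simp
  ultimately have "(\<lambda>n::nat. 0) \<longlonglongrightarrow> (\<integral>x. \<psi> x * H \<theta> y \<partial>lborel)" by simp
  then have "(\<integral>x. \<psi> x * H \<theta> y \<partial>lborel) = 0" by (metis LIMSEQ_unique tendsto_const)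
  then have "H \<theta> y = 0" using integral_nonzero by simp
  then show ?thesis by (simp add: H_def d_def split: if_splits)
qed

text \<open>The Taylor order is \<open>length ks\<close>, so the factor \<open>N ^ length ks\<close>
  from differentiation cancels the gain in the remainder exactly, and only the top term survives,
  equal to the derivative of \<open>\<theta>\<close>. Uniformity in \<open>a\<close> is essential,
  since in the application \<open>a\<close> varies with the scale.\<close>

lemma approx_converges:
  assumes \<theta>: "\<theta> \<in> test_space w r" and \<delta>: "0 < \<delta>"
  shows "\<exists>N0\<ge>1. \<forall>N\<ge>N0. \<forall>a. wnorm w r l (\<lambda>x. approx \<psi> N a \<theta> x - \<theta> x) \<le> \<delta>"
proof -
  let ?A = "{ks :: 'n list. length ks \<le> r}"
  let ?P = "\<lambda>ks N. \<forall>z u. w l z * cmod ((\<integral>v. \<theta> (z + (1 / N) *\<^sub>R v) * kern \<psi> ks u (u + v) \<partial>lborel)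
      - (\<Sum>i\<le>length ks. (1 / (fact i * N ^ i)) *\<^sub>R moment_op \<psi> ks i u \<theta> z)) \<le> \<delta> / N ^ length ks"
  have fin: "finite ?A" using finite_lists_length_le[of "UNIV :: 'n set" r] by simp
  have ex: "\<exists>N0. \<forall>N\<ge>N0. ?P ks N" if "ks \<in> ?A" for ks
  proof -
    have "length ks \<le> r" using that by simp
    from kern_taylor[OF \<theta> \<psi> this this \<delta>, of l] show ?thesis by blast
  qed
  obtain N0 where N0: "1 \<le> N0" "\<And>ks N. ks \<in> ?A \<Longrightarrow> N0 \<le> N \<Longrightarrow> ?P ks N"
    using eventually_finite_threshold[of ?A ?P, OF fin ex] by blast
  have "wnorm w r l (\<lambda>x. approx \<psi> N a \<theta> x - \<theta> x) \<le> \<delta>" if N: "N0 \<le> N" for N a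
  proof -
    have N1: "1 \<le> N" using N N0 by simp
    have ap: "approx \<psi> N a \<theta> \<in> test_space w r" using N1 by (intro approx_in_test[OF \<theta> \<psi>]) auto
    show ?thesis
    proof (rule wnorm_least[OF test_space_C_class[OF test_minus[OF ap \<theta>]]])
      fix ks :: "'n list" and z assume ks: "length ks \<le> r"
      let ?k = "length ks" and ?u = "a + N *\<^sub>R z"
      let ?I = "\<integral>v. \<theta> (z + (1 / N) *\<^sub>R v) * kern \<psi> ks ?u (?u + v) \<partial>lborel"
      have bd: "w l z * cmod (?I - (\<Sum>i\<le>?k. (1 / (fact i * N ^ i)) *\<^sub>R moment_op \<psi> ks i ?u \<theta> z)) \<le> \<delta> / N ^ ?k"
        using N0(2)[of ks N] ks N by blast
      have "(\<Sum>i\<le>?k. (1 / (fact i * N ^ i)) *\<^sub>R moment_op \<psi> ks i ?u \<theta> z)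
         = (\<Sum>i\<in>{?k}. (1 / (fact i * N ^ i)) *\<^sub>R moment_op \<psi> ks i ?u \<theta> z)"
        by (rule sum.mono_neutral_right) (auto simp: moment_identity[OF \<theta> ks])
      also have "\<dots> = (1 / N ^ ?k) *\<^sub>R pd ks \<theta> z"
        by (simp add: moment_identity[OF \<theta> ks] scaleR_conv_of_real)
      finally have "w l z * cmod (?I - (1 / N ^ ?k) *\<^sub>R pd ks \<theta> z) \<le> \<delta> / N ^ ?k"
        using bd by simp
      then have 1: "N ^ ?k * (w l z * cmod (?I - (1 / N ^ ?k) *\<^sub>R pd ks \<theta> z)) \<le> \<delta>"
        using N1 by (simp add: pos_le_divide_eq mult.commute)
      have "pd ks (\<lambda>x. approx \<psi> N a \<theta> x - \<theta> x) z = pd ks (approx \<psi> N a \<theta>) z - pd ks \<theta> z"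
        using C_class_lincomb(2)[OF test_space_C_class[OF ap] test_space_C_class[OF \<theta>] ks, of 1 "-1"] by simp
      also have "\<dots> = N ^ ?k *\<^sub>R (?I - (1 / N ^ ?k) *\<^sub>R pd ks \<theta> z)"
        using pd_approx(1)[OF \<theta> \<psi> _ ks, of N a z] N1 by (simp add: scaleR_diff_right)
      finally have "cmod (pd ks (\<lambda>x. approx \<psi> N a \<theta> x - \<theta> x) z) = N ^ ?k * cmod (?I - (1 / N ^ ?k) *\<^sub>R pd ks \<theta> z)"
        using N1 by simp
      then show "w l z * cmod (pd ks (\<lambda>x. approx \<psi> N a \<theta> x - \<theta> x) z) \<le> \<delta>"
        using 1 by (simp add: mult_ac)
    qed
  qed
  with N0(1) show ?thesis by blast
qed

end

section \<open>Exponential and polynomial weights\<close>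

lemma growth_function_mono: "growth_function M \<Longrightarrow> 0 \<le> s \<Longrightarrow> s \<le> t \<Longrightarrow> M s \<le> M t"
  unfolding growth_function_def mono_on_def by auto

lemma growth_function_superadditive: "growth_function M \<Longrightarrow> 0 \<le> s \<Longrightarrow> 0 \<le> t \<Longrightarrow> M s + M t \<le> M (s + t)"
  unfolding growth_function_def by auto

text \<open>Superadditivity gives linear growth along the multiples of a point \<open>t0\<close>
  with \<open>M t0\<close> positive, and monotonicity fills the gaps at the cost of the constant
  \<open>M t0\<close>. This is what lets the exponential weights absorb polynomials.\<close>

lemma growth_function_linear:
  assumes "growth_function M"
  shows "\<exists>c>0. \<exists>d. \<forall>t\<ge>0. c * t - d \<le> M t"
proof -
  note mono = growth_function_mono[OF assms] and super = growth_function_superadditive[OF assms]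
  have nonneg: "0 \<le> M t" if "0 \<le> t" for t using assms that unfolding growth_function_def by simp
  obtain t0 where t0: "0 \<le> t0" "M t0 \<noteq> 0" using assms by (auto simp: growth_function_def)
  have M0: "M 0 = 0" using super[of 0 0] nonneg[of 0] by simp
  have pos: "0 < t0" "0 < M t0" using t0 M0 nonneg[of t0] by (auto simp: less_le)
  have mult: "real k * M t0 \<le> M (real k * t0)" for k
  proof (induction k)
    case (Suc k)
    have "M t0 + M (real k * t0) \<le> M (t0 + real k * t0)" using pos by (intro super) auto
    with Suc show ?case by (simp add: algebra_simps)
  qed (simp add: M0)
  have "M t0 / t0 * t - M t0 \<le> M t" if t: "0 \<le> t" for t
  proof -
    define k where "k = nat \<lfloor>t / t0\<rfloor>"
    have k: "real k \<le> t / t0" "t / t0 < real k + 1"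
      using t pos(1) unfolding k_def by (auto simp: of_nat_nat)
    have "(t / t0 - 1) * M t0 \<le> real k * M t0" using k pos by (intro mult_right_mono) auto
    also have "\<dots> \<le> M (real k * t0)" by (rule mult)
    also have "\<dots> \<le> M t" using k pos by (intro mono) (auto simp: field_simps)
    finally show ?thesis by (simp add: algebra_simps)
  qed
  with pos show ?thesis by (intro exI[of _ "M t0 / t0"]) auto
qed

text \<open>The inequality between \<open>?x\<close> and \<open>exp ?x\<close> is raised to the
  power \<open>Suc p\<close>. Working with \<open>Suc p\<close> instead of \<open>p\<close> keeps
  the divisor nonzero when \<open>p = 0\<close>.\<close>

lemma power_le_exp:
  fixes c t :: real
  assumes c: "0 < c" and t: "0 \<le> t"
  shows "(1 + t) ^ p \<le> (real (Suc p) / c) ^ Suc p * exp c * exp (c * t)"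
proof -
  let ?q = "real (Suc p)"
  let ?x = "c * (1 + t) / ?q"
  have q: "0 < ?q" by simp
  have "0 \<le> ?x" using c t by simp
  moreover have "?x \<le> exp ?x" using exp_ge_add_one_self[of ?x] by linarith
  ultimately have "?x ^ Suc p \<le> exp ?x ^ Suc p" by (intro power_mono)
  also have "\<dots> = exp (?q * ?x)" by (rule exp_of_nat_mult[symmetric])
  also have "exp (?q * ?x) = exp c * exp (c * t)"
  proof -
    have "?q * ?x = c * (1 + t)" using q by (simp del: of_nat_Suc)
    also have "\<dots> = c + c * t" by (simp add: distrib_left)
    finally show ?thesis by (simp only: exp_add)
  qed
  finally have "?x ^ Suc p \<le> exp c * exp (c * t)" .
  then have "(?q / c) ^ Suc p * ?x ^ Suc p \<le> (?q / c) ^ Suc p * (exp c * exp (c * t))"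
    using c by (intro mult_left_mono) auto
  moreover have "(?q / c) ^ Suc p * ?x ^ Suc p = (1 + t) ^ Suc p"
    unfolding power_mult_distrib[symmetric] using c q by (simp del: of_nat_Suc power_Suc)
  moreover have "(1 + t) ^ p \<le> (1 + t) ^ Suc p" using t by (intro power_increasing) auto
  ultimately show ?thesis by (simp only: mult.assoc)
qed

lemma weight_family_K:
  assumes M: "growth_function M"
  shows "weight_family (K_weight M :: nat \<Rightarrow> real^'n::finite \<Rightarrow> real)"
proof
  note mono = growth_function_mono[OF M] and super = growth_function_superadditive[OF M]
  have nonneg: "0 \<le> M t" if "0 \<le> t" for t using M that unfolding growth_function_def by auto
  have sub: "M (s + t) \<le> M (2 * s) + M (2 * t)" if "0 \<le> s" "0 \<le> t" for s t
    using M that unfolding growth_function_def by auto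
  have K: "K_weight M l x = exp (M (real l * norm x))" for l and x :: "real^'n" by (simp add: K_weight_def)
  fix l l' p :: nat and x y :: "real^'n" and b :: real
  show "1 \<le> K_weight M l x" unfolding K by (simp add: nonneg)
  show "norm x \<le> norm y \<Longrightarrow> K_weight M l x \<le> K_weight M l y"
    unfolding K by (simp add: mono mult_left_mono)
  show "l \<le> l' \<Longrightarrow> K_weight M l x \<le> K_weight M l' x"
    unfolding K by (simp add: mono mult_right_mono)
  have "M (real l * norm (x + y)) \<le> M (real l * norm x + real l * norm y)"
    by (intro mono) (auto simp: norm_triangle_ineq mult_left_mono simp flip: distrib_left)
  also have "\<dots> \<le> M (real (2 * l) * norm x) + M (real (2 * l) * norm y)"
    using sub[of "real l * norm x" "real l * norm y"] by (simp add: mult.assoc)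
  finally show "K_weight M l (x + y) \<le> K_weight M (2 * l) x * K_weight M (2 * l) y"
    unfolding K by (simp flip: exp_add)
  show "\<exists>l' C. 0 < C \<and> (\<forall>x::real^'n. K_weight M l x * (1 + norm x) ^ p \<le> C * K_weight M l' x)"
  proof -
    obtain c d where c: "0 < c" "\<And>t. 0 \<le> t \<Longrightarrow> c * t - d \<le> M t" using growth_function_linear[OF M] by blast
    let ?C = "(real (Suc p) / c) ^ Suc p * exp c * exp d"
    \<comment> \<open>One unit of the index pays for the polynomial: it is bounded by a multiple of
      \<open>exp (M (norm x))\<close>, and superadditivity merges this factor with the weight of
      index \<open>l\<close> into that of index \<open>Suc l\<close>.\<close>
    have "K_weight M l x * (1 + norm x) ^ p \<le> ?C * K_weight M (Suc l) x" for x :: "real^'n"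
    proof -
      let ?t = "norm x"
      have "(1 + ?t) ^ p \<le> (real (Suc p) / c) ^ Suc p * exp c * exp (c * ?t)"
        by (rule power_le_exp[OF c(1)]) simp
      also have "\<dots> \<le> (real (Suc p) / c) ^ Suc p * exp c * (exp d * exp (M ?t))"
        using c(1) c(2)[of ?t] by (intro mult_left_mono) (auto simp flip: exp_add)
      finally have "exp (M (real l * ?t)) * (1 + ?t) ^ p \<le> exp (M (real l * ?t)) * (?C * exp (M ?t))"
        by (intro mult_left_mono) (auto simp: mult.assoc)
      also have "\<dots> = ?C * exp (M (real l * ?t) + M ?t)" by (simp add: exp_add)
      also have "\<dots> \<le> ?C * exp (M (real (Suc l) * ?t))"
        using super[of "real l * ?t" ?t] c(1) by (intro mult_left_mono) (auto simp: algebra_simps)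
      finally show ?thesis unfolding K .
    qed
    moreover have "0 < ?C" using c(1) by (intro mult_pos_pos zero_less_power) auto
    ultimately show ?thesis by blast
  qed
  show "\<exists>l' C. 0 < C \<and> (\<forall>x::real^'n. K_weight M l (b *\<^sub>R x) \<le> C * K_weight M l' x)"
  proof -
    define l' where "l' = nat \<lceil>real l * \<bar>b\<bar>\<rceil>"
    have l': "real l * \<bar>b\<bar> \<le> real l'" unfolding l'_def by linarith
    have "K_weight M l (b *\<^sub>R x) \<le> 1 * K_weight M l' x" for x :: "real^'n"
      unfolding K using mult_right_mono[OF l', of "norm x"] by (simp add: mono mult.assoc)
    then show ?thesis using zero_less_one by blast
  qed
qed

lemma weight_family_S: "weight_family (S_weight :: nat \<Rightarrow> real^'n::finite \<Rightarrow> real)"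
proof
  fix l l' p :: nat and x y :: "real^'n" and b :: real
  show one: "1 \<le> S_weight l x" for l and x :: "real^'n" unfolding S_weight_def by (intro one_le_power) simp
  show "norm x \<le> norm y \<Longrightarrow> S_weight l x \<le> S_weight l y"
    unfolding S_weight_def by (intro power_mono) auto
  show mono: "l \<le> l' \<Longrightarrow> S_weight l x \<le> S_weight l' x" for l l' and x :: "real^'n"
    unfolding S_weight_def by (intro power_increasing) auto
  have prod: "1 + norm (x + y) \<le> (1 + norm x) * (1 + norm y)"
  proof -
    have "(1 + norm x) * (1 + norm y) = 1 + norm x + norm y + norm x * norm y" by (simp add: algebra_simps)
    moreover have "0 \<le> norm x * norm y" by simp
    ultimately show ?thesis using norm_triangle_ineq[of x y] by linarith
  qed
  have "S_weight l (x + y) \<le> S_weight l x * S_weight l y"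
    unfolding S_weight_def power_mult_distrib[symmetric] using prod by (intro power_mono) auto
  also have "\<dots> \<le> S_weight (2 * l) x * S_weight (2 * l) y"
    using order_trans[OF zero_le_one one] by (intro mult_mono mono) auto
  finally show "S_weight l (x + y) \<le> S_weight (2 * l) x * S_weight (2 * l) y" .
  show "\<exists>l' C. 0 < C \<and> (\<forall>x::real^'n. S_weight l x * (1 + norm x) ^ p \<le> C * S_weight l' x)"
    by (intro exI[of _ "l + p"] exI[of _ 1]) (simp add: S_weight_def power_add)
  have "S_weight l (b *\<^sub>R x) \<le> (1 + \<bar>b\<bar>) ^ l * S_weight l x" for x :: "real^'n"
    unfolding S_weight_def power_mult_distrib[symmetric] by (intro power_mono) (auto simp: algebra_simps)
  moreover have "0 < (1 + \<bar>b\<bar>) ^ l" by (simp add: add_pos_nonneg)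
  ultimately show "\<exists>l' C. 0 < C \<and> (\<forall>x::real^'n. S_weight l (b *\<^sub>R x) \<le> C * S_weight l' x)" by blast
qed

section \<open>Self-reproduction of the scaling function\<close>

context weight_family begin

lemma test_affine_mem: "f \<in> test_space w r \<Longrightarrow> b \<noteq> 0 \<Longrightarrow> (\<lambda>x. f (c + b *\<^sub>R x)) \<in> test_space w r"
  using test_affine[of b r 0] by blast

lemma power2_decay_le: "(C * decay x)\<^sup>2 \<le> C\<^sup>2 * decay (x :: real^'n)"
  unfolding power_mult_distrib power2_eq_square[of "decay x"]
  by (intro mult_left_mono mult_left_le decay_le1) auto

lemma approx_integral:
  assumes \<theta>: "\<theta> \<in> test_space w r" and \<psi>: "\<psi> \<in> test_space w r" and N: "0 < N"
  shows "approx \<psi> N a \<theta> z = (\<integral>v. \<theta> (z + (1 / N) *\<^sub>R v) * kern \<psi> [] (a + N *\<^sub>R z) (a + N *\<^sub>R z + v) \<partial>lborel)"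
  using pd_approx(1)[OF \<theta> \<psi> N, where ks="[]" and a=a and z=z] by simp

lemma approx_lincomb:
  assumes \<theta>: "\<theta> \<in> test_space w r" and \<eta>: "\<eta> \<in> test_space w r" and \<psi>: "\<psi> \<in> test_space w r" and N: "0 < N"
  shows "approx \<psi> N a (\<lambda>x. c * \<theta> x + d * \<eta> x) z = c * approx \<psi> N a \<theta> z + d * approx \<psi> N a \<eta> z"
proof -
  let ?K = "\<lambda>v. kern \<psi> [] (a + N *\<^sub>R z) (a + N *\<^sub>R z + v)"
  have int: "integrable lborel (\<lambda>v. f (z + (1 / N) *\<^sub>R v) * ?K v)" if "f \<in> test_space w r" for f
    using pd_approx(2)[OF that \<psi> N, where ks="[]" and a=a and z=z] by simp
  have "approx \<psi> N a (\<lambda>x. c * \<theta> x + d * \<eta> x) z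
     = (\<integral>v. c * (\<theta> (z + (1 / N) *\<^sub>R v) * ?K v) + d * (\<eta> (z + (1 / N) *\<^sub>R v) * ?K v) \<partial>lborel)"
    unfolding approx_integral[OF test_lincomb(1)[OF \<theta> \<eta>] \<psi> N]
    by (intro Bochner_Integration.integral_cong refl) (simp add: algebra_simps)
  also have "\<dots> = c * approx \<psi> N a \<theta> z + d * approx \<psi> N a \<eta> z"
    unfolding approx_integral[OF \<theta> \<psi> N] approx_integral[OF \<eta> \<psi> N]
    using int[OF \<theta>] int[OF \<eta>]
    by (subst Bochner_Integration.integral_add) (auto intro!: integrable_mult_right)
  finally show ?thesis .
qed

lemma approx_cnj:
  assumes \<theta>: "\<theta> \<in> test_space w r" and \<psi>: "\<psi> \<in> test_space w r" and N: "N \<noteq> 0"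
  shows "approx (\<lambda>x. cnj (\<psi> x)) N a (\<lambda>x. cnj (\<theta> x)) z = cnj (approx \<psi> N a \<theta> z)"
proof -
  have "summable (\<lambda>k. cmod (pd [] (\<lambda>z. coeff \<psi> N a \<theta> k * \<psi> (a + N *\<^sub>R z - node k)) z))"
    by (rule summable_pd[OF approx_series[OF \<theta> \<psi> N]]) simp
  then have "(\<lambda>k. coeff \<psi> N a \<theta> k * \<psi> (a + N *\<^sub>R z - node k)) sums approx \<psi> N a \<theta> z"
    unfolding approx_def pd_Nil by (rule summable_sums[OF summable_norm_cancel])
  then have "(\<lambda>k. cnj (coeff \<psi> N a \<theta> k * \<psi> (a + N *\<^sub>R z - node k))) sums cnj (approx \<psi> N a \<theta> z)"
    by (subst sums_cnj)
  moreover have "cnj (coeff \<psi> N a \<theta> k) = coeff (\<lambda>x. cnj (\<psi> x)) N a (\<lambda>x. cnj (\<theta> x)) k" for k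
    unfolding coeff_def complex_cnj_scaleR Bochner_Integration.integral_cnj[symmetric] by simp
  ultimately show ?thesis unfolding approx_def by (simp add: sums_iff)
qed

section \<open>From density in the square norm to pointwise reproduction\<close>

lemma test_square_integrable:
  assumes f: "f \<in> test_space w r"
  shows "integrable lborel (\<lambda>x. (cmod (f x))\<^sup>2)"
proof -
  note [measurable] = test_measurable'[OF f]
  obtain C where C: "0 < C" "\<And>x. cmod (f x) \<le> C * decay x"
    using test_bounded_decay[OF f] by (metis le0 list.size(3) pd_Nil)
  have "(cmod (f x))\<^sup>2 \<le> C\<^sup>2 * decay x" for x
  proof -
    have "(cmod (f x))\<^sup>2 \<le> (C * decay x)\<^sup>2" using C(2) by (intro power_mono) auto
    also have "\<dots> \<le> C\<^sup>2 * decay x" by (rule power2_decay_le)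
    finally show ?thesis .
  qed
  then show ?thesis
    by (intro Bochner_Integration.integrable_bound[OF integrable_mult_right[OF integrable_decay, of "C\<^sup>2"]]) auto
qed

text \<open>Arithmetic-geometric mean, \<open>2 a b \<le> a\<^sup>2 / e + e b\<^sup>2\<close>, takes the place of Cauchy--Schwarz.\<close>

lemma approx_le_L2:
  assumes \<psi>: "\<psi> \<in> test_space w r"
  shows "\<exists>A>0. \<forall>g\<in>test_space w r. \<forall>e>0. (\<integral>x. (cmod (g x))\<^sup>2 \<partial>lborel) \<le> e\<^sup>2 \<longrightarrow> (\<forall>z. cmod (approx \<psi> 1 0 g z) \<le> A * e)"
proof -
  obtain C where C: "0 < C" "\<And>u v. norm v ^ 0 * cmod (kern \<psi> [] u (u + v)) \<le> C * decay v"
    using norm_power_kern_bound[OF \<psi>, of 0] by (metis le0 list.size(3))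
  define I where "I = (\<integral>x. decay (x :: real^'n) \<partial>lborel)"
  have I: "0 \<le> I" unfolding I_def by (intro integral_nonneg_AE) simp
  have "cmod (approx \<psi> 1 0 g z) \<le> (1 + C\<^sup>2 * I) * e"
    if g: "g \<in> test_space w r" and e: "0 < e" and n: "(\<integral>x. (cmod (g x))\<^sup>2 \<partial>lborel) \<le> e\<^sup>2" for g e z
  proof -
    let ?K = "\<lambda>v. kern \<psi> [] z (z + v)"
    let ?B = "\<lambda>v. (cmod (g (z + 1 *\<^sub>R v)))\<^sup>2 / e + e * (C\<^sup>2 * decay v)"
    have ig: "integrable lborel (\<lambda>v. (cmod (g (z + 1 *\<^sub>R v)))\<^sup>2)" 
      and eg: "(\<integral>v. (cmod (g (z + 1 *\<^sub>R v)))\<^sup>2 \<partial>lborel) = (\<integral>x. (cmod (g x))\<^sup>2 \<partial>lborel)"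
      using lborel_integrable_affine[OF _ test_square_integrable[OF g], of 1 z]
        lborel_integral_affine[OF _ test_square_integrable[OF g], of 1 z] by auto
    have pt: "cmod (g (z + 1 *\<^sub>R v) * ?K v) \<le> ?B v" for v
    proof -
      have am: "a * b \<le> a\<^sup>2 / e + e * b\<^sup>2" if "0 \<le> a" "0 \<le> b" for a b :: real
      proof -
        have "0 \<le> (a / e - b)\<^sup>2 * e" using e by simp
        also have "\<dots> = a\<^sup>2 / e - 2 * a * b + e * b\<^sup>2" using e by (simp add: power2_eq_square field_simps)
        finally show ?thesis using mult_nonneg_nonneg[OF that] by simp
      qed
      have k2: "(cmod (?K v))\<^sup>2 \<le> C\<^sup>2 * decay v"
      proof -
        have "(cmod (?K v))\<^sup>2 \<le> (C * decay v)\<^sup>2" using C(2)[of v z] by (intro power_mono) auto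
        also have "\<dots> \<le> C\<^sup>2 * decay v" by (rule power2_decay_le)
        finally show ?thesis .
      qed
      show ?thesis
        unfolding norm_mult using e by (intro order_trans[OF am add_left_mono[OF mult_left_mono[OF k2]]]) auto
    qed
    have "cmod (approx \<psi> 1 0 g z) \<le> (\<integral>v. ?B v \<partial>lborel)"
    proof -
      have "approx \<psi> 1 0 g z = (\<integral>v. g (z + 1 *\<^sub>R v) * ?K v \<partial>lborel)"
        using approx_integral[OF g \<psi>, of 1 0 z] by simp
      also have "cmod \<dots> \<le> (\<integral>v. cmod (g (z + 1 *\<^sub>R v) * ?K v) \<partial>lborel)" by (rule integral_norm_bound)
      also have "\<dots> \<le> (\<integral>v. ?B v \<partial>lborel)"
      proof (rule integral_mono)
        show "integrable lborel (\<lambda>v. cmod (g (z + 1 *\<^sub>R v) * ?K v))"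
          using test_shift_kern_integrable[OF g \<psi>, of "[]" z 1 z] by (intro integrable_norm) simp
        show "integrable lborel ?B"
          by (intro Bochner_Integration.integrable_add integrable_divide_zero integrable_mult_right integrable_decay) (use ig in simp)
      qed (rule pt)
      finally show ?thesis .
    qed
    also have "\<dots> = (\<integral>x. (cmod (g x))\<^sup>2 \<partial>lborel) / e + e * (C\<^sup>2 * I)"
      unfolding I_def eg[symmetric]
      by (subst Bochner_Integration.integral_add)
        (auto intro!: integrable_divide_zero integrable_mult_right integrable_decay ig[simplified])
    also have "\<dots> \<le> e\<^sup>2 / e + e * (C\<^sup>2 * I)" using n e by (intro add_mono divide_right_mono) auto
    also have "\<dots> = (1 + C\<^sup>2 * I) * e" using e by (simp add: power2_eq_square algebra_simps)
    finally show ?thesis .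
  qed
  moreover have "0 < 1 + C\<^sup>2 * I" using I by (simp add: add_pos_nonneg)
  ultimately show ?thesis by blast
qed

text \<open>At scale 1 and base point 0 the coefficients are inner products with the translates, so
  orthonormality leaves a single term of the series.\<close>

lemma approx_translate:
  assumes \<phi>: "\<phi> \<in> test_space w r"
    and orth: "\<And>m k. L2_inner (shift m \<phi>) (shift k \<phi>) = (if m = k then 1 else 0)"
  shows "approx \<phi> 1 0 (shift m \<phi>) = shift m \<phi>"
proof
  fix z
  obtain k0 where k0: "lat k0 = m" using bij_lat by (metis bij_pointE)
  have "coeff \<phi> 1 0 (shift m \<phi>) k = L2_inner (shift m \<phi>) (shift (lat k) \<phi>)" for k
    by (simp add: coeff_def L2_inner_def shift_def node_def)
  then have c: "coeff \<phi> 1 0 (shift m \<phi>) k = (if k = k0 then 1 else 0)" for k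
    using orth[of m "lat k"] k0 bij_lat by (auto simp: bij_def inj_def)
  have "(\<lambda>k. coeff \<phi> 1 0 (shift m \<phi>) k * \<phi> (0 + 1 *\<^sub>R z - node k)) sums
      (\<Sum>k\<in>{k0}. coeff \<phi> 1 0 (shift m \<phi>) k * \<phi> (0 + 1 *\<^sub>R z - node k))"
    by (rule sums_finite) (auto simp: c)
  then show "approx \<phi> 1 0 (shift m \<phi>) z = shift m \<phi> z"
    unfolding approx_def using k0 by (simp add: sums_iff c shift_def node_def)
qed

lemma shift_in_test:
  assumes "\<phi> \<in> test_space w r"
  shows "shift m \<phi> \<in> test_space w r"
proof -
  have "(\<lambda>x. \<phi> (- lattice_pt m + 1 *\<^sub>R x)) \<in> test_space w r" by (rule test_affine_mem[OF assms]) simp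
  then show ?thesis by (simp add: shift_def[abs_def])
qed

lemma approx_translate_sum:
  assumes \<phi>: "\<phi> \<in> test_space w r" and orth: "\<And>m k. L2_inner (shift m \<phi>) (shift k \<phi>) = (if m = k then 1 else 0)"
    and "finite I"
  shows "approx \<phi> 1 0 (\<lambda>x. \<Sum>m\<in>I. c m * shift m \<phi> x) z = (\<Sum>m\<in>I. c m * shift m \<phi> z)"
    and "(\<lambda>x. \<Sum>m\<in>I. c m * shift m \<phi> x) \<in> test_space w r"
  using \<open>finite I\<close>
proof (induction I)
  case empty
  { case 1 show ?case
      using approx_lincomb[OF \<phi> \<phi> \<phi>, of 1 0 0 0 z] by simp }
  { case 2 show ?case by (simp add: test_space_zero) }
next
  case (insert m I)
  note s = shift_in_test[OF \<phi>, of m]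
  { case 1 show ?case
      using approx_lincomb[OF s insert.IH(2) \<phi>, of 1 0 "c m" 1 z] insert approx_translate[OF \<phi> orth, of m] by simp }
  { case 2 show ?case using test_lincomb(1)[OF s insert.IH(2), of "c m" 1] insert.hyps by simp }
qed

text \<open>Finite combinations of translates are reproduced, so the defect \<open>D\<close> of
  \<open>h\<close> is that of the small difference \<open>g\<close>. The image of \<open>g\<close>
  is uniformly small, while \<open>g\<close> is small only in mean; but \<open>D\<close> is
  continuous, so a nonzero value would force it to stay above \<open>\<eta>\<close> on a whole ball,
  against the bound for the integral over that ball.\<close>

lemma approx_reproduces:
  assumes \<phi>: "\<phi> \<in> test_space w r" and h: "h \<in> test_space w r"
    and orth: "\<And>m k. L2_inner (shift m \<phi>) (shift k \<phi>) = (if m = k then 1 else 0)"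
    and dense: "\<And>e. 0 < e \<Longrightarrow> \<exists>I c. finite I \<and> L2_norm (\<lambda>x. h x - (\<Sum>m\<in>I. c m * shift m \<phi> x)) < e"
  shows "approx \<phi> 1 0 h = h"
proof (rule ccontr)
  assume "approx \<phi> 1 0 h \<noteq> h"
  then obtain x0 where "approx \<phi> 1 0 h x0 \<noteq> h x0" by (auto simp: fun_eq_iff)
  then have x0: "h x0 - approx \<phi> 1 0 h x0 \<noteq> 0" by simp
  define D where "D x = h x - approx \<phi> 1 0 h x" for x
  have Q: "approx \<phi> 1 0 h \<in> test_space w r" by (rule approx_in_test[OF h \<phi>]) simp
  have Dc: "continuous_on UNIV D" unfolding D_def
    using test_space_continuous[OF h, of "[]"] test_space_continuous[OF Q, of "[]"] by (intro continuous_intros) auto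
  define \<eta> where "\<eta> = cmod (D x0) / 2"
  have \<eta>: "0 < \<eta>" using x0 by (simp add: \<eta>_def D_def)
  have "isCont D x0" using Dc by (simp add: continuous_on_eq_continuous_at)
  then obtain \<rho> where \<rho>: "0 < \<rho>" "\<And>x. dist x x0 < \<rho> \<Longrightarrow> dist (D x) (D x0) < \<eta>"
    using \<eta> unfolding continuous_at_eps_delta by blast
  let ?B = "ball x0 \<rho>"
  have big: "\<eta> \<le> cmod (D x)" if "x \<in> ?B" for x
    using \<rho>(2)[of x] that norm_triangle_ineq2[of "D x0" "D x"]
    by (simp add: \<eta>_def dist_norm norm_minus_commute mem_ball)
  obtain A where A: "0 < A" "\<And>g e z. g \<in> test_space w r \<Longrightarrow> 0 < e \<Longrightarrow> (\<integral>x. (cmod (g x))\<^sup>2 \<partial>lborel) \<le> e\<^sup>2 \<Longrightarrow> cmod (approx \<phi> 1 0 g z) \<le> A * e"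
    using approx_le_L2[OF \<phi>] by blast
  define b where "b = measure lborel ?B"
  have b: "0 < b" unfolding b_def using \<rho>(1) by (simp add: content_ball unit_ball_vol_pos)
  have bound: "\<eta> * b \<le> e * (1 + (1 + A) * b)" if e: "0 < e" for e
  proof -
    obtain I c where I: "finite I" "L2_norm (\<lambda>x. h x - (\<Sum>m\<in>I. c m * shift m \<phi> x)) < e" using dense[OF e] by blast
    define s where "s x = (\<Sum>m\<in>I. c m * shift m \<phi> x)" for x
    define g where "g x = h x - s x" for x
    have s: "s \<in> test_space w r" unfolding s_def[abs_def] by (rule approx_translate_sum(2)[OF \<phi> orth I(1)])
    have g: "g \<in> test_space w r" unfolding g_def[abs_def] by (rule test_minus[OF h s])
    have g2: "(\<integral>x. (cmod (g x))\<^sup>2 \<partial>lborel) \<le> e\<^sup>2"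
    proof -
      have nn: "0 \<le> (\<integral>x. (cmod (g x))\<^sup>2 \<partial>lborel)" by (intro integral_nonneg_AE) simp
      have "sqrt (\<integral>x. (cmod (g x))\<^sup>2 \<partial>lborel) \<le> e" using I(2) by (simp add: L2_norm_def g_def s_def)
      then have "(sqrt (\<integral>x. (cmod (g x))\<^sup>2 \<partial>lborel))\<^sup>2 \<le> e\<^sup>2" by (intro power_mono) (auto simp: nn)
      then show ?thesis using nn by simp
    qed
    have D: "D x = g x - approx \<phi> 1 0 g x" for x
    proof -
      have "approx \<phi> 1 0 g x = approx \<phi> 1 0 h x - approx \<phi> 1 0 s x"
        using approx_lincomb[OF h s \<phi>, of 1 0 1 "-1" x] by (simp add: g_def[abs_def])
      moreover have "approx \<phi> 1 0 s x = s x"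
        using approx_translate_sum(1)[OF \<phi> orth I(1), of c x] by (simp add: s_def[abs_def])
      ultimately show ?thesis by (simp add: D_def g_def)
    qed
    have pt: "indicator ?B x * \<eta> \<le> (cmod (g x))\<^sup>2 / e + indicator ?B x * (e + A * e)" for x
    proof (cases "x \<in> ?B")
      case True
      have "cmod (g x) \<le> (cmod (g x))\<^sup>2 / e + e"
      proof (cases "cmod (g x) \<le> e")
        case False
        then have "e * cmod (g x) \<le> (cmod (g x))\<^sup>2" using e by (simp add: power2_eq_square mult_right_mono)
        then have "cmod (g x) \<le> (cmod (g x))\<^sup>2 / e" using e by (simp add: pos_le_divide_eq mult.commute)
        then show ?thesis using e by simp
      qed (use e in \<open>simp add: add_increasing\<close>)
      moreover have "\<eta> \<le> cmod (g x) + cmod (approx \<phi> 1 0 g x)"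
        using big[OF True] norm_triangle_ineq4[of "g x" "approx \<phi> 1 0 g x"] unfolding D by linarith
      moreover have "cmod (approx \<phi> 1 0 g x) \<le> A * e" by (rule A(2)[OF g e g2])
      ultimately show ?thesis using True by simp
    qed (use e in simp)
    have iB: "integrable lborel (\<lambda>x. indicator ?B x * t)" for t :: real
      using \<rho>(1) by (intro integrable_mult_left integrable_real_indicator) (auto simp: emeasure_ball)
    have "\<eta> * b = (\<integral>x. indicator ?B x * \<eta> \<partial>lborel)" by (simp add: b_def)
    also have "\<dots> \<le> (\<integral>x. (cmod (g x))\<^sup>2 / e + indicator ?B x * (e + A * e) \<partial>lborel)"
      by (intro integral_mono iB Bochner_Integration.integrable_add integrable_divide_zero test_square_integrable[OF g] pt)
    also have "\<dots> = (\<integral>x. (cmod (g x))\<^sup>2 \<partial>lborel) / e + b * (e + A * e)"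
      unfolding Bochner_Integration.integral_add[OF integrable_divide_zero[OF test_square_integrable[OF g]] iB]
      by (simp add: b_def)
    also have "\<dots> \<le> e\<^sup>2 / e + b * (e + A * e)" using g2 e by (intro add_mono divide_right_mono) auto
    also have "\<dots> = e * (1 + (1 + A) * b)" using e by (simp add: power2_eq_square algebra_simps)
    finally show ?thesis .
  qed
  \<comment> \<open>With \<open>e = \<eta> * b / (2 * T)\<close> the bound becomes half of its own
    left-hand side, which is positive.\<close>
  define T where "T = 1 + (1 + A) * b"
  have T: "0 < T" using A b by (simp add: T_def add_pos_pos)
  have "\<eta> * b \<le> \<eta> * b / (2 * T) * T" using bound[of "\<eta> * b / (2 * T)"] \<eta> b T by (simp add: T_def)
  then have "\<eta> * b \<le> \<eta> * b / 2" using T by simp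
  with \<eta> b show False by simp
qed

end

section \<open>Dyadic dilations in a multiresolution analysis\<close>

lemma MRA_dilate_down:
  assumes "is_MRA V" "f \<in> V (int j)"
  shows "(\<lambda>x. f ((1 / 2 ^ j) *\<^sub>R x)) \<in> V 0"
  using assms(2)
proof (induction j arbitrary: f)
  case (Suc j)
  have "(\<lambda>x. (\<lambda>x. f ((1 / 2) *\<^sub>R x)) (2 *\<^sub>R x)) \<in> V (int j + 1)" using Suc.prems by (simp add: add.commute)
  moreover have "\<forall>j f. f \<in> V j \<longleftrightarrow> (\<lambda>x. f (2 *\<^sub>R x)) \<in> V (j + 1)"
    using assms(1) by (simp add: is_MRA_def)
  ultimately have "(\<lambda>x. f ((1 / 2) *\<^sub>R x)) \<in> V (int j)" by blast
  from Suc.IH[OF this] show ?case by simp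
qed simp

lemma MRA_mono:
  assumes "is_MRA V" "f \<in> V 0"
  shows "f \<in> V (int j)"
proof (induction j)
  case (Suc j)
  have "V (int j) \<subseteq> V (int j + 1)" using assms(1) unfolding is_MRA_def by (elim conjE) (rule spec)
  with Suc show ?case by (auto simp: add.commute)
qed (use assms in simp)

text \<open>The dilate of \<open>\<phi>\<close> by \<open>1 / 2 ^ j\<close> lies in
  \<open>V 0\<close> and is again a test function, so pointwise reproduction at unit scale applies;
  rescaling the integral form of this identity yields scale \<open>2 ^ j\<close>. Conjugation adapts
  the result to the bilinear pairing.\<close>

lemma (in weight_family) MRA_refinable:
  assumes mra: "is_MRA V" and sc: "scaling_function V \<phi>" and \<phi>: "\<phi> \<in> test_space w r"
  shows "refinable w r (\<lambda>x. cnj (\<phi> x))"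
proof -
  have onb: "\<And>m. shift m \<phi> \<in> V 0" "\<And>m k. L2_inner (shift m \<phi>) (shift k \<phi>) = (if m = k then 1 else 0)"
    "\<And>f e. f \<in> V 0 \<Longrightarrow> 0 < e \<Longrightarrow> \<exists>I c. finite I \<and> L2_norm (\<lambda>x. f x - (\<Sum>m\<in>I. c m * shift m \<phi> x)) < e"
    using sc unfolding scaling_function_def translates_onb_def by auto
  have "shift 0 \<phi> = \<phi>" by (simp add: shift_def[abs_def] lattice_pt_def zero_vec_def[symmetric])
  with onb(1)[of 0] have \<phi>0: "\<phi> \<in> V 0" by simp
  have rep: "approx \<phi> (2 ^ j) 0 \<phi> = \<phi>" for j
  proof
    fix x
    let ?h = "\<lambda>x. \<phi> ((1 / 2 ^ j) *\<^sub>R x)"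
    have h: "?h \<in> test_space w r"
      using test_affine_mem[OF \<phi>, of "1 / 2 ^ j" 0] by simp
    have "?h \<in> V 0" by (intro MRA_dilate_down[OF mra] MRA_mono[OF mra \<phi>0])
    then have "approx \<phi> 1 0 ?h = ?h" by (intro approx_reproduces[OF \<phi> h onb(2) onb(3)])
    then have "approx \<phi> 1 0 ?h (2 ^ j *\<^sub>R x) = \<phi> x" by simp
    moreover have "approx \<phi> 1 0 ?h (2 ^ j *\<^sub>R x) = approx \<phi> (2 ^ j) 0 \<phi> x"
      using approx_integral[OF h \<phi>, of 1 0 "2 ^ j *\<^sub>R x"] approx_integral[OF \<phi> \<phi>, of "2 ^ j" 0 x]
      by (simp add: scaleR_add_right)
    ultimately show "approx \<phi> (2 ^ j) 0 \<phi> x = \<phi> x" by simp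
  qed
  show ?thesis
  proof (unfold_locales)
    show "(\<lambda>x. cnj (\<phi> x)) \<in> test_space w r" by (rule test_space_cnj[OF \<phi>])
    show "\<exists>x. cnj (\<phi> x) \<noteq> 0"
    proof (rule ccontr)
      assume "\<not> ?thesis"
      then have "\<And>x. \<phi> x = 0" by simp
      then have "L2_inner (shift 0 \<phi>) (shift 0 \<phi>) = 0" by (simp add: L2_inner_def shift_def)
      then show False using onb(2)[of 0 0] by simp
    qed
    show "approx (\<lambda>x. cnj (\<phi> x)) (2 ^ j) 0 (\<lambda>x. cnj (\<phi> x)) = (\<lambda>x. cnj (\<phi> x))" for j
      using approx_cnj[OF \<phi> \<phi>, of "2 ^ j" 0] rep[of j] by (simp add: fun_eq_iff)
  qed
qed

section \<open>Zooming into projections of distributions\<close>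

context weight_family begin

text \<open>No uniformity in \<open>\<epsilon>\<close> is claimed; that is left to the uniform
  boundedness principle. With division by zero equal to zero, the claim holds also for
  \<open>c = 0\<close>, so the normalising factor may be arbitrary.\<close>

lemma bounded_functional_dilate:
  assumes f: "bounded_functional w r f" and \<epsilon>: "0 < \<epsilon>"
  shows "bounded_functional w r (\<lambda>\<theta>. dilate f x0 \<epsilon> \<theta> / c)"
proof -
  let ?T = "\<lambda>\<theta> y. \<theta> ((1 / \<epsilon>) *\<^sub>R (y - x0))" and ?c = "- ((1 / \<epsilon>) *\<^sub>R x0)"
  have b: "1 / \<epsilon> \<noteq> 0" using \<epsilon> by simp
  have T: "?T \<theta> = (\<lambda>y. \<theta> (?c + (1 / \<epsilon>) *\<^sub>R y))" for \<theta> :: "real^'n \<Rightarrow> complex" by (simp add: scaleR_diff_right)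
  have mem: "?T \<theta> \<in> test_space w r" if "\<theta> \<in> test_space w r" for \<theta>
    unfolding T by (rule test_affine_mem[OF that b])
  obtain l C where C: "0 < C" "\<And>\<phi>. \<phi> \<in> test_space w r \<Longrightarrow> cmod (f \<phi>) \<le> C * wnorm w r l \<phi>"
    using f unfolding bounded_functional_def by blast
  obtain l' D where D: "0 < D" "\<And>\<theta>. \<theta> \<in> test_space w r \<Longrightarrow> wnorm w r l (?T \<theta>) \<le> D * w l' ?c * wnorm w r l' \<theta>"
    using test_affine[OF b, of r l] unfolding T by blast
  let ?K = "cmod (1 / (of_real (\<epsilon> ^ CARD('n)) * c))"
  have d: "dilate f x0 \<epsilon> \<theta> / c = (1 / (of_real (\<epsilon> ^ CARD('n)) * c)) * f (?T \<theta>)" for \<theta>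
    by (simp add: dilate_def)
  have "cmod (dilate f x0 \<epsilon> \<theta> / c) \<le> (?K * (C * (D * w l' ?c)) + 1) * wnorm w r l' \<theta>" if \<theta>: "\<theta> \<in> test_space w r" for \<theta>
  proof -
    have "cmod (dilate f x0 \<epsilon> \<theta> / c) \<le> ?K * (C * (D * w l' ?c * wnorm w r l' \<theta>))"
      unfolding d norm_mult using C(1)
      by (intro mult_left_mono order_trans[OF C(2)[OF mem[OF \<theta>]]] D \<theta>) auto
    also have "\<dots> \<le> (?K * (C * (D * w l' ?c)) + 1) * wnorm w r l' \<theta>"
      using wnorm_nonneg[OF \<theta>, of l'] by (simp add: algebra_simps)
    finally show ?thesis .
  qed
  moreover have "0 < ?K * (C * (D * w l' ?c)) + 1"
    using C(1) D(1) w_nonneg[of l' ?c] by (intro add_nonneg_pos mult_nonneg_nonneg) auto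
  moreover have "dilate f x0 \<epsilon> (\<lambda>x. \<theta> x + \<eta> x) / c = dilate f x0 \<epsilon> \<theta> / c + dilate f x0 \<epsilon> \<eta> / c"
    if "\<theta> \<in> test_space w r" "\<eta> \<in> test_space w r" for \<theta> \<eta>
    using f mem[OF that(1)] mem[OF that(2)] unfolding bounded_functional_def d by (simp add: distrib_left add_divide_distrib)
  moreover have "dilate f x0 \<epsilon> (\<lambda>x. a * \<theta> x) / c = a * (dilate f x0 \<epsilon> \<theta> / c)"
    if "\<theta> \<in> test_space w r" for a \<theta>
    using f mem[OF that] unfolding bounded_functional_def d by simp
  ultimately show ?thesis unfolding bounded_functional_def by blast
qed

lemma q0_eq_kern:
  assumes \<phi>: "\<phi> \<in> test_space w r"
  shows "q0 \<phi> x y = kern \<phi> [] x y"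
  unfolding q0_def kern_def node_def pd_Nil
  using kern_summable[OF \<phi>, of "[]" x y] by (intro suminf_lat[symmetric]) (simp add: node_def)

lemma translate_W_bound:
  assumes \<psi>: "\<psi> \<in> test_space w r"
  shows "\<exists>C. \<forall>k. cmod (c * \<psi> (u - node k)) \<le> C / W l (node k)"
proof -
  obtain D where D: "0 < D" "\<And>x. cmod (\<psi> x) \<le> D / W (2*l) x"
    using test_decay_W'[OF \<psi>, of "2*l"] by (metis le0 list.size(3) pd_Nil)
  have "cmod (c * \<psi> (u - t)) \<le> cmod c * (D * W (2*l) u) / W l t" for t
  proof -
    have "W l (u - (u - t)) \<le> W (2*l) u * W (2*l) (u - t)" by (rule W_diff)
    then have "1 / W (2*l) (u - t) \<le> W (2*l) u / W l t"
      using W_pos[of l t] W_pos[of "2*l" "u - t"] by (simp add: divide_simps mult_ac)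
    then have "D / W (2*l) (u - t) \<le> D * (W (2*l) u / W l t)"
      using D(1) mult_left_mono[of "1 / W (2*l) (u - t)" "W (2*l) u / W l t" D] by simp
    then have "cmod (\<psi> (u - t)) \<le> D * (W (2*l) u / W l t)" using D(2)[of "u - t"] by linarith
    then show ?thesis unfolding norm_mult using mult_left_mono[of _ _ "cmod c"] by fastforce
  qed
  then show ?thesis by blast
qed

text \<open>Both sides are the same series: expand the kernel over the lattice translates of the scaling
  function, so that the functional only ever acts on individual translates.\<close>

lemma fun_distr_q_proj:
  fixes \<phi> :: "real^'n \<Rightarrow> complex" and x0 :: "real^'n" and \<epsilon> :: real
  defines "N \<equiv> \<epsilon> * 2 powr (1 / \<epsilon>)" and "a \<equiv> (2 powr (1 / \<epsilon>)) *\<^sub>R x0" and "\<psi> \<equiv> (\<lambda>x. cnj (\<phi> x))"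
  assumes f: "bounded_functional w r f" and \<phi>: "\<phi> \<in> test_space w r" and \<theta>: "\<theta> \<in> test_space w r" and \<epsilon>: "0 < \<epsilon>"
  shows "fun_distr (\<lambda>x. q_proj \<phi> (1 / \<epsilon>) f (x0 + \<epsilon> *\<^sub>R x)) \<theta> = dilate f x0 \<epsilon> (approx \<psi> N a \<theta>)"
proof -
  define \<Lambda> where "\<Lambda> = 2 powr (1 / \<epsilon>)"
  have \<Lambda>: "0 < \<Lambda>" by (simp add: \<Lambda>_def)
  have N: "N = \<epsilon> * \<Lambda>" "0 < N" and a: "a = \<Lambda> *\<^sub>R x0" using \<epsilon> \<Lambda> by (simp_all add: N_def a_def \<Lambda>_def)
  have \<psi>: "\<psi> \<in> test_space w r" unfolding \<psi>_def by (rule test_space_cnj[OF \<phi>])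
  define e where "e k = (\<lambda>y. \<psi> (0 + \<Lambda> *\<^sub>R y - node k))" for k
  define s where "s = of_real (\<Lambda> ^ CARD('n)) * (1 :: complex)"
  have e: "e k \<in> test_space w r" for k unfolding e_def using \<Lambda> by (intro translate_bound[OF \<psi>]) simp
  have e_bd: "\<exists>l' C. \<forall>k. wnorm w r l (e k) \<le> C * w l' (node k)" for l
    unfolding e_def using translate_bound(2)[OF \<psi>, of \<Lambda> l 0] \<Lambda> by blast
  define c where "c u k = s * \<phi> (\<Lambda> *\<^sub>R u - node k)" for u k
  have c_bd: "\<exists>C. \<forall>k. cmod (c u k) \<le> C / W l (node k)" for u l
    unfolding c_def by (rule translate_W_bound[OF \<phi>])
  have qk: "q_kernel \<phi> (1 / \<epsilon>) u = (\<lambda>y. \<Sum>k. c u k * e k y)" for u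
  proof
    fix y
    have sm: "summable (\<lambda>k. pd [] \<phi> (\<Lambda> *\<^sub>R u - node k) * cnj (\<phi> (\<Lambda> *\<^sub>R y - node k)))"
      by (rule summable_norm_cancel[OF kern_summable[OF \<phi>]]) simp
    have "2 powr (real CARD('n) * (1 / \<epsilon>)) = \<Lambda> ^ CARD('n)"
      unfolding \<Lambda>_def by (simp add: powr_powr[symmetric] powr_realpow[symmetric] powr_powr mult.commute)
    then have "q_kernel \<phi> (1 / \<epsilon>) u y = s * kern \<phi> [] (\<Lambda> *\<^sub>R u) (\<Lambda> *\<^sub>R y)"
      unfolding q_kernel_def q0_eq_kern[OF \<phi>] s_def \<Lambda>_def[symmetric] by simp
    also have "\<dots> = (\<Sum>k. s * (pd [] \<phi> (\<Lambda> *\<^sub>R u - node k) * cnj (\<phi> (\<Lambda> *\<^sub>R y - node k))))"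
      unfolding kern_def by (rule suminf_mult[OF sm, symmetric])
    also have "\<dots> = (\<Sum>k. c u k * e k y)" by (simp add: c_def e_def \<psi>_def mult.assoc)
    finally show "q_kernel \<phi> (1 / \<epsilon>) u y = (\<Sum>k. c u k * e k y)" .
  qed
  have fck: "f (\<lambda>y. b * e k y) = b * f (e k)" for b k
    using f e unfolding bounded_functional_def by blast
  have fq: "q_proj \<phi> (1 / \<epsilon>) f u = (\<Sum>k. c u k * f (e k))" for u
    using bounded_functional_suminf[OF f weighted_series[OF e e_bd c_bd]]
    unfolding q_proj_def qk fck by (simp add: sums_iff)
  obtain l0 C0 where C0: "0 < C0" "\<And>\<phi>. \<phi> \<in> test_space w r \<Longrightarrow> cmod (f \<phi>) \<le> C0 * wnorm w r l0 \<phi>"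
    using f unfolding bounded_functional_def by blast
  obtain l1 C1 where C1: "\<And>k. wnorm w r l0 (e k) \<le> C1 * w l1 (node k)" using e_bd by blast
  have C1_0: "0 \<le> C1" using order_trans[OF wnorm_nonneg[OF e] C1] w_pos by (metis zero_le_mult_iff not_less)
  have fe: "cmod (f (e k)) \<le> C0 * C1 * w l1 (node k)" for k
    using order_trans[OF C0(2)[OF e] mult_left_mono[OF C1]] C0(1) by (simp add: mult.assoc)
  have fe_decay: "D / W l1 (node k) * cmod (f (e k)) \<le> D * (C0 * C1) * decay (0 - node k :: real^'n)" if "0 \<le> D" for D k
  proof -
    have "D / W l1 (node k) * cmod (f (e k)) \<le> D / W l1 (node k) * (C0 * C1 * w l1 (node k))"
      using that by (intro mult_left_mono fe) auto
    also have "\<dots> = D * (C0 * C1) * decay (0 - node k :: real^'n)"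
      unfolding W_eq using w_pos[of l1 "node k"] by simp
    finally show ?thesis .
  qed
  let ?i = "\<lambda>k x. \<theta> x * cnj (\<psi> (a + N *\<^sub>R x - node k))"
  let ?g = "\<lambda>k x. s * f (e k) * ?i k x"
  have int_g: "integrable lborel (?g k)" for k by (intro integrable_mult_right coeff_integrable[OF \<theta> \<psi>])
  have cg: "c (x0 + \<epsilon> *\<^sub>R x) k * f (e k) * \<theta> x = ?g k x" for x k
    by (simp add: c_def \<psi>_def a N algebra_simps)
  have sm_c: "summable (\<lambda>k. cmod (c u k * f (e k)))" for u
  proof -
    obtain D where D: "\<And>k. cmod (c u k) \<le> D / W l1 (node k)" using c_bd by blast
    have D0: "0 \<le> D" using order_trans[OF norm_ge_zero D[of 0]] W_pos[of l1 "node 0"] by (simp add: zero_le_divide_iff)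
    show ?thesis
    proof (rule summable_comparison_test'[OF summable_mult[OF summable_decay_node[of 0], of "D * (C0 * C1)"], of 0])
      show "norm (cmod (c u k * f (e k))) \<le> D * (C0 * C1) * decay (0 - node k :: real^'n)" for k
        using order_trans[OF mult_right_mono[OF D norm_ge_zero] fe_decay[OF D0]] by (simp add: norm_mult)
    qed
  qed
  have sm_g: "summable (\<lambda>k. norm (?g k x))" for x
    unfolding cg[symmetric] norm_mult[of _ "\<theta> x"] by (intro summable_mult2 sm_c)
  have si_g: "summable (\<lambda>k. \<integral>x. norm (?g k x) \<partial>lborel)"
  proof -
    obtain D where D: "0 < D" "\<And>k. (\<integral>x. cmod (?i k x) \<partial>lborel) \<le> D / W l1 (node k)"
      using coeff_integral_bound[OF \<theta> \<psi>] by blast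
    show ?thesis
    proof (rule summable_comparison_test'[OF summable_mult[OF summable_decay_node[of 0], of "cmod s * (D * (C0 * C1))"], of 0])
      fix k
      have nn: "0 \<le> (\<integral>x. cmod (?i k x) \<partial>lborel)" by (intro integral_nonneg_AE) simp
      have "(\<integral>x. norm (?g k x) \<partial>lborel) = cmod s * (cmod (f (e k)) * (\<integral>x. cmod (?i k x) \<partial>lborel))"
        unfolding norm_mult[of "s * f (e k)"] by (simp add: norm_mult)
      moreover have "cmod (f (e k)) * (\<integral>x. cmod (?i k x) \<partial>lborel) \<le> D * (C0 * C1) * decay (0 - node k :: real^'n)"
        using order_trans[OF mult_right_mono[OF D(2) norm_ge_zero] fe_decay[of D]] D(1) by (simp add: mult.commute)
      ultimately show "norm (\<integral>x. norm (?g k x) \<partial>lborel) \<le> cmod s * (D * (C0 * C1)) * decay (0 - node k :: real^'n)"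
        using nn mult_left_mono[of _ _ "cmod s"] by (fastforce simp: mult.assoc)
    qed
  qed
  have "fun_distr (\<lambda>x. q_proj \<phi> (1 / \<epsilon>) f (x0 + \<epsilon> *\<^sub>R x)) \<theta> = (\<integral>x. (\<Sum>k. ?g k x) \<partial>lborel)"
    unfolding fun_distr_def fq suminf_mult2[OF summable_norm_cancel[OF sm_c]] cg ..
  also have "\<dots> = (\<Sum>k. \<integral>x. ?g k x \<partial>lborel)"
    using sm_g by (intro integral_suminf int_g si_g) simp
  \<comment> \<open>The factor \<open>s\<close>, the power \<open>\<Lambda> ^ CARD('n)\<close> from
    the kernel, splits into \<open>N ^ CARD('n)\<close>, which belongs to \<open>coeff\<close>, and
    the power of \<open>1 / \<epsilon>\<close> that belongs to \<open>dilate\<close>.\<close>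
  also have "\<dots> = (\<Sum>k. of_real (1 / \<epsilon> ^ CARD('n)) * (coeff \<psi> N a \<theta> k * f (e k)))"
  proof (rule suminf_cong)
    fix k
    have "s = of_real (1 / \<epsilon> ^ CARD('n)) * of_real (N ^ CARD('n))"
      using \<epsilon> by (simp add: s_def N(1) power_mult_distrib)
    then show "(\<integral>x. ?g k x \<partial>lborel) = of_real (1 / \<epsilon> ^ CARD('n)) * (coeff \<psi> N a \<theta> k * f (e k))"
      unfolding coeff_def integral_mult_right_zero scaleR_conv_of_real by (simp only: mult_ac)
  qed
  also have "\<dots> = of_real (1 / \<epsilon> ^ CARD('n)) * f (\<lambda>y. \<Sum>k. coeff \<psi> N a \<theta> k * e k y)"
  proof -
    have "(\<lambda>k. coeff \<psi> N a \<theta> k * f (e k)) sums f (\<lambda>y. \<Sum>k. coeff \<psi> N a \<theta> k * e k y)"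
      using bounded_functional_suminf[OF f weighted_series[OF e e_bd]] coeff_bound[OF \<theta> \<psi>] unfolding fck by meson
    from sums_mult[OF this, of "of_real (1 / \<epsilon> ^ CARD('n))"] show ?thesis by (simp add: sums_iff)
  qed
  also have "(\<lambda>y. \<Sum>k. coeff \<psi> N a \<theta> k * e k y) = (\<lambda>y. approx \<psi> N a \<theta> ((1 / \<epsilon>) *\<^sub>R (y - x0)))"
  proof
    fix y
    have "a + N *\<^sub>R (1 / \<epsilon>) *\<^sub>R (y - x0) = 0 + \<Lambda> *\<^sub>R y"
      using \<epsilon> by (simp add: a N(1) scaleR_diff_right)
    then show "(\<Sum>k. coeff \<psi> N a \<theta> k * e k y) = approx \<psi> N a \<theta> ((1 / \<epsilon>) *\<^sub>R (y - x0))"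
      unfolding approx_def e_def by simp
  qed
  finally show ?thesis by (simp add: dilate_def)
qed

end

text \<open>The exponential is at least half the square of \<open>ln 2 / \<epsilon>\<close>; one of
  the two powers of \<open>1 / \<epsilon>\<close> is consumed by the factor
  \<open>\<epsilon>\<close>, the other one diverges.\<close>

lemma dilation_factor_at_top: "filterlim (\<lambda>\<epsilon>. \<epsilon> * 2 powr (1 / \<epsilon>)) at_top (at_right (0::real))"
proof (rule filterlim_at_top_mono)
  show "filterlim (\<lambda>\<epsilon>. (ln 2)\<^sup>2 / 2 * inverse \<epsilon>) at_top (at_right (0::real))"
    by (rule filterlim_tendsto_pos_mult_at_top[OF tendsto_const _ filterlim_inverse_at_top_right]) simp
  show "\<forall>\<^sub>F \<epsilon> in at_right (0::real). (ln 2)\<^sup>2 / 2 * inverse \<epsilon> \<le> \<epsilon> * 2 powr (1 / \<epsilon>)"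
    unfolding eventually_at_right_field
  proof (intro exI[of _ 1] conjI allI impI)
    fix \<epsilon> :: real assume \<epsilon>: "0 < \<epsilon>"
    let ?x = "ln 2 / \<epsilon>"
    have "0 \<le> ?x" using \<epsilon> by simp
    from exp_lower_Taylor_quadratic[OF this] have "?x\<^sup>2 / 2 \<le> exp ?x" using \<open>0 \<le> ?x\<close> by linarith
    then have "\<epsilon> * (?x\<^sup>2 / 2) \<le> \<epsilon> * exp ?x" using \<epsilon> by (intro mult_left_mono) auto
    then show "(ln 2)\<^sup>2 / 2 * inverse \<epsilon> \<le> \<epsilon> * 2 powr (1 / \<epsilon>)"
      using \<epsilon> by (simp add: powr_def power2_eq_square field_simps)
  qed simp
qed

lemma (in weight_family) quasiasymptotics_iff_projections:
  fixes f g :: "'n distr"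
  assumes L: "slowly_varying_at_0 L" and mra: "is_MRA V" "scaling_function V \<phi>"
    and \<phi>: "\<phi> \<in> test_space w r" and f: "f \<in> dual_space w r"
  shows "weakstar_lim (test_space w r)
          (\<lambda>\<epsilon> \<theta>. dilate f x0 \<epsilon> \<theta> / of_real (\<epsilon> powr \<alpha> * L \<epsilon>)) g
        \<longleftrightarrow>
        weakstar_lim (test_space w r)
          (\<lambda>\<epsilon> \<theta>. fun_distr (\<lambda>x. q_proj \<phi> (1 / \<epsilon>) f (x0 + \<epsilon> *\<^sub>R x)) \<theta> / of_real (\<epsilon> powr \<alpha> * L \<epsilon>)) g
        \<and> (\<forall>\<theta>\<in>test_space w r.
             (\<lambda>\<epsilon>. dilate f x0 \<epsilon> \<theta>) \<in> O[at_right 0](\<lambda>\<epsilon>. of_real (\<epsilon> powr \<alpha> * L \<epsilon>)))"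
proof -
  let ?X = "test_space w r"
  define D where "D \<epsilon> = (of_real (\<epsilon> powr \<alpha> * L \<epsilon>) :: complex)" for \<epsilon>
  define \<psi> where "\<psi> = (\<lambda>x. cnj (\<phi> x))"
  define T where "T \<epsilon> \<theta> = approx \<psi> (\<epsilon> * 2 powr (1 / \<epsilon>)) ((2 powr (1 / \<epsilon>)) *\<^sub>R x0) \<theta>" for \<epsilon> \<theta>
  define F where "F \<epsilon> \<theta> = dilate f x0 \<epsilon> \<theta> / D \<epsilon>" for \<epsilon> \<theta>
  define G where "G \<epsilon> \<theta> = fun_distr (\<lambda>x. q_proj \<phi> (1 / \<epsilon>) f (x0 + \<epsilon> *\<^sub>R x)) \<theta> / D \<epsilon>" for \<epsilon> \<theta>
  interpret R: refinable w r \<psi> unfolding \<psi>_def by (rule MRA_refinable[OF mra \<phi>])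
  have bf: "bounded_functional w r f" by (rule dual_bounded_functional[OF f])
  have F: "bounded_functional w r (F \<epsilon>)" if "0 < \<epsilon>" for \<epsilon>
    unfolding F_def[abs_def] by (rule bounded_functional_dilate[OF bf that])
  have T: "T \<epsilon> \<theta> \<in> ?X" if "0 < \<epsilon>" "\<theta> \<in> ?X" for \<epsilon> \<theta>
    unfolding T_def using that by (intro approx_in_test R.\<psi>) auto
  \<comment> \<open>By duality \<open>G\<close> is \<open>F\<close> composed with the operator
    \<open>T\<close>; linearity isolates the term in which only the approximation error is
    tested.\<close>
  have GF: "G \<epsilon> \<theta> = F \<epsilon> \<theta> + F \<epsilon> (\<lambda>x. T \<epsilon> \<theta> x - \<theta> x)" if "0 < \<epsilon>" "\<theta> \<in> ?X" for \<epsilon> \<theta>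
    using bounded_functional_minus[OF F[OF that(1)] T[OF that] that(2)] fun_distr_q_proj[OF bf \<phi> that(2,1), of x0]
    by (simp add: G_def F_def T_def \<psi>_def)
  have small: "((\<lambda>\<epsilon>. F \<epsilon> (\<lambda>x. T \<epsilon> \<theta> x - \<theta> x)) \<longlongrightarrow> 0) (at_right 0)"
    if bd: "\<And>\<theta>. \<theta> \<in> ?X \<Longrightarrow> \<exists>B. \<forall>\<^sub>F \<epsilon> in at_right 0. cmod (F \<epsilon> \<theta>) \<le> B" and \<theta>: "\<theta> \<in> ?X" for \<theta>
  \<comment> \<open>Uniform boundedness is proved for sequences of functionals, so the limit is
    tested along sequences of scales. There an eventual bound becomes a bound for all indices, as
    only finitely many are exceptional.\<close>
  proof (rule tendsto_at_right_sequentially[of 0 1])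
    fix S :: "nat \<Rightarrow> real"
    assume S: "\<And>n. 0 < S n" "S \<longlonglongrightarrow> 0"
    have lim: "filterlim S (at_right 0) sequentially"
      using S by (auto simp: filterlim_at less_imp_neq[OF S(1), symmetric] intro!: always_eventually)
    show "(\<lambda>n. F (S n) (\<lambda>x. T (S n) \<theta> x - \<theta> x)) \<longlonglongrightarrow> 0"
    proof (rule pointwise_bounded_null[where r=r and F="\<lambda>n. F (S n)" and \<eta>="\<lambda>n x. T (S n) \<theta> x - \<theta> x"])
      show "bounded_functional w r (F (S n))" for n by (rule F[OF S(1)])
      show "(\<lambda>x. T (S n) \<theta> x - \<theta> x) \<in> ?X" for n by (intro test_minus T S \<theta>)
      show "\<exists>B. \<forall>n. cmod (F (S n) \<theta>') \<le> B" if \<theta>': "\<theta>' \<in> ?X" for \<theta>'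
      proof -
        obtain B where "\<forall>\<^sub>F \<epsilon> in at_right 0. cmod (F \<epsilon> \<theta>') \<le> B" using bd[OF \<theta>'] by blast
        then have "\<forall>\<^sub>F n in sequentially. cmod (F (S n) \<theta>') \<le> B"
          using lim by (rule eventually_compose_filterlim)
        then have "Bseq (\<lambda>n. F (S n) \<theta>')" by (rule BfunI)
        then show ?thesis unfolding Bseq_def by blast
      qed
      show "(\<lambda>n. wnorm w r l (\<lambda>x. T (S n) \<theta> x - \<theta> x)) \<longlonglongrightarrow> 0" for l
      proof (rule tendstoI)
        fix e :: real assume e: "0 < e"
        obtain N0 where N0: "\<And>N a. N0 \<le> N \<Longrightarrow> wnorm w r l (\<lambda>x. approx \<psi> N a \<theta> x - \<theta> x) \<le> e / 2"
          using R.approx_converges[OF \<theta>, of "e / 2" l] e by auto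
        have "\<forall>\<^sub>F \<epsilon> in at_right 0. N0 \<le> \<epsilon> * 2 powr (1 / \<epsilon> :: real)"
          using dilation_factor_at_top by (simp add: filterlim_at_top)
        then have "\<forall>\<^sub>F n in sequentially. N0 \<le> S n * 2 powr (1 / S n)"
          using lim by (rule eventually_compose_filterlim)
        then show "\<forall>\<^sub>F n in sequentially. dist (wnorm w r l (\<lambda>x. T (S n) \<theta> x - \<theta> x)) 0 < e"
        proof eventually_elim
          case (elim n)
          have "0 \<le> wnorm w r l (\<lambda>x. T (S n) \<theta> x - \<theta> x)" by (intro wnorm_nonneg test_minus T S \<theta>)
          moreover have "wnorm w r l (\<lambda>x. T (S n) \<theta> x - \<theta> x) \<le> e / 2"
            unfolding T_def by (rule N0[OF elim])
          ultimately show ?case using e by simp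
        qed
      qed
    qed
  qed simp
  \<comment> \<open>Near the origin the normalising factor is nonzero; this makes a bound on the
    quotient \<open>F\<close> the same as the growth condition on the dilates.\<close>
  have pos: "\<forall>\<^sub>F \<epsilon> in at_right 0. D \<epsilon> \<noteq> 0"
  proof -
    obtain A where A: "0 < A" "\<forall>\<epsilon>\<in>{0<..A}. 0 < L \<epsilon>" using L unfolding slowly_varying_at_0_def by blast
    have "D \<epsilon> \<noteq> 0" if "0 < \<epsilon>" "\<epsilon> < A" for \<epsilon>
    proof -
      have "0 < L \<epsilon>" using A(2) that by simp
      then have "0 < \<epsilon> powr \<alpha> * L \<epsilon>" using that by simp
      then show ?thesis unfolding D_def of_real_eq_0_iff by linarith
    qed
    with A(1) show ?thesis unfolding eventually_at_right_field by blast
  qed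
  have right: "\<forall>\<^sub>F \<epsilon> in at_right (0::real). 0 < \<epsilon>" by (simp add: eventually_at_right_less)
  have FG: "((\<lambda>\<epsilon>. F \<epsilon> \<theta>) \<longlongrightarrow> g \<theta>) (at_right 0) \<longleftrightarrow> ((\<lambda>\<epsilon>. G \<epsilon> \<theta>) \<longlongrightarrow> g \<theta>) (at_right 0)"
    if bd: "\<And>\<theta>. \<theta> \<in> ?X \<Longrightarrow> \<exists>B. \<forall>\<^sub>F \<epsilon> in at_right 0. cmod (F \<epsilon> \<theta>) \<le> B" and \<theta>: "\<theta> \<in> ?X" for \<theta>
  proof -
    have "\<forall>\<^sub>F \<epsilon> in at_right 0. F \<epsilon> (\<lambda>x. T \<epsilon> \<theta> x - \<theta> x) = G \<epsilon> \<theta> - F \<epsilon> \<theta>"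
      using right by eventually_elim (simp add: GF[OF _ \<theta>])
    with small[OF bd \<theta>] have "((\<lambda>\<epsilon>. G \<epsilon> \<theta> - F \<epsilon> \<theta>) \<longlongrightarrow> 0) (at_right 0)" by (rule Lim_transform_eventually)
    then show ?thesis by (rule Lim_transform_eq[symmetric])
  qed
  have "weakstar_lim ?X F g \<longleftrightarrow> weakstar_lim ?X G g \<and> (\<forall>\<theta>\<in>?X. (\<lambda>\<epsilon>. dilate f x0 \<epsilon> \<theta>) \<in> O[at_right 0](D))"
  proof
    assume lim: "weakstar_lim ?X F g"
    have bd: "\<exists>B. \<forall>\<^sub>F \<epsilon> in at_right 0. cmod (F \<epsilon> \<theta>) \<le> B" if \<theta>: "\<theta> \<in> ?X" for \<theta>
    proof -
      have "((\<lambda>\<epsilon>. F \<epsilon> \<theta>) \<longlongrightarrow> g \<theta>) (at_right 0)" using lim \<theta> by (simp add: weakstar_lim_def)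
      from tendstoD[OF this zero_less_one] have "\<forall>\<^sub>F \<epsilon> in at_right 0. cmod (F \<epsilon> \<theta>) \<le> cmod (g \<theta>) + 1"
      proof eventually_elim
        case (elim \<epsilon>)
        then show ?case using norm_triangle_sub[of "F \<epsilon> \<theta>" "g \<theta>"] by (simp add: dist_norm)
      qed
      then show ?thesis by blast
    qed
    have "(\<lambda>\<epsilon>. dilate f x0 \<epsilon> \<theta>) \<in> O[at_right 0](D)" if \<theta>: "\<theta> \<in> ?X" for \<theta>
    proof -
      obtain B where "\<forall>\<^sub>F \<epsilon> in at_right 0. cmod (F \<epsilon> \<theta>) \<le> B" using bd[OF \<theta>] by blast
      then have "\<forall>\<^sub>F \<epsilon> in at_right 0. cmod (dilate f x0 \<epsilon> \<theta>) \<le> B * cmod (D \<epsilon>)"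
        using pos by eventually_elim (simp add: F_def norm_divide pos_divide_le_eq)
      then show ?thesis by (rule bigoI)
    qed
    moreover have "weakstar_lim ?X G g" using lim FG[OF bd] by (simp add: weakstar_lim_def)
    ultimately show "weakstar_lim ?X G g \<and> (\<forall>\<theta>\<in>?X. (\<lambda>\<epsilon>. dilate f x0 \<epsilon> \<theta>) \<in> O[at_right 0](D))" by blast
  next
    assume *: "weakstar_lim ?X G g \<and> (\<forall>\<theta>\<in>?X. (\<lambda>\<epsilon>. dilate f x0 \<epsilon> \<theta>) \<in> O[at_right 0](D))"
    have bd: "\<exists>B. \<forall>\<^sub>F \<epsilon> in at_right 0. cmod (F \<epsilon> \<theta>) \<le> B" if \<theta>: "\<theta> \<in> ?X" for \<theta>
    proof -
      obtain B where "\<forall>\<^sub>F \<epsilon> in at_right 0. cmod (dilate f x0 \<epsilon> \<theta>) \<le> B * cmod (D \<epsilon>)"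
        using * \<theta> by (auto elim: landau_o.bigE)
      then have "\<forall>\<^sub>F \<epsilon> in at_right 0. cmod (F \<epsilon> \<theta>) \<le> B"
        using pos by eventually_elim (simp add: F_def norm_divide pos_divide_le_eq)
      then show ?thesis by blast
    qed
    show "weakstar_lim ?X F g" using * FG[OF bd] by (simp add: weakstar_lim_def)
  qed
  then show ?thesis unfolding F_def[abs_def] G_def[abs_def] D_def[abs_def] .
qed

theorem theorem5p5:
  fixes r :: nat and \<alpha> :: real and x0 :: "real^'n::finite"
    and L :: "real \<Rightarrow> real" and M :: "real \<Rightarrow> real"
    and V :: "int \<Rightarrow> (real^'n \<Rightarrow> complex) set" and \<phi> :: "real^'n \<Rightarrow> complex"
    and f g :: "'n distr"
  assumes "slowly_varying_at_0 L" and "is_MRA V" and "scaling_function V \<phi>"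
  shows
    "(growth_function M \<and> \<phi> \<in> K_space M r \<and> g \<in> K_dual M r \<and> f \<in> K_dual M r \<longrightarrow>
       (weakstar_lim (K_space M r)
          (\<lambda>\<epsilon> \<theta>. dilate f x0 \<epsilon> \<theta> / of_real (\<epsilon> powr \<alpha> * L \<epsilon>)) g
        \<longleftrightarrow>
        weakstar_lim (K_space M r)
          (\<lambda>\<epsilon> \<theta>. fun_distr (\<lambda>x. q_proj \<phi> (1 / \<epsilon>) f (x0 + \<epsilon> *\<^sub>R x)) \<theta> / of_real (\<epsilon> powr \<alpha> * L \<epsilon>)) g
        \<and> (\<forall>\<theta>\<in>K_space M r.
             (\<lambda>\<epsilon>. dilate f x0 \<epsilon> \<theta>) \<in> O[at_right 0](\<lambda>\<epsilon>. of_real (\<epsilon> powr \<alpha> * L \<epsilon>)))))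
   \<and> (\<phi> \<in> S_space r \<and> g \<in> S_dual r \<and> f \<in> S_dual r \<longrightarrow>
       (weakstar_lim (S_space r)
          (\<lambda>\<epsilon> \<theta>. dilate f x0 \<epsilon> \<theta> / of_real (\<epsilon> powr \<alpha> * L \<epsilon>)) g
        \<longleftrightarrow>
        weakstar_lim (S_space r)
          (\<lambda>\<epsilon> \<theta>. fun_distr (\<lambda>x. q_proj \<phi> (1 / \<epsilon>) f (x0 + \<epsilon> *\<^sub>R x)) \<theta> / of_real (\<epsilon> powr \<alpha> * L \<epsilon>)) g
        \<and> (\<forall>\<theta>\<in>S_space r.
             (\<lambda>\<epsilon>. dilate f x0 \<epsilon> \<theta>) \<in> O[at_right 0](\<lambda>\<epsilon>. of_real (\<epsilon> powr \<alpha> * L \<epsilon>)))))"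
  using weight_family.quasiasymptotics_iff_projections[OF weight_family_K assms, of M r f x0 \<alpha> g]
    weight_family.quasiasymptotics_iff_projections[OF weight_family_S assms, of r f x0 \<alpha> g]
  by (intro conjI impI) (elim conjE; assumption)+

end
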